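(* Let $\Omega$ be a finite-dimensional real Euclidean space and $f_1,\dots,f_N\colon\Omega\to\mathbb{R}$ convex functions, each $L$-smooth for some $L>0$ (not assumed strongly convex), such that $E=\frac1N\sum_j f_j$ is coercive. For $\alpha>0$ let $f_j^\alpha=f_j+\frac\alpha2\|\cdot\|^2$, $E^\alpha=\frac1N\sum_jf_j^\alpha$, and let $\theta^\alpha$ be the unique minimizer of $E^\alpha$. Run DualFL (described in the context) on $f_1^\alpha,\dots,f_N^\alpha$ with $\rho=\alpha/(L+\alpha)$ and $\nu=\alpha$, and suppose that for some $\gamma>0$ the local iterates satisfy $\Gamma^{n,j}(\theta_j^{(n+1)})\le\frac1N\left(\frac{1-\sqrt\rho}{1+\gamma}\right)^n$ for all $1\le j\le N$, $n\ge0$. Then for $n\ge0$, \[ \|\nabla E(\theta^{(n)})\|\lesssim\left(1-\sqrt{\frac{\alpha}{L+\alpha}}\right)^{n/2}+\alpha\|\theta^\alpha\|. \] Moreover, let $\alpha_0>0$ and let $R_0>0$ be such that $\|\theta^\alpha\|\le R_0$ for all $\alpha\in(0,\alpha_0]$. If $\alpha=\epsilon/(2R_0)$ for some $\epsilon\in(0,2R_0\alpha_0]$, then the number of communication rounds $M_{\mathrm{comm}}$ needed to achieve $\|\nabla E(\theta^{(n)})\|\le\epsilon$ satisfies \[ M_{\mathrm{comm}}\le\left(1+2\sqrt{1+\frac{2LR_0}{\epsilon}}\right)\left(\log\frac1\epsilon+\mathrm{constant}\right)=\mathcal{O}\left(\frac1{\sqrt\epsilon}\log\frac1\epsilon\right),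 \] where the constant is independent of $n$.
   Context: $h$ is $L$-smooth if differentiable with $L$-Lipschitz gradient; $h^*$ is the Legendre--Fenchel conjugate; $A\lesssim B$ means $A\le CB$ with $C>0$ independent of $n$. (Such $R_0$ exists for every $\alpha_0>0$ by coercivity of $E$.) DualFL applied to convex functions $\tilde f_1,\dots,\tilde f_N$ (here $\tilde f_j=f_j^\alpha$) with hyperparameters $\rho\ge0$, $\nu>0$: set $\theta^{(0)}=\theta_j^{(0)}=0$, $\zeta_j^{(0)}=\zeta_j^{(-1)}=0$, $t_0=1$. For $n=0,1,\dots$: each client $j$ computes an approximate minimizer $\theta_j^{(n+1)}$ of $E^{n,j}(\theta)=\tilde f_j(\theta)-\nu\langle\zeta_j^{(n)},\theta\rangle$; $\theta^{(n+1)}=\frac1N\sum_j\theta_j^{(n+1)}$; $t_{n+1}=\frac{1-\rho t_n^2+\sqrt{(1-\rho t_n^2)^2+4t_n^2}}{2}$, $\beta_n=\frac{t_n-1}{t_{n+1}}\cdot\frac{1-t_{n+1}\rho}{1-\rho}$; $\zeta_j^{(n+1)}=(1+\beta_n)(\zeta_j^{(n)}+\theta^{(n+1)}-\theta_j^{(n+1)})-\beta_n(\zeta_j^{(n-1)}+\theta^{(n)}-\theta_j^{(n)})$. Primal-dual gap: $g_j=\tilde f_j-\frac\nu2\|\cdot\|^2$, $E^{n,j}_{\mathrm d}(\xi)=g_j^*(\xi)+\frac1{2\nu}\|\xi-\nu\zeta_j^{(n)}\|^2$, $\Gamma^{n,j}(\theta)=E^{n,j}(\theta)+E^{n,j}_{\mathrm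 d}(\nu(\zeta_j^{(n)}-\theta))$. *)

theory Defs
  imports "HOL-Analysis.Analysis"
begin

definition grad :: "('a::real_inner \<Rightarrow> real) \<Rightarrow> 'a \<Rightarrow> 'a" where
  "grad h x = (THE D. GDERIV h x :> D)"

definition L_smooth :: "('a::real_inner \<Rightarrow> real) \<Rightarrow> real \<Rightarrow> bool" where
  "L_smooth h L \<longleftrightarrow> (\<exists>g. (\<forall>x. GDERIV h x :> g x) \<and>
                          (\<forall>x y. norm (g x - g y) \<le> L * norm (x - y)))"

definition conj :: "('a::real_inner \<Rightarrow> real) \<Rightarrow> 'a \<Rightarrow> ereal" where
  "conj h \<xi> = (SUP x. ereal (\<xi> \<bullet> x - h x))"

definition minimizer :: "('a \<Rightarrow> real) \<Rightarrow> 'a" where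
  "minimizer F = (THE x. \<forall>y. F x \<le> F y)"

definition avg :: "nat \<Rightarrow> (nat \<Rightarrow> 'a::real_vector) \<Rightarrow> 'a" where
  "avg N v = (1 / real N) *\<^sub>R (\<Sum>j<N. v j)"

fun dfl_t :: "real \<Rightarrow> nat \<Rightarrow> real" where
  "dfl_t \<rho> 0 = 1"
| "dfl_t \<rho> (Suc n) =
     (1 - \<rho> * (dfl_t \<rho> n)\<^sup>2 + sqrt ((1 - \<rho> * (dfl_t \<rho> n)\<^sup>2)\<^sup>2 + 4 * (dfl_t \<rho> n)\<^sup>2)) / 2"

definition dfl_beta :: "real \<Rightarrow> nat \<Rightarrow> real" where
  "dfl_beta \<rho> n = (dfl_t \<rho> n - 1) / dfl_t \<rho> (Suc n) * ((1 - dfl_t \<rho> (Suc n) * \<rho>) / (1 - \<rho>))"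

text \<open>Server iterate: theta^(n) = average of local iterates th n j (th 0 j = 0 gives theta^(0) = 0).\<close>
definition dfl_theta :: "nat \<Rightarrow> (nat \<Rightarrow> nat \<Rightarrow> 'a::real_vector) \<Rightarrow> nat \<Rightarrow> 'a" where
  "dfl_theta N th n = avg N (th n)"

text \<open>Dual variables zeta_j^(n), with zeta^(0) = zeta^(-1) = 0.\<close>
fun dfl_zeta :: "nat \<Rightarrow> real \<Rightarrow> (nat \<Rightarrow> nat \<Rightarrow> 'a::real_vector) \<Rightarrow> nat \<Rightarrow> nat \<Rightarrow> 'a" where
  "dfl_zeta N \<rho> th 0 j = 0"
| "dfl_zeta N \<rho> th (Suc 0) j =
     (1 + dfl_beta \<rho> 0) *\<^sub>R (0 + dfl_theta N th 1 - th 1 j)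
     - dfl_beta \<rho> 0 *\<^sub>R (0 + dfl_theta N th 0 - th 0 j)"
| "dfl_zeta N \<rho> th (Suc (Suc n)) j =
     (1 + dfl_beta \<rho> (Suc n)) *\<^sub>R
        (dfl_zeta N \<rho> th (Suc n) j + dfl_theta N th (Suc (Suc n)) - th (Suc (Suc n)) j)
     - dfl_beta \<rho> (Suc n) *\<^sub>R
        (dfl_zeta N \<rho> th n j + dfl_theta N th (Suc n) - th (Suc n) j)"

definition dfl_gap :: "('a::real_inner \<Rightarrow> real) \<Rightarrow> real \<Rightarrow> 'a \<Rightarrow> 'a \<Rightarrow> ereal" where
  "dfl_gap ft \<nu> \<zeta> \<theta> =
     ereal (ft \<theta> - \<nu> * (\<zeta> \<bullet> \<theta>))
     + (conj (\<lambda>x. ft x - \<nu> / 2 * (norm x)\<^sup>2) (\<nu> *\<^sub>R (\<zeta> - \<theta>))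
        + ereal (1 / (2 * \<nu>) * (norm (\<nu> *\<^sub>R (\<zeta> - \<theta>) - \<nu> *\<^sub>R \<zeta>))\<^sup>2))"

definition dfl_run :: "nat \<Rightarrow> (nat \<Rightarrow> 'a::real_inner \<Rightarrow> real) \<Rightarrow> real \<Rightarrow> real \<Rightarrow> real
                        \<Rightarrow> (nat \<Rightarrow> nat \<Rightarrow> 'a) \<Rightarrow> bool" where
  "dfl_run N ft \<rho> \<nu> \<gamma> th \<longleftrightarrow>
     (\<forall>j<N. th 0 j = 0) \<and>
     (\<forall>j<N. \<forall>n. dfl_gap (ft j) \<nu> (dfl_zeta N \<rho> th n j) (th (Suc n) j)
                 \<le> ereal (1 / real N * ((1 - sqrt \<rho>) / (1 + \<gamma>)) ^ n))"

end

theory Submission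
  imports Defs
begin

text \<open>
  DualFL is an inexact accelerated proximal point method for the dual problem, reduced to the part
  of the dual variable orthogonal to the consensus directions: with
  \<open>\<xi>\<^sub>j = \<nu> (\<zeta>\<^sub>j - \<theta>\<^sub>j)\<close>, the gap \<open>\<Gamma>\<close> is the Fenchel--Young gap
  \<open>f\<^sub>j(\<theta>\<^sub>j) + f\<^sub>j\<^sup>*(\<xi>\<^sub>j) - \<langle>\<xi>\<^sub>j, \<theta>\<^sub>j\<rangle>\<close>, and the proximal residual is
  \<open>w\<^sub>j = \<theta>\<^sub>j - \<theta>\<close>. As \<open>\<nabla>E\<^sup>\<alpha>(\<theta>)\<close> is the average of \<open>\<nabla>f\<^sub>j(\<theta>) - \<xi>\<^sub>j\<close>, it is bounded by
  \<open>L |w|\<close> plus the inexactness, so it suffices to make \<open>w\<close> small. The standard Lyapunov function gives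
  the rate \<open>(1 - \<surd>\<rho>)\<^sup>n\<close> for \<open>|w|\<^sup>2\<close> with a constant that degenerates as \<open>\<alpha> \<rightarrow> 0\<close>.

  A complexity constant that does not depend on \<open>\<epsilon>\<close> needs more. Up to \<open>n \<approx> 11 / \<surd>\<rho>\<close> the
  sublinear estimate brings the dual gap to order one. From then on a modified Lyapunov function
  decays like \<open>(1 - 5/4 \<surd>\<rho>)\<^sup>n\<close>, and since its decrease dominates \<open>|w|\<^sup>2\<close>, the smallest residual in a
  window of length \<open>1 / \<surd>\<rho>\<close> gains another factor \<open>\<surd>\<rho>\<close>. Together
  \<open>|w|\<^sup>2 \<lesssim> \<epsilon> powr (- 1/2) * exp (- 5/4 * \<surd>\<rho> * n)\<close>, which is of order \<open>\<epsilon>\<^sup>2\<close> at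
  \<open>n = 2 ln (1/\<epsilon>) / \<surd>\<rho>\<close>.
\<close>

section \<open>The step size sequence\<close>

text \<open>The obstacle is the leading constant 2 in the round count. In the standard estimate of
  |w|^2 the factor in front of \<open>(1 - r) ^ n\<close>, with \<open>r = sqrt \<rho>\<close>, is
  of order \<open>1 / \<nu>^2\<close>: one \<open>1 / \<nu>\<close> is the weight of the residual in
  the Lyapunov decrease, the other comes from the starting value and the accumulated errors. With
  \<nu> proportional to \<epsilon>, reaching \<epsilon>^2 that way takes
  \<open>4 * ln (1/\<epsilon>) / r\<close> rounds, twice the allowance. The refined estimate loses
  only \<open>1 / r\<close>, and the rate 5/4 is exactly what pays for it: \<open>2 * s / r\<close>
  rounds give \<open>exp (- 5/2 * s)\<close>, and \<open>1 / r\<close> is at most a multiple of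
  \<open>exp (s / 2)\<close>. Taking the best index of a window is legitimate because the claim asks
  for one good round within the budget, not for all later ones. The refined estimate needs r small
  compared with 1 and with \<gamma>. The other values of \<alpha> fill a compact interval away from
  0, where the degenerating constant is harmless.\<close>

lemma dfl_t_basic:
  assumes "0 < r" "r < 1"
  shows "1 \<le> dfl_t (r\<^sup>2) n" and "r * dfl_t (r\<^sup>2) n \<le> 1"
    and "(dfl_t (r\<^sup>2) (Suc n))\<^sup>2 - dfl_t (r\<^sup>2) (Suc n)
           = (dfl_t (r\<^sup>2) n)\<^sup>2 * (1 - r\<^sup>2 * dfl_t (r\<^sup>2) (Suc n))"
proof -
  define T where "T = dfl_t (r\<^sup>2)"
  have rec: "(T (Suc n))\<^sup>2 - T (Suc n) = (T n)\<^sup>2 * (1 - r\<^sup>2 * T (Suc n))" for n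
  proof -
    define a where "a = 1 - r\<^sup>2 * (T n)\<^sup>2"
    define d where "d = sqrt (a\<^sup>2 + 4 * (T n)\<^sup>2)"
    have d2: "d\<^sup>2 = a\<^sup>2 + 4 * (T n)\<^sup>2" unfolding d_def by simp
    have "T (Suc n) = (a + d) / 2" by (simp add: T_def a_def d_def)
    then have "(T (Suc n))\<^sup>2 = a * T (Suc n) + (T n)\<^sup>2"
      using d2 by (simp add: power2_eq_square field_simps) algebra
    then show ?thesis by (simp add: a_def algebra_simps)
  qed
  have pos: "0 < T n \<Longrightarrow> 0 < T (Suc n)" for n
  proof -
    assume "0 < T n"
    define a where "a = 1 - r\<^sup>2 * (T n)\<^sup>2"
    have "\<bar>a\<bar> < sqrt (a\<^sup>2 + 4 * (T n)\<^sup>2)"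
      using \<open>0 < T n\<close> by (intro real_less_rsqrt) simp
    then show ?thesis by (simp add: T_def a_def)
  qed
  have "1 \<le> T n \<and> r * T n \<le> 1"
  proof (induction n)
    case 0
    then show ?case using assms by (simp add: T_def)
  next
    case (Suc n)
    define t s where "t = T n" and "s = T (Suc n)"
    have t: "1 \<le> t" "r * t \<le> 1" and s: "s > 0" and e: "s\<^sup>2 - s = t\<^sup>2 * (1 - r\<^sup>2 * s)"
      using Suc pos[of n] rec[of n] by (auto simp: t_def s_def)
    have rt: "(r * t)\<^sup>2 \<le> 1" using t assms by (simp add: power_le_one)
    \<comment> \<open>The number \<open>1 / r\<close> is the positive fixed point of the recursion,
      and the iteration stays below it.\<close>
    have "r * s \<le> 1"
    proof (rule ccontr)
      assume "\<not> r * s \<le> 1"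
      then have a: "1 < r * s" by simp
      \<comment> \<open>For \<open>r * s > 1\<close> the left side lies below
        \<open>1 - r * s\<close>; the right side does not, since both \<open>1 - (r * t)^2\<close>
        and \<open>r\<close> are at most 1.\<close>
      have "1 - (r * s)\<^sup>2 = (1 - (r * t)\<^sup>2) * (1 - r * (r * s))"
        using e by (simp add: power2_eq_square) algebra
      moreover have "(r * s)\<^sup>2 > r * s" using a power_strict_increasing[of 1 2 "r * s"] by simp
      ultimately have "(1 - (r * t)\<^sup>2) * (r * (r * s) - 1) > r * s - 1"
        by (simp add: algebra_simps)
      moreover have "(1 - (r * t)\<^sup>2) * (r * (r * s) - 1) \<le> r * s - 1"
      proof (cases "r * (r * s) - 1 \<ge> 0")
        case True
        have "(1 - (r * t)\<^sup>2) * (r * (r * s) - 1) \<le> 1 * (r * (r * s) - 1)"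
          using True rt by (intro mult_right_mono) auto
        also have "\<dots> \<le> r * s - 1"
          using mult_right_mono[of r 1 "r * s"] a assms by simp
        finally show ?thesis .
      next
        case False
        then have "(1 - (r * t)\<^sup>2) * (r * (r * s) - 1) \<le> 0"
          using rt by (intro mult_nonneg_nonpos) auto
        then show ?thesis using a by simp
      qed
      ultimately show False by simp
    qed
    moreover have "1 \<le> s"
    proof (rule ccontr)
      assume "\<not> 1 \<le> s"
      then have "s * (s - 1) < 0" using s by (simp add: mult_pos_neg)
      then have "t\<^sup>2 * (1 - r\<^sup>2 * s) < 0" using e by (simp add: algebra_simps power2_eq_square)
      moreover have "r\<^sup>2 * s \<le> 1"
        using \<open>\<not> 1 \<le> s\<close> assms s by (intro mult_le_one) (auto simp: power_le_one)
      ultimately show False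
        by (metis diff_ge_0_iff_ge linorder_not_less mult_nonneg_nonneg zero_le_power2)
    qed
    ultimately show ?case by (simp add: s_def)
  qed
  then show "1 \<le> dfl_t (r\<^sup>2) n" "r * dfl_t (r\<^sup>2) n \<le> 1" by (auto simp: T_def)
  show "(dfl_t (r\<^sup>2) (Suc n))\<^sup>2 - dfl_t (r\<^sup>2) (Suc n)
           = (dfl_t (r\<^sup>2) n)\<^sup>2 * (1 - r\<^sup>2 * dfl_t (r\<^sup>2) (Suc n))"
    using rec[of n] by (simp add: T_def)
qed

context
  fixes r :: real and T :: "nat \<Rightarrow> real"
  assumes r: "0 < r" "r < 1"
  defines "T \<equiv> dfl_t (r\<^sup>2)"
begin

lemma dfl_t_bounds: "1 \<le> T n" "0 < T n" "r * T n \<le> 1" "0 < r * T n"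
proof -
  show "1 \<le> T n" "r * T n \<le> 1" using dfl_t_basic[OF r] by (auto simp: T_def)
  then show "0 < T n" "0 < r * T n" using r by auto
qed

lemma dfl_t_rec: "T (Suc n) * (T (Suc n) - 1) = (T n)\<^sup>2 * (1 - r\<^sup>2 * T (Suc n))"
  using dfl_t_basic(3)[OF r, of n] by (simp add: T_def algebra_simps power2_eq_square)

text \<open>Unlike the bound \<open>1 / r\<close>, this one does not depend on \<nu>; it keeps the
  errors weighted by \<open>T^2\<close> summable uniformly in \<nu>.\<close>

lemma dfl_t_le_Suc: "T n \<le> real n + 1"
proof (induction n)
  case 0
  show ?case by (simp add: T_def)
next
  case (Suc n)
  have "T (Suc n) \<le> T n + 1"
  proof (rule ccontr)
    assume "\<not> T (Suc n) \<le> T n + 1"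
    then have "(T n + 1) * T n < T (Suc n) * (T (Suc n) - 1)"
      using dfl_t_bounds[of n] by (intro mult_strict_mono) auto
    moreover have "(T n)\<^sup>2 * (1 - r\<^sup>2 * T (Suc n)) \<le> (T n)\<^sup>2 * 1"
      using dfl_t_bounds[of "Suc n"] by (intro mult_left_mono) auto
    ultimately show False
      using dfl_t_rec[of n] dfl_t_bounds[of n] by (simp add: algebra_simps power2_eq_square)
  qed
  then show ?case using Suc by simp
qed

text \<open>Multiplicative form of the recursion. The last factor is the contraction factor of one
  Lyapunov step, so products of these factors become explicit.\<close>

lemma one_minus_tau_sq: "1 - (r * T (Suc n))\<^sup>2 = (1 - (r * T n)\<^sup>2) * (1 - r * (r * T (Suc n)))"
  using dfl_t_rec[of n] by (simp add: power2_eq_square) algebra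

lemma one_minus_tau_sq_ge: "(1 - r\<^sup>2) * (1 - r) ^ n \<le> 1 - (r * T n)\<^sup>2"
proof (induction n)
  case 0
  then show ?case by (simp add: T_def)
next
  case (Suc n)
  have "(1 - r\<^sup>2) * (1 - r) ^ Suc n = ((1 - r\<^sup>2) * (1 - r) ^ n) * (1 - r)" by simp
  also have "\<dots> \<le> (1 - (r * T n)\<^sup>2) * (1 - r * (r * T (Suc n)))"
    using Suc r dfl_t_bounds[of n] dfl_t_bounds[of "Suc n"]
    by (intro mult_mono) (auto simp: power_le_one)
  finally show ?case using one_minus_tau_sq[of n] by simp
qed

text \<open>In the variable \<open>r T n\<close>, which behaves like \<open>tanh (r n / 2)\<close>, the map
  \<open>\<tau> \<mapsto> (1 - \<tau>) / (1 + \<tau>)\<close> linearises the recursion.\<close>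

lemma one_minus_tau_le: "1 - r * T n \<le> (1 - r) ^ n * (1 + r * T n)"
proof (induction n)
  case 0
  then show ?case using r by (simp add: T_def)
next
  case (Suc n)
  define a b where "a = r * T n" and "b = r * T (Suc n)"
  have a: "0 < a" "a \<le> 1" and b: "0 < b" "b \<le> 1"
    using dfl_t_bounds[of n] dfl_t_bounds[of "Suc n"] by (auto simp: a_def b_def)
  have rel: "1 - b\<^sup>2 = (1 - a\<^sup>2) * (1 - r * b)"
    using one_minus_tau_sq[of n] by (simp add: a_def b_def)
  have "(1 - b) * (b + a\<^sup>2) = (1 - r) * (b * (1 - a\<^sup>2))"
    using rel by (simp add: power2_eq_square) algebra
  \<comment> \<open>The contraction of \<open>(1 - \<tau>) / (1 + \<tau>)\<close> by
    \<open>1 - r\<close>, cleared of denominators; its defect is a square times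
    \<open>1 - b\<close>.\<close>
  then have "b * (1 + a) * ((1 - r) * (1 - a) * (1 + b) - (1 - b) * (1 + a)) = (1 - b) * (a - b)\<^sup>2"
    by (simp add: power2_eq_square) algebra
  then have "0 \<le> b * (1 + a) * ((1 - r) * (1 - a) * (1 + b) - (1 - b) * (1 + a))"
    using b by simp
  moreover have "0 < b * (1 + a)" using a b by simp
  ultimately have "(1 - b) * (1 + a) \<le> (1 - r) * (1 - a) * (1 + b)"
    by (metis diff_ge_0_iff_ge zero_le_mult_iff not_less)
  also have "\<dots> \<le> (1 - r) * ((1 - r) ^ n * (1 + a)) * (1 + b)"
    using Suc r b by (intro mult_right_mono mult_left_mono) (auto simp: a_def)
  finally have "(1 - b) * (1 + a) \<le> ((1 - r) ^ Suc n * (1 + b)) * (1 + a)"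
    by (simp add: mult_ac)
  then show ?case using a by (simp add: b_def)
qed

text \<open>At \<open>r * T n = 1\<close> the momentum is \<open>(1 - r) / (1 + r)\<close>, the
  constant momentum of the strongly convex case, which is \<open>1 - 2 * r\<close> to first order.
  With time step r this is the friction term of the limiting damped system.\<close>

lemma dfl_beta_near:
  assumes small: "r \<le> 1 / 1000" and tau: "999 / 1000 \<le> r * T n"
  shows "\<bar>dfl_beta (r\<^sup>2) n - (1 - 2 * r)\<bar> \<le> r / 100"
proof -
  define a b where "a = r * T n" and "b = r * T (Suc n)"
  have a: "999/1000 \<le> a" "a \<le> 1" and b: "0 < b" "b \<le> 1"
    using dfl_t_bounds[of n] dfl_t_bounds[of "Suc n"] tau by (auto simp: a_def b_def)
  have rel: "b\<^sup>2 - a\<^sup>2 = r * b * (1 - a\<^sup>2)"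
    using one_minus_tau_sq[of n] by (simp add: a_def b_def power2_eq_square) algebra
  have a1: "1 - a\<^sup>2 \<le> 2/1000" "0 \<le> 1 - a\<^sup>2"
  proof -
    have "(999/1000)^2 \<le> a\<^sup>2" by (rule power_mono) (use a in auto)
    then show "1 - a\<^sup>2 \<le> 2/1000" by (simp add: power2_eq_square)
    show "0 \<le> 1 - a\<^sup>2" using a by (simp add: power_le_one)
  qed
  have ba: "a \<le> b"
  proof -
    have "a\<^sup>2 \<le> b\<^sup>2" using rel a1 b r by (simp add: algebra_simps) (smt (verit) mult_nonneg_nonneg rel)
    then show ?thesis using b by (simp add: power2_le_iff_abs_le)
  qed
  have diff: "b - a \<le> r * b * (2/1000)"
  proof -
    have "(b - a) * 1 \<le> (b - a) * (b + a)" using ba a by (intro mult_left_mono) auto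
    also have "\<dots> = r * b * (1 - a\<^sup>2)" using rel by (simp add: power2_eq_square algebra_simps)
    also have "\<dots> \<le> r * b * (2/1000)" using a1 r b by (intro mult_left_mono) auto
    finally show ?thesis by simp
  qed
  have eq: "dfl_beta (r\<^sup>2) n = (a - r) / b * ((1 - r * b) / (1 - r\<^sup>2))"
  proof -
    have "dfl_beta (r\<^sup>2) n = (T n - 1) / T (Suc n) * ((1 - r * b) / (1 - r\<^sup>2))"
      unfolding dfl_beta_def b_def T_def by (simp only: power2_eq_square mult_ac)
    moreover have "(T n - 1) / T (Suc n) = (a - r) / b"
      using r dfl_t_bounds[of "Suc n"] by (simp add: a_def b_def field_simps)
    ultimately show ?thesis by simp
  qed
  define c where "c = a / b"
  have c: "1 - r * (2/1000) \<le> c" "c \<le> 1"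
    using diff ba b by (auto simp: c_def field_simps)
  define i where "i = 1 / b"
  have i: "1 \<le> i" "i \<le> 1002/1000"
    using b ba a by (auto simp: i_def field_simps)
  have r2: "0 < 1 - r\<^sup>2" "r\<^sup>2 \<le> r / 1000"
    using r small by (auto simp: power2_eq_square abs_square_less_1 mult_le_cancel_left_pos
        mult_strict_mono[of r 1 r 1, simplified])
  have eq2: "dfl_beta (r\<^sup>2) n * (1 - r\<^sup>2) = (c - r * i) * (1 - r * b)"
    using r2 b by (simp add: eq c_def i_def field_simps)
  have P: "(c - r * i) * (1 - r * b) = c - r * i - r * a + r\<^sup>2"
    using b by (simp add: c_def i_def field_simps power2_eq_square)
  have "r * i \<le> r * (1002/1000)" "r * 1 \<le> r * i" "r * (999/1000) \<le> r * a" "r * a \<le> r * 1"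
    using i a r by (auto intro!: mult_left_mono)
  then have bnd: "dfl_beta (r\<^sup>2) n * (1 - r\<^sup>2) \<le> 1 - 2 * r + r * (2/1000)"
    "1 - 2 * r - r * (4/1000) \<le> dfl_beta (r\<^sup>2) n * (1 - r\<^sup>2)"
    unfolding eq2 P using c r2 zero_le_power2[of r] by linarith+
  have "0 \<le> dfl_beta (r\<^sup>2) n * (1 - r\<^sup>2)" using bnd(2) small r by linarith
  then have b0: "0 \<le> dfl_beta (r\<^sup>2) n" using r2 by (simp add: zero_le_mult_iff)
  have "dfl_beta (r\<^sup>2) n * (1 - r\<^sup>2) \<le> 1" using bnd(1) r by simp
  then have "dfl_beta (r\<^sup>2) n * (1/2) \<le> 1"
    using mult_left_mono[of "1/2" "1 - r\<^sup>2", OF _ b0] r2 small r by linarith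
  then have "dfl_beta (r\<^sup>2) n * r\<^sup>2 \<le> 2 * (r/1000)"
    using r2 b0 by (intro mult_mono) auto
  moreover have "0 \<le> dfl_beta (r\<^sup>2) n * r\<^sup>2" using b0 by simp
  moreover have "dfl_beta (r\<^sup>2) n * (1 - r\<^sup>2) = dfl_beta (r\<^sup>2) n - dfl_beta (r\<^sup>2) n * r\<^sup>2"
    by (simp add: algebra_simps)
  ultimately show ?thesis using bnd r by linarith
qed

end

section \<open>Inexact accelerated proximal point iteration\<close>

text \<open>\<open>X n\<close> is the \<open>n\<close>-th iterate minus the solution, \<open>W n\<close> the approximate subgradient at it,
  \<open>D n\<close> its objective gap; the strong convexity of the objective is centred at a point that differs
  from the iterate by \<open>e n\<close>. \<open>D 0\<close> is left unconstrained, because the conjugates may be infinite at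
  the starting point 0.\<close>

locale inexact_accel_prox =
  fixes N :: nat and L \<nu> \<gamma> :: real
    and D :: "nat \<Rightarrow> real" and X W e :: "nat \<Rightarrow> nat \<Rightarrow> 'a::real_inner"
    and r :: real and \<delta> T :: "nat \<Rightarrow> real"
  defines "r \<equiv> sqrt (\<nu> / (L + \<nu>))"
    and "\<delta> \<equiv> \<lambda>n. ((1 - r) / (1 + \<gamma>)) ^ n"
    and "T \<equiv> dfl_t (\<nu> / (L + \<nu>))"
  assumes L: "0 < L" and nu: "0 < \<nu>" and gam: "0 < \<gamma>"
    and step0: "\<And>j. j < N \<Longrightarrow> X 1 j = X 0 j - \<nu> *\<^sub>R W 1 j"
    and step: "\<And>n j. j < N \<Longrightarrow> X (Suc (Suc n)) j =
        X (Suc n) j + dfl_beta (\<nu> / (L + \<nu>)) n *\<^sub>R (X (Suc n) j - X n j) - \<nu> *\<^sub>R W (Suc (Suc n)) j"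
    and opt: "\<And>n. D (Suc n) \<le> (\<Sum>j<N. W (Suc n) j \<bullet> X (Suc n) j)
        - 1 / (2 * L) * (\<Sum>j<N. (norm (X (Suc n) j + e (Suc n) j))\<^sup>2) + \<delta> n"
    and descent: "\<And>n. D (Suc (Suc n)) \<le> D (Suc n)
        - (\<Sum>j<N. W (Suc (Suc n)) j \<bullet> (X (Suc n) j - X (Suc (Suc n)) j))
        - 1 / (2 * L) * (\<Sum>j<N. (norm (X (Suc n) j - X (Suc (Suc n)) j - e (Suc (Suc n)) j))\<^sup>2)
        + \<delta> (Suc n)"
    and err: "\<And>n. 1 / (2 * L) * (\<Sum>j<N. (norm (e (Suc n) j))\<^sup>2) \<le> \<delta> n"
    and growth: "\<And>n. 1 / (2 * L) * (\<Sum>j<N. (norm (X (Suc n) j))\<^sup>2) \<le> D (Suc n)"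

text \<open>The momentum is chosen so that \<open>V' + t' \<nu> w\<close> is a convex combination of
  \<open>x\<close> and \<open>V\<close>. Convexity of the squared norm then leaves a multiple of
  |x|^2, which the strong convexity terms on the right pay for exactly.\<close>

lemma accel_prox_step_ineq:
  fixes x0 x x' w e :: "'a::real_inner" and t t' \<nu> L \<rho> :: real
  assumes L: "0 < L" and nu: "0 < \<nu>" and rho: "\<rho> = \<nu> / (L + \<nu>)" and t': "1 \<le> t'" "\<rho> * t' \<le> 1"
    and x': "x' = x + ((t - 1) / t' * ((1 - t' * \<rho>) / (1 - \<rho>))) *\<^sub>R (x - x0) - \<nu> *\<^sub>R w"
  defines "V \<equiv> t *\<^sub>R x - (t - 1) *\<^sub>R x0" and "V' \<equiv> t' *\<^sub>R x' - (t' - 1) *\<^sub>R x"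
  shows "1 / (2 * \<nu>) * (norm V')\<^sup>2 + 1 / (2 * L) * (norm (V' + t' *\<^sub>R e))\<^sup>2 + \<nu> / 2 * t'\<^sup>2 * (norm w)\<^sup>2
    \<le> (1 / (2 * \<nu>) + 1 / (2 * L)) * (1 - \<rho> * t') * (norm V)\<^sup>2
      + t' * (- (w \<bullet> x') + 1 / (2 * L) * (norm (x' + e))\<^sup>2)
      + t' * (t' - 1) * (w \<bullet> (x - x') + 1 / (2 * L) * (norm (x - x' - e))\<^sup>2)"
proof -
  define \<omega> where "\<omega> = (1 - t' * \<rho>) / (1 - \<rho>)"
  have rho1: "1 - \<rho> = L / (L + \<nu>)" "0 < \<rho>" "\<rho> < 1" unfolding rho using L nu by (auto simp: field_simps)
  have w0: "0 \<le> \<omega>" "\<omega> \<le> 1"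
    using t' rho1 mult_left_mono[of 1 t' \<rho>] by (auto simp: \<omega>_def field_simps)
  define U where "U = V' + (t' * \<nu>) *\<^sub>R w"
  have U: "U = (1 - \<omega>) *\<^sub>R x + \<omega> *\<^sub>R V"
  proof -
    have "U = t' *\<^sub>R (x + ((t - 1) / t' * \<omega>) *\<^sub>R (x - x0)) - (t' - 1) *\<^sub>R x"
      by (simp add: U_def V'_def x' \<omega>_def scaleR_diff_right)
    also have "\<dots> = x + ((t - 1) * \<omega>) *\<^sub>R (x - x0)"
    proof -
      have "t' * ((t - 1) / t' * \<omega>) = (t - 1) * \<omega>" using t' by simp
      then show ?thesis by (simp only: scaleR_add_right scaleR_scaleR) (simp add: algebra_simps)
    qed
    also have "\<dots> = (1 - \<omega>) *\<^sub>R x + \<omega> *\<^sub>R V"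
      by (simp add: V_def algebra_simps)
    finally show ?thesis .
  qed
  have "(norm U)\<^sup>2 = (1 - \<omega>) * (norm x)\<^sup>2 + \<omega> * (norm V)\<^sup>2 - \<omega> * (1 - \<omega>) * (norm (x - V))\<^sup>2"
    unfolding U power2_norm_eq_inner by (simp add: inner_simps inner_commute algebra_simps)
  also have "\<dots> \<le> (1 - \<omega>) * (norm x)\<^sup>2 + \<omega> * (norm V)\<^sup>2"
    using w0 by simp
  finally have U2: "1 / (2 * \<nu>) * (norm U)\<^sup>2 \<le> 1 / (2 * \<nu>) * ((1 - \<omega>) * (norm x)\<^sup>2 + \<omega> * (norm V)\<^sup>2)"
    using nu by (intro mult_left_mono) auto
  have c1: "1 / (2 * \<nu>) * (1 - \<omega>) = (t' - 1) / (2 * L)"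
  proof -
    have "1 - \<omega> = \<rho> * (t' - 1) / (1 - \<rho>)" using rho1 by (simp add: \<omega>_def field_simps)
    also have "\<rho> / (1 - \<rho>) = \<nu> / L" unfolding rho1(1) using rho L nu by simp
    then have "\<rho> * (t' - 1) / (1 - \<rho>) = \<nu> / L * (t' - 1)" by (metis times_divide_eq_left)
    finally show ?thesis using nu by simp
  qed
  have c2: "1 / (2 * \<nu>) * \<omega> = (1 / (2 * \<nu>) + 1 / (2 * L)) * (1 - \<rho> * t')"
    using L nu by (simp add: \<omega>_def rho1(1) field_simps)
  have U3: "1 / (2 * \<nu>) * (norm U)\<^sup>2 \<le> (t' - 1) / (2 * L) * (norm x)\<^sup>2
      + (1 / (2 * \<nu>) + 1 / (2 * L)) * (1 - \<rho> * t') * (norm V)\<^sup>2"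
    using U2 unfolding distrib_left mult.assoc[symmetric] c1 c2 by simp
  \<comment> \<open>The two strong convexity terms merge into a square in \<open>V'\<close> and a
    multiple of |x|^2; by \<open>c1\<close> the latter is just the cost of the convex
    combination.\<close>
  have i1: "t' * (norm (x' + e))\<^sup>2 + t' * (t' - 1) * (norm (x - x' - e))\<^sup>2
      = (norm (V' + t' *\<^sub>R e))\<^sup>2 + (t' - 1) * (norm x)\<^sup>2"
    unfolding V'_def power2_norm_eq_inner by (simp add: inner_simps inner_commute algebra_simps)
  have i2: "1 / (2 * \<nu>) * (norm U)\<^sup>2 = 1 / (2 * \<nu>) * (norm V')\<^sup>2 + t' * (V' \<bullet> w) + \<nu> / 2 * t'\<^sup>2 * (norm w)\<^sup>2"
    unfolding U_def power2_norm_eq_inner using nu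
    by (simp add: inner_simps inner_commute field_simps power2_eq_square)
  have i3: "t' * (V' \<bullet> w) = t' * (w \<bullet> x') - t' * (t' - 1) * (w \<bullet> (x - x'))"
    unfolding V'_def by (simp add: inner_simps inner_commute algebra_simps)
  have i4: "t' * (1 / (2 * L) * (norm (x' + e))\<^sup>2) + t' * (t' - 1) * (1 / (2 * L) * (norm (x - x' - e))\<^sup>2)
     = 1 / (2 * L) * (norm (V' + t' *\<^sub>R e))\<^sup>2 + (t' - 1) / (2 * L) * (norm x)\<^sup>2"
    using arg_cong[OF i1, of "\<lambda>z. 1 / (2 * L) * z"] by (simp add: algebra_simps add_divide_distrib diff_divide_distrib)
  show ?thesis using U3 i2 i3 i4 unfolding distrib_left by linarith
qed

section \<open>One-step inequalities for the standard Lyapunov function\<close>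

context inexact_accel_prox
begin

lemma rho_sq: "\<nu> / (L + \<nu>) = r\<^sup>2"
  using L nu by (simp add: r_def)

lemma r_bounds: "0 < r" "r < 1"
proof -
  show "0 < r" using L nu by (simp add: r_def)
  have "\<nu> / (L + \<nu>) < 1" using L nu by simp
  then show "r < 1" by (simp add: r_def)
qed

lemma T_def': "T = dfl_t (r\<^sup>2)" by (simp add: T_def rho_sq)

lemmas T_bounds = dfl_t_bounds[OF r_bounds, folded T_def']
  and T_rec = dfl_t_rec[OF r_bounds, folded T_def']

lemma delta_nonneg: "0 \<le> \<delta> n"
  using r_bounds gam by (simp add: \<delta>_def)

definition V where "V n j = T n *\<^sub>R X (Suc n) j - (T n - 1) *\<^sub>R X n j"

text \<open>Add \<open>t\<close> times the comparison with the solution (\<open>opt\<close>) and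
  \<open>t * (t - 1)\<close> times the comparison with the previous iterate
  (\<open>descent\<close>), where \<open>t = T (Suc n)\<close>. The new gap gets weight
  \<open>t^2\<close>, and the recursion for \<open>T\<close> turns the weight of the old one into
  \<open>T n ^ 2\<close> times the contraction factor.\<close>

lemma lyapunov_step:
  "(T (Suc n))\<^sup>2 * D (Suc (Suc n)) + 1 / (2 * \<nu>) * (\<Sum>j<N. (norm (V (Suc n) j))\<^sup>2)
     + 1 / (2 * L) * (\<Sum>j<N. (norm (V (Suc n) j + T (Suc n) *\<^sub>R e (Suc (Suc n)) j))\<^sup>2)
     + \<nu> / 2 * (T (Suc n))\<^sup>2 * (\<Sum>j<N. (norm (W (Suc (Suc n)) j))\<^sup>2)
   \<le> (1 - r\<^sup>2 * T (Suc n)) * ((T n)\<^sup>2 * D (Suc n)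
       + (1 / (2 * \<nu>) + 1 / (2 * L)) * (\<Sum>j<N. (norm (V n j))\<^sup>2))
     + (T (Suc n))\<^sup>2 * \<delta> (Suc n)"
proof -
  define t where "t = T (Suc n)"
  define \<kappa> where "\<kappa> = 1 / (2 * \<nu>) + 1 / (2 * L)"
  define A where "A j = - (W (Suc (Suc n)) j \<bullet> X (Suc (Suc n)) j)
     + 1 / (2 * L) * (norm (X (Suc (Suc n)) j + e (Suc (Suc n)) j))\<^sup>2" for j
  define B where "B j = W (Suc (Suc n)) j \<bullet> (X (Suc n) j - X (Suc (Suc n)) j)
     + 1 / (2 * L) * (norm (X (Suc n) j - X (Suc (Suc n)) j - e (Suc (Suc n)) j))\<^sup>2" for j
  have t1: "1 \<le> t" using T_bounds by (simp add: t_def)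
  have rt: "r\<^sup>2 * t \<le> 1"
    using mult_le_one[of r "r * t"] T_bounds[of "Suc n"] r_bounds
    by (simp add: t_def power2_eq_square mult_ac)
  have "(\<Sum>j<N. 1 / (2 * \<nu>) * (norm (V (Suc n) j))\<^sup>2
      + 1 / (2 * L) * (norm (V (Suc n) j + t *\<^sub>R e (Suc (Suc n)) j))\<^sup>2
      + \<nu> / 2 * t\<^sup>2 * (norm (W (Suc (Suc n)) j))\<^sup>2)
    \<le> (\<Sum>j<N. (1 / (2 * \<nu>) + 1 / (2 * L)) * (1 - r\<^sup>2 * t) * (norm (V n j))\<^sup>2
        + t * A j + t * (t - 1) * B j)"
  proof (intro sum_mono)
    fix j assume "j \<in> {..<N}"
    then have "X (Suc (Suc n)) j = X (Suc n) j + ((T n - 1) / t * ((1 - t * r\<^sup>2) / (1 - r\<^sup>2))) *\<^sub>R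
       (X (Suc n) j - X n j) - \<nu> *\<^sub>R W (Suc (Suc n)) j"
      using step[of j n] unfolding rho_sq dfl_beta_def t_def T_def' by simp
    from accel_prox_step_ineq[OF L nu rho_sq[symmetric] t1 rt this]
    show "1 / (2 * \<nu>) * (norm (V (Suc n) j))\<^sup>2
      + 1 / (2 * L) * (norm (V (Suc n) j + t *\<^sub>R e (Suc (Suc n)) j))\<^sup>2
      + \<nu> / 2 * t\<^sup>2 * (norm (W (Suc (Suc n)) j))\<^sup>2
      \<le> (1 / (2 * \<nu>) + 1 / (2 * L)) * (1 - r\<^sup>2 * t) * (norm (V n j))\<^sup>2
        + t * A j + t * (t - 1) * B j"
      unfolding V_def A_def B_def t_def .
  qed
  then have 1: "1 / (2 * \<nu>) * (\<Sum>j<N. (norm (V (Suc n) j))\<^sup>2)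
      + 1 / (2 * L) * (\<Sum>j<N. (norm (V (Suc n) j + t *\<^sub>R e (Suc (Suc n)) j))\<^sup>2)
      + \<nu> / 2 * t\<^sup>2 * (\<Sum>j<N. (norm (W (Suc (Suc n)) j))\<^sup>2)
    \<le> (1 / (2 * \<nu>) + 1 / (2 * L)) * (1 - r\<^sup>2 * t) * (\<Sum>j<N. (norm (V n j))\<^sup>2)
        + t * sum A {..<N} + t * (t - 1) * sum B {..<N}"
    by (simp only: sum.distrib sum_distrib_left)
  have "D (Suc (Suc n)) \<le> - sum A {..<N} + \<delta> (Suc n)"
    using opt[of "Suc n"] by (simp add: A_def sum.distrib sum_subtractf sum_negf sum_distrib_left)
  then have 2: "t * D (Suc (Suc n)) \<le> t * (- sum A {..<N} + \<delta> (Suc n))"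
    using t1 by (intro mult_left_mono) auto
  have "D (Suc (Suc n)) \<le> D (Suc n) - sum B {..<N} + \<delta> (Suc n)"
    using descent[of n] by (simp add: B_def sum.distrib sum_distrib_left)
  then have 3: "t * (t - 1) * D (Suc (Suc n)) \<le> t * (t - 1) * (D (Suc n) - sum B {..<N} + \<delta> (Suc n))"
    using t1 by (intro mult_left_mono) auto
  have 4: "t * (t - 1) * D (Suc n) = (T n)\<^sup>2 * (1 - r\<^sup>2 * t) * D (Suc n)"
    using T_rec[of n] by (simp add: t_def)
  have "t\<^sup>2 * D (Suc (Suc n)) \<le> t * (t - 1) * D (Suc n) - t * sum A {..<N} - t * (t - 1) * sum B {..<N}
     + t\<^sup>2 * \<delta> (Suc n)"
    using 2 3 by (simp add: algebra_simps power2_eq_square)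
  moreover have "(1 - r\<^sup>2 * t) * ((T n)\<^sup>2 * D (Suc n) + \<kappa> * (\<Sum>j<N. (norm (V n j))\<^sup>2))
     = (T n)\<^sup>2 * (1 - r\<^sup>2 * t) * D (Suc n) + \<kappa> * (1 - r\<^sup>2 * t) * (\<Sum>j<N. (norm (V n j))\<^sup>2)"
    by (simp add: algebra_simps)
  ultimately show ?thesis
    using 1 4 unfolding t_def[symmetric] \<kappa>_def[symmetric] by linarith
qed

text \<open>The first step is a plain proximal step, so the three-point identity and
  \<open>opt\<close> suffice, and \<open>D 0\<close> does not enter.\<close>

lemma lyapunov_init:
  "D 1 + (1 / (2 * \<nu>)) * (\<Sum>j<N. (norm (X 1 j))\<^sup>2) + \<nu> / 2 * (\<Sum>j<N. (norm (W 1 j))\<^sup>2)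
     \<le> 1 / (2 * \<nu>) * (\<Sum>j<N. (norm (X 0 j))\<^sup>2) + 1"
proof -
  have "(\<Sum>j<N. W 1 j \<bullet> X 1 j) = (\<Sum>j<N. 1 / (2 * \<nu>) * (norm (X 0 j))\<^sup>2
      - 1 / (2 * \<nu>) * (norm (X 1 j))\<^sup>2 - \<nu> / 2 * (norm (W 1 j))\<^sup>2)"
  proof (intro sum.cong refl)
    fix j assume "j \<in> {..<N}"
    then have x0: "X 0 j = X 1 j + \<nu> *\<^sub>R W 1 j" using step0[of j] by simp
    show "W 1 j \<bullet> X 1 j = 1 / (2 * \<nu>) * (norm (X 0 j))\<^sup>2
      - 1 / (2 * \<nu>) * (norm (X 1 j))\<^sup>2 - \<nu> / 2 * (norm (W 1 j))\<^sup>2"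
      unfolding x0 power2_norm_eq_inner using nu
      by (simp add: inner_simps inner_commute field_simps power2_eq_square)
  qed
  moreover have "0 \<le> 1 / (2 * L) * (\<Sum>j<N. (norm (X 1 j + e 1 j))\<^sup>2)"
    using L by (intro mult_nonneg_nonneg sum_nonneg) auto
  ultimately show ?thesis using opt[of 0]
    by (simp add: \<delta>_def sum_subtractf sum_distrib_left)
qed

end

lemma norm_add_sq_ge:
  fixes a b :: "'a::real_inner"
  assumes "0 < s" "s < 1"
  shows "(1 - s) * (norm a)\<^sup>2 - 1 / s * (norm b)\<^sup>2 \<le> (norm (a + b))\<^sup>2"
proof -
  have "0 \<le> (norm (s *\<^sub>R a + b))\<^sup>2" by simp
  then have "0 \<le> s * (norm (a + b))\<^sup>2 - s * (1 - s) * (norm a)\<^sup>2 + (1 - s) * (norm b)\<^sup>2"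
    unfolding power2_norm_eq_inner by (simp add: inner_simps inner_commute algebra_simps)
  also have "\<dots> \<le> s * (norm (a + b))\<^sup>2 - s * (1 - s) * (norm a)\<^sup>2 + 1 * (norm b)\<^sup>2"
    using assms by (intro add_left_mono mult_right_mono) auto
  finally have "s * ((1 - s) * (norm a)\<^sup>2 - 1 / s * (norm b)\<^sup>2) \<le> s * (norm (a + b))\<^sup>2"
    using assms by (simp add: algebra_simps)
  then show ?thesis using assms by (simp only: mult_le_cancel_left_pos)
qed

lemma geometric_partial_sum_le:
  fixes g :: real
  assumes "0 \<le> g" "g < 1"
  shows "(\<Sum>k<n. g ^ k) \<le> 1 / (1 - g)"
  using assms by (simp add: sum_gp_strict divide_simps)

section \<open>Geometric decay of the standard Lyapunov function\<close>

context inexact_accel_prox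
begin

definition S where
  "S n = (T n)\<^sup>2 * D (Suc n) + (1 / (2 * \<nu>) + 1 / (2 * L)) * (\<Sum>j<N. (norm (V n j))\<^sup>2)"

definition Z where "Z = 1 / (2 * \<nu>) * (\<Sum>j<N. (norm (X 0 j))\<^sup>2) + 1"

lemma D_nonneg: "0 \<le> D (Suc n)"
proof -
  have "0 \<le> 1 / (2 * L) * (\<Sum>j<N. (norm (X (Suc n) j))\<^sup>2)"
    using L by (intro mult_nonneg_nonneg sum_nonneg) auto
  then show ?thesis using growth[of n] by simp
qed

lemma S_nonneg: "0 \<le> S n"
  unfolding S_def using L nu D_nonneg[of n]
  by (intro add_nonneg_nonneg mult_nonneg_nonneg sum_nonneg) auto

text \<open>In \<open>lyapunov_step\<close> the new \<open>V\<close> appears shifted by the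
  inexactness. Young's inequality removes the shift at the price of a factor \<open>1 - s\<close>
  and of \<open>1 / s\<close> times the error bounded in \<open>err\<close>; the factor is put on
  all of \<open>S\<close> so that the inequality can be iterated.\<close>

lemma S_step:
  assumes "0 < s" "s < 1"
  shows "(1 - s) * S (Suc n) + \<nu> / 2 * (T (Suc n))\<^sup>2 * (\<Sum>j<N. (norm (W (Suc (Suc n)) j))\<^sup>2)
    \<le> (1 - r\<^sup>2 * T (Suc n)) * S n + (1 + 1 / s) * ((T (Suc n))\<^sup>2 * \<delta> (Suc n))"
proof -
  define t where "t = T (Suc n)"
  define v where "v = (\<Sum>j<N. (norm (V (Suc n) j))\<^sup>2)"
  define E where "E = (\<Sum>j<N. (norm (e (Suc (Suc n)) j))\<^sup>2)"
  have "(\<Sum>j<N. (1 - s) * (norm (V (Suc n) j))\<^sup>2 - 1 / s * (norm (t *\<^sub>R e (Suc (Suc n)) j))\<^sup>2)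
     \<le> (\<Sum>j<N. (norm (V (Suc n) j + t *\<^sub>R e (Suc (Suc n)) j))\<^sup>2)" (is "_ \<le> ?R")
    using assms by (intro sum_mono norm_add_sq_ge)
  then have "(1 - s) * v - 1 / s * (t\<^sup>2 * E) \<le> ?R"
    by (simp add: v_def E_def sum_subtractf sum_distrib_left power_mult_distrib mult_ac)
  then have "1 / (2 * L) * ((1 - s) * v - 1 / s * (t\<^sup>2 * E)) \<le> 1 / (2 * L) * ?R"
    using L by (intro mult_left_mono) auto
  then have 1: "(1 - s) * (1 / (2 * L) * v) - 1 / s * (t\<^sup>2 * (1 / (2 * L) * E)) \<le> 1 / (2 * L) * ?R"
    by (simp add: algebra_simps diff_divide_distrib)
  have 2: "1 / s * (t\<^sup>2 * (1 / (2 * L) * E)) \<le> 1 / s * (t\<^sup>2 * \<delta> (Suc n))"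
    using err[of "Suc n"] assms by (intro mult_left_mono) (auto simp: E_def)
  have v0: "0 \<le> v" unfolding v_def by (intro sum_nonneg) auto
  have 3: "s * (t\<^sup>2 * D (Suc (Suc n)) + 1 / (2 * \<nu>) * v) \<ge> 0"
    using assms D_nonneg[of "Suc n"] v0 nu by (intro mult_nonneg_nonneg add_nonneg_nonneg) auto
  have "(1 - s) * S (Suc n) = t\<^sup>2 * D (Suc (Suc n)) + 1 / (2 * \<nu>) * v + (1 - s) * (1 / (2 * L) * v)
      - s * (t\<^sup>2 * D (Suc (Suc n)) + 1 / (2 * \<nu>) * v)"
    by (simp add: S_def v_def t_def algebra_simps diff_divide_distrib)
  moreover have "(1 + 1 / s) * (t\<^sup>2 * \<delta> (Suc n)) = t\<^sup>2 * \<delta> (Suc n) + 1 / s * (t\<^sup>2 * \<delta> (Suc n))"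
    by (simp add: distrib_right)
  ultimately show ?thesis
    using lyapunov_step[of n] 1 2 3
    unfolding t_def[symmetric] v_def[symmetric] S_def[symmetric] by linarith
qed

lemma S_0_le: "S 0 \<le> 2 * Z" and Z_ge_1: "1 \<le> Z"
proof -
  have "S 0 = D 1 + (1 / (2 * \<nu>) + 1 / (2 * L)) * (\<Sum>j<N. (norm (X 1 j))\<^sup>2)"
    by (simp add: S_def V_def T_def)
  moreover have "0 \<le> \<nu> / 2 * (\<Sum>j<N. (norm (W 1 j))\<^sup>2)" "0 \<le> 1 / (2 * \<nu>) * (\<Sum>j<N. (norm (X 1 j))\<^sup>2)"
    using nu by (auto intro!: divide_nonneg_nonneg mult_nonneg_nonneg sum_nonneg)
  ultimately show "S 0 \<le> 2 * Z"
    using lyapunov_init growth[of 0] by (simp add: Z_def distrib_right)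
  have "0 \<le> 1 / (2 * \<nu>) * (\<Sum>j<N. (norm (X 0 j))\<^sup>2)"
    using nu by (auto intro!: divide_nonneg_nonneg sum_nonneg)
  then show "1 \<le> Z" by (simp add: Z_def)
qed

text \<open>Square root of the decay that the errors have in excess of \<open>1 - r\<close>. One
  factor \<open>g ^ n\<close> pays for \<open>1 / s\<close> in \<open>S_step\<close>, the other
  leaves a summable series.\<close>

definition g where "g = 1 / sqrt (1 + \<gamma>)"

lemma g_bounds: "0 < g" "g < 1" and g_sq: "g\<^sup>2 = 1 / (1 + \<gamma>)"
  using gam by (auto simp: g_def power_divide)

lemma delta_eq: "\<delta> n = (1 - r) ^ n * (g\<^sup>2) ^ n"
  by (simp add: \<delta>_def g_sq power_divide)

text \<open>Since \<open>T 0 = 1\<close>, this is the product of \<open>1 - r^2 * T k\<close> over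
  all \<open>k \<le> n\<close>, hence the natural unit for \<open>S n\<close>.\<close>

definition q where "q n = 1 - (r * T n)\<^sup>2"

lemma q_facts: "0 < q n" "(1 - r\<^sup>2) * (1 - r) ^ n \<le> q n" "q n \<le> 4 * (1 - r) ^ n"
  "q (Suc n) = q n * (1 - r\<^sup>2 * T (Suc n))"
proof -
  show a: "(1 - r\<^sup>2) * (1 - r) ^ n \<le> q n"
    using one_minus_tau_sq_ge[OF r_bounds, of n] by (simp add: q_def T_def')
  have "0 < (1 - r\<^sup>2) * (1 - r) ^ n" using r_bounds by (simp add: abs_square_less_1)
  with a show "0 < q n" by linarith
  show "q (Suc n) = q n * (1 - r\<^sup>2 * T (Suc n))"
    using one_minus_tau_sq[OF r_bounds, of n] unfolding T_def'[symmetric]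
    by (simp add: q_def power2_eq_square mult_ac)
  have "q n = (1 - r * T n) * (1 + r * T n)" by (simp add: q_def power2_eq_square algebra_simps)
  also have "\<dots> \<le> ((1 - r) ^ n * (1 + r * T n)) * (1 + r * T n)"
    using one_minus_tau_le[OF r_bounds, of n] T_bounds[of n]
    unfolding T_def'[symmetric] by (intro mult_right_mono) auto
  also have "\<dots> \<le> ((1 - r) ^ n * 2) * 2"
    using T_bounds[of n] r_bounds by (intro mult_mono mult_nonneg_nonneg) auto
  finally show "q n \<le> 4 * (1 - r) ^ n" by simp
qed

text \<open>The loss factors \<open>1 - s\<close> of the inexact step are chosen to telescope to \<open>1 + g ^ n\<close>.\<close>

lemma S_le: "S n \<le> q n * (4 * Z / (1 - r\<^sup>2) + 8 / (r\<^sup>2 * (1 - r\<^sup>2) * (1 - g)\<^sup>2))"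
proof -
  define B where "B = 8 / (r\<^sup>2 * (1 - r\<^sup>2) * (1 - g))"
  define P where "P n = 1 + g ^ n" for n
  have r2: "0 < r\<^sup>2" "0 < 1 - r\<^sup>2" using r_bounds by (auto simp: abs_square_less_1)
  have B0: "0 < B" using r2 g_bounds by (simp add: B_def)
  have main: "P (Suc n) * (S (Suc n) / q (Suc n)) \<le> P n * (S n / q n) + B * g ^ n" for n
  proof -
    define s where "s = 1 - P (Suc n) / P n"
    define R where "R n = S n / q n" for n
    have P0: "1 \<le> P n" "P n \<le> 2" "1 \<le> P (Suc n)"
      using g_bounds by (auto simp: P_def power_le_one mult_le_one)
    have s_eq: "s = g ^ n * (1 - g) / P n" using P0 by (simp add: s_def P_def field_simps)
    have gn: "0 < g ^ n" "g ^ n \<le> 1" using g_bounds by (auto simp: power_le_one)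
    have s0: "0 < s" unfolding s_eq using gn g_bounds P0 by simp
    have s1: "s < 1" using P0 by (simp add: s_def)
    have "g ^ n * (1 - g) / 2 \<le> s"
      unfolding s_eq using gn g_bounds P0 by (intro divide_left_mono mult_nonneg_nonneg) auto
    then have inv_s: "1 / s \<le> 2 / (g ^ n * (1 - g))"
      using s0 gn g_bounds by (simp add: field_simps)
    have is2: "1 + 1 / s \<le> 4 / (g ^ n * (1 - g))"
    proof -
      have "1 \<le> 1 / s" using s0 s1 by simp
      then have "1 + 1 / s \<le> 2 * (1 / s)" by simp
      also have "\<dots> \<le> 2 * (2 / (g ^ n * (1 - g)))" using inv_s by simp
      finally show ?thesis by simp
    qed
    have w0: "0 \<le> \<nu> / 2 * (T (Suc n))\<^sup>2 * (\<Sum>j<N. (norm (W (Suc (Suc n)) j))\<^sup>2)"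
      using nu by (intro mult_nonneg_nonneg sum_nonneg) auto
    have "(1 - s) * S (Suc n) \<le> (1 - r\<^sup>2 * T (Suc n)) * S n + (1 + 1 / s) * ((T (Suc n))\<^sup>2 * \<delta> (Suc n))"
      using S_step[OF s0 s1, of n] w0 by linarith
    then have "((1 - s) * S (Suc n)) / q (Suc n)
      \<le> ((1 - r\<^sup>2 * T (Suc n)) * S n + (1 + 1 / s) * ((T (Suc n))\<^sup>2 * \<delta> (Suc n))) / q (Suc n)"
      using q_facts(1)[of "Suc n"] by (intro divide_right_mono) auto
    also have "\<dots> = R n + (1 + 1 / s) * ((T (Suc n))\<^sup>2 * (\<delta> (Suc n) / q (Suc n)))"
    proof -
      have "1 - r\<^sup>2 * T (Suc n) \<noteq> 0"
        using q_facts(1)[of "Suc n"] unfolding q_facts(4) by auto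
      then have "(1 - r\<^sup>2 * T (Suc n)) * S n / q (Suc n) = R n"
        unfolding q_facts(4) R_def by simp
      then show ?thesis by (simp add: add_divide_distrib)
    qed
    finally have 1: "(1 - s) * R (Suc n) \<le> R n + (1 + 1 / s) * ((T (Suc n))\<^sup>2 * (\<delta> (Suc n) / q (Suc n)))"
      by (simp add: R_def)
    have "\<delta> (Suc n) / q (Suc n) \<le> \<delta> (Suc n) / ((1 - r\<^sup>2) * (1 - r) ^ Suc n)"
      using q_facts(2)[of "Suc n"] q_facts(1)[of "Suc n"] delta_nonneg[of "Suc n"] r2 r_bounds
      by (intro divide_left_mono mult_pos_pos) auto
    also have "\<dots> = (g\<^sup>2) ^ Suc n / (1 - r\<^sup>2)"
      unfolding delta_eq using r_bounds by simp
    finally have 2: "\<delta> (Suc n) / q (Suc n) \<le> (g\<^sup>2) ^ Suc n / (1 - r\<^sup>2)" .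
    have "(r * T (Suc n))\<^sup>2 \<le> 1" using T_bounds[of "Suc n"] by (intro power_le_one) auto
    then have T2: "(T (Suc n))\<^sup>2 \<le> 1 / r\<^sup>2" using r2 by (simp add: power_mult_distrib field_simps)
    have "(1 + 1 / s) * ((T (Suc n))\<^sup>2 * (\<delta> (Suc n) / q (Suc n)))
       \<le> 4 / (g ^ n * (1 - g)) * (1 / r\<^sup>2 * ((g\<^sup>2) ^ Suc n / (1 - r\<^sup>2)))"
      using is2 T2 2 s0 delta_nonneg[of "Suc n"] q_facts(1)[of "Suc n"] gn g_bounds
      by (intro mult_mono mult_nonneg_nonneg) auto
    also have "\<dots> = 4 / (r\<^sup>2 * (1 - r\<^sup>2) * (1 - g)) * ((g\<^sup>2) ^ Suc n / g ^ n)"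
      by simp
    also have "(g\<^sup>2) ^ Suc n / g ^ n = g ^ n * g\<^sup>2"
      using g_bounds by (simp add: power2_eq_square power_mult_distrib)
    also have "4 / (r\<^sup>2 * (1 - r\<^sup>2) * (1 - g)) * (g ^ n * g\<^sup>2) \<le> 4 / (r\<^sup>2 * (1 - r\<^sup>2) * (1 - g)) * (g ^ n * 1)"
      using r2 g_bounds gn by (intro mult_left_mono) (auto simp: power_le_one)
    finally have "(1 - s) * R (Suc n) \<le> R n + B / 2 * g ^ n"
      using 1 by (simp add: B_def mult_ac)
    then have "P n * ((1 - s) * R (Suc n)) \<le> P n * (R n + B / 2 * g ^ n)"
      using P0 by (intro mult_left_mono) auto
    moreover have "P n * ((1 - s) * R (Suc n)) = P (Suc n) * R (Suc n)"
      using P0 by (simp add: s_def)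
    moreover have "P n * (B / 2 * g ^ n) \<le> 2 * (B / 2 * g ^ n)"
      using P0 B0 gn by (intro mult_right_mono) auto
    ultimately show ?thesis unfolding R_def[symmetric] distrib_left by linarith
  qed
  have "P n * (S n / q n) \<le> P 0 * (S 0 / q 0) + B * (\<Sum>k<n. g ^ k)"
  proof (induction n)
    case (Suc n)
    then show ?case using main[of n] by (simp add: distrib_left)
  qed simp
  also have "\<dots> \<le> P 0 * (2 * Z / (1 - r\<^sup>2)) + B * (1 / (1 - g))"
    using B0 g_bounds S_0_le r2
    by (intro add_mono mult_left_mono geometric_partial_sum_le)
       (auto simp: P_def q_def T_def intro!: divide_right_mono)
  also have "\<dots> = 4 * Z / (1 - r\<^sup>2) + 8 / (r\<^sup>2 * (1 - r\<^sup>2) * (1 - g)\<^sup>2)"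
    by (simp add: P_def B_def power2_eq_square)
  finally have "P n * (S n / q n) \<le> \<dots>" .
  moreover have "1 * (S n / q n) \<le> P n * (S n / q n)"
    using g_bounds S_nonneg[of n] q_facts(1)[of n]
    by (intro mult_right_mono) (auto simp: P_def)
  ultimately have "S n / q n \<le> 4 * Z / (1 - r\<^sup>2) + 8 / (r\<^sup>2 * (1 - r\<^sup>2) * (1 - g)\<^sup>2)" by simp
  then show ?thesis using q_facts(1)[of n] by (simp add: pos_divide_le_eq mult.commute)
qed

text \<open>The residual is part of the decrease in one Lyapunov step, with weight
  \<open>\<nu> / 2 * T^2\<close>, and \<open>T \<ge> 1\<close>. Index 0 precedes the first such step
  and is read off from \<open>lyapunov_init\<close>.\<close>

lemma residual_le:
  "(\<Sum>j<N. (norm (W (Suc n) j))\<^sup>2)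
     \<le> 2 / \<nu> * ((16 * Z / (1 - r\<^sup>2) + 32 / (r\<^sup>2 * (1 - r\<^sup>2) * (1 - g)\<^sup>2) + 3) / (1 - r) + Z) * (1 - r) ^ n"
  (is "_ \<le> 2 / \<nu> * (?Q / (1 - r) + Z) * _")
proof -
  have r2: "0 < r\<^sup>2" "0 < 1 - r\<^sup>2" using r_bounds by (auto simp: abs_square_less_1)
  have Q0: "0 \<le> ?Q"
    using r2 Z_ge_1 g_bounds by (intro add_nonneg_nonneg divide_nonneg_nonneg mult_nonneg_nonneg) auto
  show ?thesis
  proof (cases n)
    case 0
    have "0 \<le> D 1" using D_nonneg[of 0] by simp
    moreover have "0 \<le> 1 / (2 * \<nu>) * (\<Sum>j<N. (norm (X 1 j))\<^sup>2)"
      using nu by (auto intro!: divide_nonneg_nonneg sum_nonneg)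
    ultimately have "\<nu> / 2 * (\<Sum>j<N. (norm (W 1 j))\<^sup>2) \<le> Z"
      using lyapunov_init by (simp add: Z_def)
    then have "(\<Sum>j<N. (norm (W 1 j))\<^sup>2) \<le> 2 / \<nu> * Z" using nu by (simp add: field_simps)
    also have "\<dots> \<le> 2 / \<nu> * (?Q / (1 - r) + Z)"
      using nu Q0 r_bounds by (intro mult_left_mono) auto
    finally show ?thesis using 0 by simp
  next
    case (Suc m)
    define w where "w = (\<Sum>j<N. (norm (W (Suc (Suc m)) j))\<^sup>2)"
    define t where "t = T (Suc m)"
    have t: "1 \<le> t\<^sup>2" using T_bounds[of "Suc m"] by (simp add: t_def)
    have "\<nu> / 2 * t\<^sup>2 * w \<le> (1 - r\<^sup>2 * t) * S m + 3 * (t\<^sup>2 * \<delta> (Suc m))"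
      using S_step[of "1/2" m] S_nonneg[of "Suc m"] by (simp add: t_def w_def)
    also have "(1 - r\<^sup>2 * t) * S m \<le> 1 * S m"
      using r2 T_bounds[of "Suc m"] S_nonneg by (intro mult_right_mono) (auto simp: t_def)
    also have "1 * S m \<le> t\<^sup>2 * S m" using t S_nonneg by (intro mult_right_mono) auto
    finally have "t\<^sup>2 * (\<nu> / 2 * w) \<le> t\<^sup>2 * (S m + 3 * \<delta> (Suc m))" by (simp add: algebra_simps)
    then have "\<nu> / 2 * w \<le> S m + 3 * \<delta> (Suc m)"
      by (rule mult_left_le_imp_le) (use t in linarith)
    also have "\<delta> (Suc m) \<le> (1 - r) ^ m * 1"
      unfolding delta_eq power_Suc mult.assoc
      using r_bounds g_bounds
      by (subst mult.left_commute, intro mult_left_mono mult_le_one) (auto simp: power_le_one)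
    also have "S m \<le> (4 * (1 - r) ^ m) * (4 * Z / (1 - r\<^sup>2) + 8 / (r\<^sup>2 * (1 - r\<^sup>2) * (1 - g)\<^sup>2))"
      by (rule order_trans[OF S_le], rule mult_right_mono[OF q_facts(3)])
         (use r2 Z_ge_1 g_bounds in \<open>auto intro!: add_nonneg_nonneg\<close>)
    finally have "\<nu> / 2 * w \<le> ?Q * (1 - r) ^ m" by (simp add: algebra_simps)
    also have "\<dots> = ?Q / (1 - r) * (1 - r) ^ n" using Suc r_bounds by simp
    also have "\<dots> \<le> (?Q / (1 - r) + Z) * (1 - r) ^ n"
      using Z_ge_1 r_bounds by (intro mult_right_mono) auto
    finally have "2 / \<nu> * (\<nu> / 2 * w) \<le> 2 / \<nu> * ((?Q / (1 - r) + Z) * (1 - r) ^ n)"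
      using nu by (intro mult_left_mono) auto
    moreover have "2 / \<nu> * (\<nu> / 2 * w) = w" using nu by simp
    ultimately show ?thesis unfolding Suc w_def by (simp only: mult.assoc)
  qed
qed

end

text \<open>The constant of \<open>residual_le\<close> is continuous in \<nu>, hence bounded on a
  compact interval away from 0. Replacing the initial distance by \<open>A\<close> makes it the same
  for all runs.\<close>

lemma residual_le_uniform:
  fixes L \<gamma> \<nu>1 \<nu>2 A :: real
  assumes "0 < L" "0 < \<gamma>" "0 < \<nu>1"
  obtains C where "0 < C" and
    "\<And>N \<nu> D (X :: nat \<Rightarrow> nat \<Rightarrow> 'a::real_inner) W e n.
      inexact_accel_prox N L \<nu> \<gamma> D X W e \<Longrightarrow> \<nu>1 \<le> \<nu> \<Longrightarrow> \<nu> \<le> \<nu>2 \<Longrightarrow>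
      (\<Sum>j<N. (norm (X 0 j))\<^sup>2) \<le> A \<Longrightarrow>
      (\<Sum>j<N. (norm (W (Suc n) j))\<^sup>2) \<le> C * (1 - sqrt (\<nu> / (L + \<nu>))) ^ n"
proof -
  define g where "g = 1 / sqrt (1 + \<gamma>)"
  define r where "r = (\<lambda>\<nu>. sqrt (\<nu> / (L + \<nu>)))"
  define Z where "Z = (\<lambda>\<nu>. 1 / (2 * \<nu>) * A + 1)"
  define F where "F \<nu> = 2 / \<nu> * ((16 * Z \<nu> / (1 - (r \<nu>)\<^sup>2)
     + 32 / ((r \<nu>)\<^sup>2 * (1 - (r \<nu>)\<^sup>2) * (1 - g)\<^sup>2) + 3) / (1 - r \<nu>) + Z \<nu>)" for \<nu>
  have g: "g < 1" using assms by (simp add: g_def)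
  have r: "0 < r \<nu>" "r \<nu> < 1" "(r \<nu>)\<^sup>2 < 1" if "0 < \<nu>" for \<nu>
  proof -
    show a: "0 < r \<nu>" "r \<nu> < 1" using assms that by (auto simp: r_def)
    then show "(r \<nu>)\<^sup>2 < 1" by (simp add: abs_square_less_1)
  qed
  have cr: "continuous_on {\<nu>1..\<nu>2} r"
    unfolding r_def using assms by (intro continuous_intros) auto
  have "r x \<noteq> 0" "r x \<noteq> 1" "(r x)\<^sup>2 \<noteq> 1" if "x \<in> {\<nu>1..\<nu>2}" for x
    using r[of x] assms that by auto
  then have "continuous_on {\<nu>1..\<nu>2} F"
    unfolding F_def Z_def using assms g by (intro continuous_intros cr ballI) auto
  then have "bounded (F ` {\<nu>1..\<nu>2})"
    by (intro compact_imp_bounded compact_continuous_image) auto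
  then obtain C0 where C0: "\<forall>y\<in>F ` {\<nu>1..\<nu>2}. norm y \<le> C0"
    unfolding bounded_iff by blast
  show ?thesis
  proof (rule that[of "max C0 1"])
    fix N \<nu> D e n and X W :: "nat \<Rightarrow> nat \<Rightarrow> 'a"
    assume "inexact_accel_prox N L \<nu> \<gamma> D X W e" and nu: "\<nu>1 \<le> \<nu>" "\<nu> \<le> \<nu>2"
      and A: "(\<Sum>j<N. (norm (X 0 j))\<^sup>2) \<le> A"
    then interpret run: inexact_accel_prox N L \<nu> \<gamma> D X W e "r \<nu>"
       "\<lambda>n. ((1 - r \<nu>) / (1 + \<gamma>)) ^ n" "dfl_t (\<nu> / (L + \<nu>))"
      by (simp_all add: r_def)
    have Z: "run.Z \<le> Z \<nu>" unfolding run.Z_def Z_def using A assms nu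
      by (intro add_mono mult_left_mono) auto
    have r': "0 < r \<nu>" "r \<nu> < 1" "(r \<nu>)\<^sup>2 < 1" using r[of \<nu>] assms nu by auto
    have "(\<Sum>j<N. (norm (W (Suc n) j))\<^sup>2) \<le> F \<nu> * (1 - r \<nu>) ^ n"
      unfolding F_def using r' Z assms nu run.g_def g_def
      by (intro order_trans[OF run.residual_le] mult_right_mono mult_left_mono add_mono divide_right_mono)
         auto
    also have "\<dots> \<le> max C0 1 * (1 - r \<nu>) ^ n"
      using C0 nu r' by (intro mult_right_mono) (auto simp: abs_le_iff max.coboundedI1)
    finally show "(\<Sum>j<N. (norm (W (Suc n) j))\<^sup>2) \<le> max C0 1 * (1 - sqrt (\<nu> / (L + \<nu>))) ^ n"
      by (simp add: r_def)
  qed simp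
qed

section \<open>Accelerated decay and windows of small residual\<close>

text \<open>Cauchy-Schwarz and weighted arithmetic-geometric means. The cross terms use up at most
  \<open>r / 20\<close> of |x|^2 and \<open>3 * r / 50\<close> of |v|^2; the weights push the rest
  onto |u|^2, where \<open>100 * r \<le> 1 / 10\<close> leaves more than 1/4 of the available
  12/25.\<close>

lemma quadratic_form_le:
  fixes x v u :: "'a::real_inner"
  assumes "0 < r" "r \<le> 1 / 1000"
    and "cxx \<le> - r / 20" "cvv \<le> - 3 * r / 50" "\<bar>cxv\<bar> \<le> 3 * r / 50"
    and "\<bar>cxu\<bar> \<le> r" "\<bar>cvu\<bar> \<le> 3 * r" "cuu \<le> - 12 / 25"
  shows "cxx * (x \<bullet> x) + cvv * (v \<bullet> v) + cxv * (x \<bullet> v) + cxu * (x \<bullet> u) + cvu * (v \<bullet> u) + cuu * (u \<bullet> u)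
    \<le> - (u \<bullet> u) / 4"
proof -
  define X V U where "X = norm x" and "V = norm v" and "U = norm u"
  have nn: "0 \<le> X" "0 \<le> V" "0 \<le> U" by (auto simp: X_def V_def U_def)
  have cs: "c * (a \<bullet> b) \<le> d * (norm a * norm b)" if "\<bar>c\<bar> \<le> d" for c d and a b :: 'a
  proof -
    have "c * (a \<bullet> b) \<le> \<bar>c\<bar> * \<bar>a \<bullet> b\<bar>" by (metis abs_ge_self abs_mult)
    also have "\<dots> \<le> d * (norm a * norm b)"
      using that by (intro mult_mono Cauchy_Schwarz_ineq2) auto
    finally show ?thesis .
  qed
  have 1: "cxv * (x \<bullet> v) \<le> 3 * r / 50 * (X * V)" "cxu * (x \<bullet> u) \<le> r * (X * U)"
    "cvu * (v \<bullet> u) \<le> 3 * r * (V * U)"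
    unfolding X_def V_def U_def by (rule cs[OF assms(5)] cs[OF assms(6)] cs[OF assms(7)])+
  have 2: "cxx * (x \<bullet> x) \<le> - r / 20 * X\<^sup>2" "cvv * (v \<bullet> v) \<le> - 3 * r / 50 * V\<^sup>2"
    "cuu * (u \<bullet> u) \<le> - 12 / 25 * U\<^sup>2"
    unfolding X_def V_def U_def power2_norm_eq_inner
    by (rule mult_right_mono[OF assms(3) inner_ge_zero] mult_right_mono[OF assms(4) inner_ge_zero]
        mult_right_mono[OF assms(8) inner_ge_zero])+
  have a1: "2 * (X * V) \<le> X\<^sup>2 + V\<^sup>2" using sum_squares_bound[of X V] by (simp add: mult.assoc)
  have a2: "X * U \<le> X\<^sup>2 / 100 + 25 * U\<^sup>2"
    using zero_le_power2[of "X / 10 - 5 * U"] by (simp add: power2_diff power_divide power_mult_distrib field_simps)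
  have a3: "3 * (V * U) \<le> 3 * V\<^sup>2 / 100 + 75 * U\<^sup>2"
    using zero_le_power2[of "V / 10 - 5 * U"] by (simp add: power2_diff power_divide power_mult_distrib field_simps)
  have 3: "r * (3 / 50 * (X * V) + X * U + 3 * (V * U)) \<le> r * (X\<^sup>2 / 20 + 3 * V\<^sup>2 / 50 + 100 * U\<^sup>2)"
    using a1 a2 a3 assms zero_le_power2[of X] zero_le_power2[of V]
    by (intro mult_left_mono) linarith+
  have 4: "r * (100 * U\<^sup>2) \<le> 1 / 1000 * (100 * U\<^sup>2)"
    using assms by (intro mult_right_mono) auto
  have "cxx * (x \<bullet> x) + cvv * (v \<bullet> v) + cxv * (x \<bullet> v) + cxu * (x \<bullet> u) + cvu * (v \<bullet> u) + cuu * (u \<bullet> u)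
     \<le> - 12 / 25 * U\<^sup>2 + 1 / 10 * U\<^sup>2"
    using 1 2 3 4 by (simp add: algebra_simps)
  also have "\<dots> \<le> - (u \<bullet> u) / 4" by (simp add: U_def power2_norm_eq_inner)
  finally show ?thesis .
qed

text \<open>The quadratic form \<open>|v|\<^sup>2/2 + 1.3 \<langle>x,v\<rangle> + 0.4875 |x|\<^sup>2\<close> discretises the Lyapunov function
  \<open>f + |\<lambda> x + x'|\<^sup>2/2 + \<xi> |x|\<^sup>2/2\<close> of the damped system \<open>x'' + 2 x' + \<nabla>f(x) = 0\<close> with 1-strongly
  convex \<open>f\<close>, whose decay rate may be pushed from 1 to any value below 4/3; the constants
  give the rate 5/4 with room for the discretisation errors.\<close>

lemma fast_lyapunov_form:
  fixes x v u :: "'a::real_inner" and r \<beta> :: real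
  assumes r: "0 < r" "r \<le> 1 / 1000" and b: "\<bar>\<beta> - (1 - 2 * r)\<bar> \<le> r / 100"
  defines "v' \<equiv> \<beta> *\<^sub>R v - u" and "x' \<equiv> x + r *\<^sub>R (\<beta> *\<^sub>R v - u)"
  shows "(1 - r\<^sup>2) * (u \<bullet> ((13/10) *\<^sub>R x + v'))
      - 1/2 * (1 - 13/10 * r) * ((99/100) * (norm (x - x'))\<^sup>2)
      - 1/2 * (13/10 * r) * ((99/100) * (norm x')\<^sup>2)
      - r / 40 * (norm x)\<^sup>2
      + (1/2 * (norm v')\<^sup>2 + 13/10 * (x' \<bullet> v') + 39/80 * (norm x')\<^sup>2)
    \<le> (1 - 5/4 * r) * (1/2 * (norm v)\<^sup>2 + 13/10 * (x \<bullet> v) + 39/80 * (norm x)\<^sup>2) - (norm u)\<^sup>2 / 4"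
proof -
  \<comment> \<open>\<open>P\<close> and \<open>Q\<close> collect the coefficients of |v'|^2 and
    |x'|^2 once \<open>x' = x + r v'\<close> is used in \<open>x - x'\<close> and in the mixed term.
    The other constants are the coefficients, in x, v and u, of the difference of the two
    sides.\<close>
  define P where "P = 1/2 + 13/10 * r - 99/200 * (1 - 13/10 * r) * r\<^sup>2"
  define Q where "Q = 39/80 - 1287/2000 * r"
  define cxx where "cxx = - r / 40 + Q - (1 - 5/4 * r) * (39/80)"
  define cvv where "cvv = \<beta>\<^sup>2 * (P + r\<^sup>2 * Q) - 1/2 + 5/8 * r"
  define cxv where "cxv = \<beta> * (2 * r * Q + 13/10) - 13/10 + 13/8 * r"
  define cxu where "cxu = - (13/10 * r\<^sup>2) - 2 * (r * Q)"
  define cvu where "cvu = \<beta> * (1 - r\<^sup>2 - 2 * P - 2 * r\<^sup>2 * Q)"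
  define cuu where "cuu = - (1 - r\<^sup>2) + P + r\<^sup>2 * Q"
  have r2: "0 \<le> r\<^sup>2" "r\<^sup>2 \<le> r / 1000"
    using r mult_left_mono[of r "1/1000" r] by (auto simp: power2_eq_square)
  have b2: "1 - 201/100 * r \<le> \<beta>" "\<beta> \<le> 1 - 199/100 * r" "0 \<le> \<beta>" "\<beta> \<le> 1"
    using b r unfolding abs_le_iff by linarith+
  have "0 \<le> 99/200 * (1 - 13/10 * r) * r\<^sup>2" using r by simp
  moreover have "(99/200 * (1 - 13/10 * r)) * r\<^sup>2 \<le> 1 * r\<^sup>2" using r by (intro mult_right_mono) auto
  ultimately have P: "1/2 + 13/10 * r - r / 1000 \<le> P" "P \<le> 1/2 + 13/10 * r"
    using r2 unfolding P_def by linarith+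
  have Q: "48/100 \<le> Q" "Q \<le> 39/80" using r by (auto simp: Q_def)
  have "r\<^sup>2 * Q \<le> r / 1000 * (1/2)" using r2 Q r by (intro mult_mono) auto
  moreover have "0 \<le> r\<^sup>2 * Q" using Q by simp
  ultimately have r2Q: "0 \<le> r\<^sup>2 * Q" "r\<^sup>2 * Q \<le> r / 2000" by simp_all
  have rQ: "r * (48/100) \<le> r * Q" "r * Q \<le> r * (39/80)"
    using Q r by (auto intro!: mult_left_mono)
  have rQ': "r * (39/80) - r / 1000 \<le> r * Q"
  proof -
    have "r * Q = r * (39/80) - 1287/2000 * r\<^sup>2"
      by (simp add: Q_def algebra_simps power2_eq_square)
    then show ?thesis using r2 r by linarith
  qed
  have Cxx: "cxx \<le> - r / 20"
  proof -
    have "cxx = - (473/8000) * r" by (simp add: cxx_def Q_def field_simps)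
    then show ?thesis using r by simp
  qed
  have Cvv: "cvv \<le> - 3 * r / 50"
  proof -
    have "\<beta>\<^sup>2 \<le> (1 - 199/100 * r)\<^sup>2" using b2 by (intro power_mono) auto
    also have "\<dots> = 1 - 398/100 * r + 39601/10000 * r\<^sup>2" by (simp add: power2_eq_square algebra_simps)
    also have "\<dots> \<le> 1 - 3976/1000 * r" using r2 r by linarith
    finally have "\<beta>\<^sup>2 * (P + r\<^sup>2 * Q) \<le> (1 - 3976/1000 * r) * (1/2 + 13005/10000 * r)"
      using P r2Q r by (intro mult_mono) auto
    also have "\<dots> \<le> 1/2 - 6875/10000 * r" using r2 r by (simp add: algebra_simps power2_eq_square)
    finally show ?thesis unfolding cvv_def using r by linarith
  qed
  have Cxv: "\<bar>cxv\<bar> \<le> 3 * r / 50"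
  proof -
    have "\<beta> * (2 * r * Q + 13/10) \<le> (1 - 199/100 * r) * (13/10 + 975/1000 * r)"
      using b2 rQ r by (intro mult_mono) auto
    also have "\<dots> \<le> 13/10 - 1612/1000 * r" using r2 r by (simp add: algebra_simps power2_eq_square)
    finally have u: "cxv \<le> 3 * r / 50" unfolding cxv_def using r by linarith
    have "13/10 - 165/100 * r \<le> (1 - 201/100 * r) * (13/10 + 973/1000 * r)"
      using r2 r by (simp add: algebra_simps power2_eq_square)
    also have "\<dots> \<le> \<beta> * (2 * r * Q + 13/10)"
      using b2 rQ' r by (intro mult_mono) auto
    finally have "- (3 * r / 50) \<le> cxv" unfolding cxv_def using r by linarith
    with u show ?thesis by linarith
  qed
  have Cxu: "\<bar>cxu\<bar> \<le> r"
    using r2 rQ r unfolding cxu_def by linarith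
  have Cvu: "\<bar>cvu\<bar> \<le> 3 * r"
  proof -
    have "\<bar>1 - r\<^sup>2 - 2 * P - 2 * r\<^sup>2 * Q\<bar> \<le> 3 * r" using r2 r2Q P r by linarith
    then have "\<beta> * \<bar>1 - r\<^sup>2 - 2 * P - 2 * r\<^sup>2 * Q\<bar> \<le> 1 * (3 * r)" using b2 by (intro mult_mono) auto
    then show ?thesis using b2 by (simp add: cvu_def abs_mult)
  qed
  have Cuu: "cuu \<le> - 12 / 25" using r2 r2Q P r unfolding cuu_def by linarith
  have x': "x' = x + r *\<^sub>R v'" by (simp add: x'_def v'_def)
  have v'v': "v' \<bullet> v' = \<beta>\<^sup>2 * (v \<bullet> v) - 2 * \<beta> * (v \<bullet> u) + u \<bullet> u"
    by (simp add: v'_def inner_simps inner_commute algebra_simps power2_eq_square)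
  have xv': "x \<bullet> v' = \<beta> * (x \<bullet> v) - x \<bullet> u" and uv': "u \<bullet> v' = \<beta> * (v \<bullet> u) - u \<bullet> u"
    by (simp_all add: v'_def inner_simps inner_commute)
  have "(1 - r\<^sup>2) * (u \<bullet> ((13/10) *\<^sub>R x + v'))
      - 1/2 * (1 - 13/10 * r) * ((99/100) * (norm (x - x'))\<^sup>2)
      - 1/2 * (13/10 * r) * ((99/100) * (norm x')\<^sup>2)
      - r / 40 * (norm x)\<^sup>2
      + (1/2 * (norm v')\<^sup>2 + 13/10 * (x' \<bullet> v') + 39/80 * (norm x')\<^sup>2)
     = - r / 40 * (x \<bullet> x) + (1 - r\<^sup>2) * (13/10 * (x \<bullet> u) + u \<bullet> v') + P * (v' \<bullet> v')
      + Q * (x \<bullet> x + 2 * r * (x \<bullet> v') + r\<^sup>2 * (v' \<bullet> v')) + 13/10 * (x \<bullet> v')"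
    unfolding x' power2_norm_eq_inner P_def Q_def
    by (simp add: inner_simps inner_commute field_simps power2_eq_square)
  also have "\<dots> = (1 - 5/4 * r) * (1/2 * (v \<bullet> v) + 13/10 * (x \<bullet> v) + 39/80 * (x \<bullet> x))
     + (cxx * (x \<bullet> x) + cvv * (v \<bullet> v) + cxv * (x \<bullet> v) + cxu * (x \<bullet> u) + cvu * (v \<bullet> u) + cuu * (u \<bullet> u))"
    unfolding v'v' xv' uv' cxx_def cvv_def cxv_def cxu_def cvu_def cuu_def
    by (simp add: field_simps power2_eq_square)
  also have "\<dots> \<le> (1 - 5/4 * r) * (1/2 * (v \<bullet> v) + 13/10 * (x \<bullet> v) + 39/80 * (x \<bullet> x)) - (u \<bullet> u) / 4"
    using quadratic_form_le[OF r Cxx Cvv Cxv Cxu Cvu Cuu, of x v u] by linarith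
  finally show ?thesis by (simp add: power2_norm_eq_inner)
qed

text \<open>With \<open>h = s^4\<close>, the factor \<open>s^2\<close> absorbs the polynomial and
  the other \<open>s^2\<close> is summed.\<close>

lemma square_times_geometric_bounded:
  fixes h :: real
  assumes "0 < h" "h < 1"
  obtains A where "0 \<le> A" "\<And>n. (\<Sum>k<n. (real k + 1)\<^sup>2 * h ^ k) \<le> A"
proof -
  define s where "s = sqrt (sqrt h)"
  have s: "0 < s" "s < 1" and s4: "h = (s\<^sup>2)\<^sup>2"
    using assms by (auto simp: s_def)
  have "(\<lambda>n. real n * s ^ n) \<longlonglongrightarrow> 0"
    using s by (intro powser_times_n_limit_0) auto
  then have "Bseq (\<lambda>n. real n * s ^ n)" by (intro convergent_imp_Bseq convergentI)
  then obtain K where K: "\<And>n. \<bar>real n * s ^ n\<bar> \<le> K" by (auto simp: Bseq_def)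
  have K0: "0 \<le> K" using K[of 0] by simp
  have "(real k + 1)\<^sup>2 * h ^ k \<le> (K + 1)\<^sup>2 * (s\<^sup>2) ^ k" for k
  proof -
    have "(real k + 1) * s ^ k \<le> K + 1"
      using K[of k] s by (auto simp: distrib_right abs_le_iff intro!: add_mono power_le_one)
    then have "((real k + 1) * s ^ k)\<^sup>2 * (s\<^sup>2) ^ k \<le> (K + 1)\<^sup>2 * (s\<^sup>2) ^ k"
      using s by (intro mult_right_mono power_mono) auto
    then show ?thesis by (simp add: s4 power_mult_distrib power2_eq_square mult_ac)
  qed
  then have "(\<Sum>k<n. (real k + 1)\<^sup>2 * h ^ k) \<le> (\<Sum>k<n. (K + 1)\<^sup>2 * (s\<^sup>2) ^ k)" for n
    by (intro sum_mono)
  also have "(\<Sum>k<n. (K + 1)\<^sup>2 * (s\<^sup>2) ^ k) \<le> (K + 1)\<^sup>2 * (1 / (1 - s\<^sup>2))" for n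
    unfolding sum_distrib_left[symmetric]
    using s by (intro mult_left_mono geometric_partial_sum_le) (auto simp: abs_square_less_1)
  finally show ?thesis
    using s by (intro that[of "(K + 1)\<^sup>2 * (1 / (1 - s\<^sup>2))"]) (auto simp: power_le_one)
qed

section \<open>The sublinear phase and the modified Lyapunov function\<close>

context inexact_accel_prox
begin

text \<open>Discarding the strong convexity gained in \<open>V\<close> costs nothing here, since
  \<open>(1 - r\<^sup>2 T n) / (1 - r\<^sup>2) \<le> 1\<close>; what remains is the sublinear rate with constants of the right
  order in \<open>\<nu>\<close>.\<close>

lemma sublinear_bound:
  "(T n)\<^sup>2 * D (Suc n) + 1 / (2 * \<nu>) * (\<Sum>j<N. (norm (V n j))\<^sup>2)
     \<le> Z + (\<Sum>k<Suc n. (real k + 1)\<^sup>2 * (1 / (1 + \<gamma>)) ^ k)"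
proof (induction n)
  case 0
  have "0 \<le> \<nu> / 2 * (\<Sum>j<N. (norm (W 1 j))\<^sup>2)"
    using nu by (intro mult_nonneg_nonneg sum_nonneg) auto
  then show ?case using lyapunov_init by (simp add: Z_def V_def T_def)
next
  case (Suc n)
  define t where "t = T (Suc n)"
  define v where "v = (\<Sum>j<N. (norm (V n j))\<^sup>2)"
  have t: "1 \<le> t" "t \<le> real n + 2"
    using T_bounds[of "Suc n"] dfl_t_le_Suc[OF r_bounds, of "Suc n"] by (auto simp: t_def T_def')
  have v0: "0 \<le> v" unfolding v_def by (intro sum_nonneg) auto
  have r2: "0 < 1 - r\<^sup>2" "0 \<le> r\<^sup>2" using r_bounds by (auto simp: abs_square_less_1)
  have le: "1 - r\<^sup>2 * t \<le> 1 - r\<^sup>2" using mult_left_mono[of 1 t "r\<^sup>2"] t r2 by simp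
  have k: "1 / (2 * \<nu>) + 1 / (2 * L) = 1 / (2 * \<nu>) / (1 - r\<^sup>2)"
    unfolding rho_sq[symmetric] using L nu by (simp add: field_simps)
  have 1: "(1 - r\<^sup>2 * t) * ((1 / (2 * \<nu>) + 1 / (2 * L)) * v) \<le> 1 / (2 * \<nu>) * v"
  proof -
    have "(1 - r\<^sup>2 * t) * ((1 / (2 * \<nu>) + 1 / (2 * L)) * v)
       \<le> (1 - r\<^sup>2) * ((1 / (2 * \<nu>) + 1 / (2 * L)) * v)"
      using le L nu v0 by (intro mult_right_mono) auto
    also have "\<dots> = 1 / (2 * \<nu>) * v" unfolding k using r2 by simp
    finally show ?thesis .
  qed
  have 2: "(1 - r\<^sup>2 * t) * ((T n)\<^sup>2 * D (Suc n)) \<le> 1 * ((T n)\<^sup>2 * D (Suc n))"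
    using t r2 D_nonneg[of n] by (intro mult_right_mono) (auto intro!: mult_nonneg_nonneg)
  have 3: "t\<^sup>2 * \<delta> (Suc n) \<le> (real (Suc n) + 1)\<^sup>2 * (1 / (1 + \<gamma>)) ^ Suc n"
    unfolding \<delta>_def using t r_bounds gam
    by (intro mult_mono power_mono divide_right_mono) auto
  have 4: "0 \<le> 1 / (2 * L) * (\<Sum>j<N. (norm (V (Suc n) j + t *\<^sub>R e (Suc (Suc n)) j))\<^sup>2)"
    "0 \<le> \<nu> / 2 * t\<^sup>2 * (\<Sum>j<N. (norm (W (Suc (Suc n)) j))\<^sup>2)"
    using L nu by (intro mult_nonneg_nonneg sum_nonneg; simp)+
  show ?case
    using lyapunov_step[of n] Suc 1 2 3 4
    unfolding t_def[symmetric] v_def[symmetric] distrib_left by simp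
qed

text \<open>Velocity in the rescaled time \<open>r * n\<close> of the limiting system.\<close>

definition vel where "vel n j = (1 / r) *\<^sub>R (X (Suc n) j - X n j)"

text \<open>Scaling the gap by \<open>L\<close> gives quadratic growth with modulus 1
  (\<open>growth'\<close>), matching the 1-strongly convex model.\<close>

definition E where
  "E n = L * D (Suc n) + (\<Sum>j<N. 1/2 * (norm (vel n j))\<^sup>2 + 13/10 * (X (Suc n) j \<bullet> vel n j)
     + 39/80 * (norm (X (Suc n) j))\<^sup>2)"

lemma growth': "1/2 * (\<Sum>j<N. (norm (X (Suc n) j))\<^sup>2) \<le> L * D (Suc n)"
  using growth[of n] L by (simp add: field_simps)

text \<open>The quadratic form alone is indefinite. The growth of \<open>L * D\<close> supplies
  another |x|^2 / 2, after which completing the square works because 169/200 < 79/80.\<close>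

lemma E_nonneg: "0 \<le> E n"
proof -
  have "0 \<le> 1/2 * (norm x)\<^sup>2 + (1/2 * (norm v)\<^sup>2 + 13/10 * (x \<bullet> v) + 39/80 * (norm x)\<^sup>2)" for x v :: 'a
  proof -
    have "0 \<le> (norm (v + (13/10) *\<^sub>R x))\<^sup>2 / 2" by simp
    also have "\<dots> = 1/2 * (norm v)\<^sup>2 + 13/10 * (x \<bullet> v) + 169/200 * (norm x)\<^sup>2"
      unfolding power2_norm_eq_inner by (simp add: inner_simps inner_commute algebra_simps)
    also have "\<dots> \<le> 1/2 * (norm v)\<^sup>2 + 13/10 * (x \<bullet> v) + 79/80 * (norm x)\<^sup>2"
      by (intro add_left_mono mult_right_mono) auto
    finally show ?thesis by simp
  qed
  then have "0 \<le> (\<Sum>j<N. 1/2 * (norm (X (Suc n) j))\<^sup>2 + (1/2 * (norm (vel n j))\<^sup>2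
     + 13/10 * (X (Suc n) j \<bullet> vel n j) + 39/80 * (norm (X (Suc n) j))\<^sup>2))"
    by (intro sum_nonneg) auto
  then show ?thesis
    using growth'[of n] unfolding E_def sum.distrib[of "\<lambda>j. 1/2 * (norm (X (Suc n) j))\<^sup>2"]
      sum_distrib_left[symmetric] by linarith
qed

lemma nu_L: "\<nu> * (1 - r\<^sup>2) = L * r\<^sup>2"
  unfolding rho_sq[symmetric] using L nu by (simp add: field_simps)

text \<open>As in \<open>lyapunov_step\<close>, but with the fixed weights \<open>l\<close> and
  \<open>1 - l\<close> for \<open>opt\<close> and \<open>descent\<close>, since the momentum is
  nearly stationary here. The algebra per client is \<open>fast_lyapunov_form\<close>.\<close>

lemma E_step:
  assumes small: "r \<le> 1 / 1000" and tau: "999 / 1000 \<le> r * T n"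
  shows "E (Suc n) \<le> (1 - 5/4 * r) * E n - 1/4 * (\<nu> / r)\<^sup>2 * (\<Sum>j<N. (norm (W (Suc (Suc n)) j))\<^sup>2)
     + 101 * L * \<delta> (Suc n)"
proof -
  define \<beta> where "\<beta> = dfl_beta (r\<^sup>2) n"
  have beta: "\<bar>\<beta> - (1 - 2 * r)\<bar> \<le> r / 100"
    unfolding \<beta>_def using dfl_beta_near[OF r_bounds small] tau by (simp add: T_def')
  have r0: "0 < r" "r < 1" by (fact r_bounds)+
  define x x' w ee where "x = X (Suc n)" and "x' = X (Suc (Suc n))" and "w = W (Suc (Suc n))"
    and "ee = e (Suc (Suc n))"
  define u where "u j = (\<nu> / r) *\<^sub>R w j" for j
  have vel': "vel (Suc n) j = \<beta> *\<^sub>R vel n j - u j" if "j < N" for j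
  proof -
    have "X (Suc (Suc n)) j - X (Suc n) j = \<beta> *\<^sub>R (X (Suc n) j - X n j) - \<nu> *\<^sub>R w j"
      using step[OF that, of n] by (simp add: rho_sq \<beta>_def w_def)
    then show ?thesis by (simp add: vel_def u_def scaleR_diff_right mult.commute)
  qed
  have x': "x' j = x j + r *\<^sub>R (\<beta> *\<^sub>R vel n j - u j)" if "j < N" for j
    unfolding vel'[OF that, symmetric] using r0 by (simp add: vel_def x_def x'_def)
  have w: "L * (w j \<bullet> z) = (1 - r\<^sup>2) / r * (u j \<bullet> z)" for j z
  proof -
    have "(1 - r\<^sup>2) / r * (\<nu> / r) = L"
      using nu_L r0 by (simp add: field_simps power2_eq_square)
    then show ?thesis by (simp add: u_def) (metis mult.assoc times_divide_eq_left times_divide_eq_right)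
  qed
  define G where "G j = 1/2 * (norm (vel n j))\<^sup>2 + 13/10 * (x j \<bullet> vel n j) + 39/80 * (norm (x j))\<^sup>2" for j
  define G' where "G' j = 1/2 * (norm (vel (Suc n) j))\<^sup>2 + 13/10 * (x' j \<bullet> vel (Suc n) j)
      + 39/80 * (norm (x' j))\<^sup>2" for j
  define A where "A j = - (w j \<bullet> x' j) + 1 / (2 * L) * (norm (x' j + ee j))\<^sup>2" for j
  define B where "B j = w j \<bullet> (x j - x' j) + 1 / (2 * L) * (norm (x j - x' j - ee j))\<^sup>2" for j
  \<comment> \<open>With the mixed coefficient 13/10 of the form, this weight makes
    \<open>(1 - l) x - x'\<close> equal to \<open>- r (13/10 x + v')\<close>, where
    \<open>v'\<close> is the new velocity; the residual then pairs with what
    \<open>fast_lyapunov_form\<close> expects.\<close>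
  define l where "l = 13/10 * r"
  have l: "0 \<le> l" "l \<le> 1" using small r0 by (auto simp: l_def)
  have pt: "- l * (L * A j) - (1 - l) * (L * B j) + G' j - r / 40 * (norm (x j))\<^sup>2
     \<le> (1 - 5/4 * r) * G j - 1/4 * (\<nu> / r)\<^sup>2 * (norm (w j))\<^sup>2 + 50 * (norm (ee j))\<^sup>2"
    if j: "j < N" for j
  proof -
    \<comment> \<open>Young with parameter 1/100: the factor 99/100 is allowed for in
      \<open>fast_lyapunov_form\<close>, and \<open>50 * |ee|^2\<close> costs
      \<open>100 * L * \<delta>\<close>. The direct contribution of the errors raises this to
      101.\<close>
    have e1: "99/100 * (norm (x' j))\<^sup>2 - 100 * (norm (ee j))\<^sup>2 \<le> (norm (x' j + ee j))\<^sup>2"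
      using norm_add_sq_ge[of "1/100" "x' j" "ee j"] by simp
    have e2: "99/100 * (norm (x j - x' j))\<^sup>2 - 100 * (norm (ee j))\<^sup>2 \<le> (norm (x j - x' j - ee j))\<^sup>2"
      using norm_add_sq_ge[of "1/100" "x j - x' j" "- ee j"] by simp
    have "l * (99/100 * (norm (x' j))\<^sup>2 - 100 * (norm (ee j))\<^sup>2)
        + (1 - l) * (99/100 * (norm (x j - x' j))\<^sup>2 - 100 * (norm (ee j))\<^sup>2)
      \<le> l * (norm (x' j + ee j))\<^sup>2 + (1 - l) * (norm (x j - x' j - ee j))\<^sup>2"
      using l e1 e2 by (intro add_mono mult_left_mono) auto
    then have e3: "1/2 * l * (99/100 * (norm (x' j))\<^sup>2) + 1/2 * (1 - l) * (99/100 * (norm (x j - x' j))\<^sup>2)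
       - 50 * (norm (ee j))\<^sup>2 \<le> 1/2 * (l * (norm (x' j + ee j))\<^sup>2 + (1 - l) * (norm (x j - x' j - ee j))\<^sup>2)"
      by (simp add: algebra_simps)
    have e4: "l * (L * A j) + (1 - l) * (L * B j)
       = 1/2 * (l * (norm (x' j + ee j))\<^sup>2 + (1 - l) * (norm (x j - x' j - ee j))\<^sup>2)
         - (1 - r\<^sup>2) * (u j \<bullet> ((13/10) *\<^sub>R x j + vel (Suc n) j))"
    proof -
      have "l * (L * A j) + (1 - l) * (L * B j)
        = 1/2 * (l * (norm (x' j + ee j))\<^sup>2 + (1 - l) * (norm (x j - x' j - ee j))\<^sup>2)
         + L * (w j \<bullet> ((1 - l) *\<^sub>R x j - x' j))"
        using L by (simp add: A_def B_def inner_simps field_simps)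
      also have "(1 - l) *\<^sub>R x j - x' j = - (r *\<^sub>R ((13/10) *\<^sub>R x j + vel (Suc n) j))"
        unfolding x'[OF j] vel'[OF j] by (simp add: l_def algebra_simps)
      also have "L * (w j \<bullet> - (r *\<^sub>R ((13/10) *\<^sub>R x j + vel (Suc n) j)))
        = - ((1 - r\<^sup>2) * (u j \<bullet> ((13/10) *\<^sub>R x j + vel (Suc n) j)))"
        unfolding w using r0 by simp
      finally show ?thesis by simp
    qed
    have nu: "(norm (u j))\<^sup>2 / 4 = 1/4 * (\<nu> / r)\<^sup>2 * (norm (w j))\<^sup>2"
      by (simp add: u_def power_mult_distrib power_divide)
    have "(1 - r\<^sup>2) * (u j \<bullet> ((13/10) *\<^sub>R x j + vel (Suc n) j))
      - 1/2 * (1 - l) * ((99/100) * (norm (x j - x' j))\<^sup>2)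
      - 1/2 * l * ((99/100) * (norm (x' j))\<^sup>2) - r / 40 * (norm (x j))\<^sup>2 + G' j
      \<le> (1 - 5/4 * r) * G j - (norm (u j))\<^sup>2 / 4"
      using fast_lyapunov_form[OF r0(1) small beta, of "u j" "x j" "vel n j"]
      unfolding G_def G'_def l_def x'[OF j] vel'[OF j] .
    then show ?thesis using e3 e4 unfolding nu by linarith
  qed
  have "(\<Sum>j<N. - l * (L * A j) - (1 - l) * (L * B j) + G' j - r / 40 * (norm (x j))\<^sup>2)
     \<le> (\<Sum>j<N. (1 - 5/4 * r) * G j - 1/4 * (\<nu> / r)\<^sup>2 * (norm (w j))\<^sup>2 + 50 * (norm (ee j))\<^sup>2)"
    using pt by (intro sum_mono) auto
  then have 1: "- l * (L * sum A {..<N}) - (1 - l) * (L * sum B {..<N}) + sum G' {..<N}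
       - r / 40 * (\<Sum>j<N. (norm (x j))\<^sup>2)
     \<le> (1 - 5/4 * r) * sum G {..<N} - 1/4 * (\<nu> / r)\<^sup>2 * (\<Sum>j<N. (norm (w j))\<^sup>2)
       + 50 * (\<Sum>j<N. (norm (ee j))\<^sup>2)"
    by (simp only: sum.distrib sum_subtractf sum_distrib_left)
  have "D (Suc (Suc n)) \<le> - sum A {..<N} + \<delta> (Suc n)"
    using opt[of "Suc n"]
    by (simp add: A_def x'_def w_def ee_def sum.distrib sum_subtractf sum_negf sum_distrib_left)
  then have 2: "l * (L * D (Suc (Suc n))) \<le> l * (L * (- sum A {..<N} + \<delta> (Suc n)))"
    using l L by (intro mult_left_mono) auto
  have "D (Suc (Suc n)) \<le> D (Suc n) - sum B {..<N} + \<delta> (Suc n)"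
    using descent[of n] by (simp add: B_def x_def x'_def w_def ee_def sum.distrib sum_distrib_left)
  then have 3: "(1 - l) * (L * D (Suc (Suc n))) \<le> (1 - l) * (L * (D (Suc n) - sum B {..<N} + \<delta> (Suc n)))"
    using l L by (intro mult_left_mono) auto
  have 4: "50 * (\<Sum>j<N. (norm (ee j))\<^sup>2) \<le> 100 * L * \<delta> (Suc n)"
    using err[of "Suc n"] L by (simp add: ee_def field_simps)
  \<comment> \<open>The gap contracts by \<open>1 - 13/10 * r\<close>, only
    \<open>1 - 5/4 * r\<close> is claimed; the difference, turned into |x|^2 by quadratic growth, is
    the term \<open>r / 40\<close> in \<open>pt\<close>.\<close>
  have 5: "r / 40 * (\<Sum>j<N. (norm (x j))\<^sup>2) \<le> r / 20 * (L * D (Suc n))"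
    using mult_left_mono[OF growth'[of n], of "r / 20"] r0 by (simp add: x_def)
  have E: "E n = L * D (Suc n) + sum G {..<N}" "E (Suc n) = L * D (Suc (Suc n)) + sum G' {..<N}"
    by (simp_all add: E_def G_def G'_def x_def x'_def)
  have "L * D (Suc (Suc n)) \<le> (1 - l) * (L * D (Suc n)) - l * (L * sum A {..<N}) - (1 - l) * (L * sum B {..<N})
      + L * \<delta> (Suc n)"
    using 2 3 by (simp add: algebra_simps)
  moreover have "(1 - l) * (L * D (Suc n)) = (1 - 5/4 * r) * (L * D (Suc n)) - r / 20 * (L * D (Suc n))"
    by (simp add: l_def algebra_simps)
  ultimately show ?thesis
    using 1 4 5 unfolding E distrib_left w_def[symmetric] by linarith
qed

end

lemma one_minus_power_le_exp:
  fixes a :: real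
  assumes "a \<le> 1"
  shows "(1 - a) ^ n \<le> exp (- a * real n)"
proof -
  have "(1 - a) ^ n \<le> exp (- a) ^ n"
    using assms exp_ge_add_one_self[of "- a"] by (intro power_mono) auto
  then show ?thesis by (simp add: exp_of_nat2_mult[symmetric] mult.commute)
qed

section \<open>Linking the sublinear phase to a window of small residual\<close>

context inexact_accel_prox
begin

text \<open>The threshold 11 comes from \<open>2 * exp (- 11) \<le> 2 / 2048 < 1 / 1000\<close>,
  with e estimated by 2 from below.\<close>

lemma tau_near_1:
  assumes "11 \<le> r * real n"
  shows "999 / 1000 \<le> r * T n"
proof -
  have "(2::real) ^ 11 \<le> exp 1 ^ 11" using exp_ge_add_one_self[of 1] by (intro power_mono) auto
  then have e11: "2048 \<le> exp (11::real)" by (simp add: exp_of_nat2_mult[symmetric])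
  have "1 - r * T n \<le> (1 - r) ^ n * (1 + r * T n)"
    using one_minus_tau_le[OF r_bounds, of n] by (simp add: T_def')
  also have "\<dots> \<le> exp (- 11) * 2"
  proof (intro mult_mono)
    show "(1 - r) ^ n \<le> exp (- 11)"
      using r_bounds assms by (intro order_trans[OF one_minus_power_le_exp]) auto
  qed (use T_bounds[of n] in auto)
  also have "\<dots> \<le> 1 / 1000" using e11 by (simp add: exp_minus field_simps)
  finally show ?thesis by simp
qed

text \<open>Here \<open>T n\<close> is close to \<open>1 / r\<close>, so \<open>\<nu> * T^2\<close>
  is comparable to \<open>L\<close> and the sublinear estimate bounds \<open>L * D\<close>. The
  velocity is recovered from \<open>V\<close> and \<open>X\<close>. In the hypothesis the factor
  \<nu> cancels the \<open>1 / \<nu>\<close> inside \<open>Z\<close>, so \<open>B\<close> need not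
  grow as \<nu> tends to 0.\<close>

lemma E_init:
  assumes small: "r \<le> 1 / 1000" and tau: "999 / 1000 \<le> r * T n"
    and B: "\<nu> * (Z + (\<Sum>k<Suc n. (real k + 1)\<^sup>2 * (1 / (1 + \<gamma>)) ^ k)) \<le> B" (is "\<nu> * ?Y \<le> B")
  shows "E n \<le> 60 * B"
proof -
  define x v where "x = (\<Sum>j<N. (norm (X (Suc n) j))\<^sup>2)" and "v = (\<Sum>j<N. (norm (V n j))\<^sup>2)"
  have v0: "0 \<le> v" unfolding v_def by (intro sum_nonneg) auto
  have r0: "0 < r" "r < 1" by (fact r_bounds)+
  have TD: "0 \<le> (T n)\<^sup>2 * D (Suc n)" using D_nonneg[of n] by simp
  have nv: "0 \<le> 1 / (2 * \<nu>) * v" using v0 nu by simp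
  have s: "(T n)\<^sup>2 * D (Suc n) + 1 / (2 * \<nu>) * v \<le> ?Y"
    using sublinear_bound[of n] by (simp add: v_def)
  have "\<nu> * ((T n)\<^sup>2 * D (Suc n)) \<le> \<nu> * ?Y" using s nv nu by (intro mult_left_mono) auto
  then have d1: "\<nu> * ((T n)\<^sup>2 * D (Suc n)) \<le> B" using B by linarith
  have "\<nu> * (1 / (2 * \<nu>) * v) \<le> \<nu> * ?Y" using s TD nu by (intro mult_left_mono) auto
  then have v: "v \<le> 2 * B" using B nu by simp
  have LD: "L * D (Suc n) \<le> 2 * B"
  proof -
    have "(1/2) \<le> (999/1000 :: real)\<^sup>2" by (simp add: power2_eq_square)
    also have "\<dots> \<le> (r * T n)\<^sup>2" using tau by (intro power_mono) auto
    finally have "1/2 * (L * D (Suc n)) \<le> (r * T n)\<^sup>2 * (L * D (Suc n))"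
      using L D_nonneg[of n] by (intro mult_right_mono) auto
    also have "\<dots> = (L * r\<^sup>2) * ((T n)\<^sup>2 * D (Suc n))" by (simp add: power_mult_distrib)
    also have "\<dots> = (1 - r\<^sup>2) * (\<nu> * ((T n)\<^sup>2 * D (Suc n)))" by (simp add: nu_L[symmetric])
    also have "\<dots> \<le> 1 * (\<nu> * ((T n)\<^sup>2 * D (Suc n)))"
      using D_nonneg[of n] nu by (intro mult_right_mono mult_nonneg_nonneg) auto
    finally show ?thesis using d1 by simp
  qed
  have x: "x \<le> 4 * B" using growth'[of n] LD by (simp add: x_def)
  have vel: "(norm (vel n j))\<^sup>2 \<le> 4 * (norm (V n j))\<^sup>2 + 4 * (norm (X (Suc n) j))\<^sup>2" for j
  proof -
    have eq: "(r * T n - r) *\<^sub>R vel n j = V n j - X (Suc n) j"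
      using r0 by (simp add: vel_def V_def algebra_simps)
    have "(1/2) \<le> (99/100 :: real)\<^sup>2" by (simp add: power2_eq_square)
    also have "\<dots> \<le> (r * T n - r)\<^sup>2" using tau small by (intro power_mono) auto
    finally have "1/2 * (norm (vel n j))\<^sup>2 \<le> (r * T n - r)\<^sup>2 * (norm (vel n j))\<^sup>2"
      by (intro mult_right_mono) auto
    also have "\<dots> = (norm (V n j - X (Suc n) j))\<^sup>2"
      unfolding eq[symmetric] by (simp add: power_mult_distrib)
    also have "\<dots> \<le> 2 * (norm (V n j))\<^sup>2 + 2 * (norm (X (Suc n) j))\<^sup>2"
    proof -
      have "0 \<le> (norm (V n j + X (Suc n) j))\<^sup>2" by simp
      then show ?thesis
        unfolding power2_norm_eq_inner by (simp add: inner_simps inner_commute)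
    qed
    finally show ?thesis by simp
  qed
  have "1/2 * (norm (vel n j))\<^sup>2 + 13/10 * (X (Suc n) j \<bullet> vel n j) + 39/80 * (norm (X (Suc n) j))\<^sup>2
      \<le> 8 * (norm (V n j))\<^sup>2 + 10 * (norm (X (Suc n) j))\<^sup>2" for j
  proof -
    have "0 \<le> (norm (X (Suc n) j - vel n j))\<^sup>2" by simp
    then have "2 * (X (Suc n) j \<bullet> vel n j) \<le> (norm (X (Suc n) j))\<^sup>2 + (norm (vel n j))\<^sup>2"
      unfolding power2_norm_eq_inner by (simp add: inner_simps inner_commute)
    then show ?thesis using vel[of j] zero_le_power2[of "norm (X (Suc n) j)"] zero_le_power2[of "norm (vel n j)"] zero_le_power2[of "norm (V n j)"] by linarith
  qed
  then have "E n \<le> L * D (Suc n) + (\<Sum>j<N. 8 * (norm (V n j))\<^sup>2 + 10 * (norm (X (Suc n) j))\<^sup>2)"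
    unfolding E_def by (intro add_left_mono sum_mono)
  also have "\<dots> = L * D (Suc n) + 8 * v + 10 * x"
    by (simp add: v_def x_def sum.distrib sum_distrib_left)
  finally show ?thesis using LD v x v0 by linarith
qed

definition residual where "residual n = 1/4 * (\<nu> / r)\<^sup>2 * (\<Sum>j<N. (norm (W (Suc (Suc n)) j))\<^sup>2)"

text \<open>\<open>E_step\<close> divided by powers of \<open>q = 1 - 5/4 * r\<close> telescopes. As
  \<open>q\<close> is below \<open>1 - r\<close>, the errors must beat a faster rate than the one
  built into them; one factor \<open>g\<close> makes up for this when
  \<open>1 + r \<le> sqrt (1 + \<gamma>)\<close>, and the second factor \<open>g\<close>
  sums.\<close>

lemma weighted_residual_sum:
  assumes small: "r \<le> 1 / 1000" "1 + r \<le> sqrt (1 + \<gamma>)" and k0: "11 \<le> r * real k0"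
  shows "(\<Sum>i<k. residual (k0 + i) / (1 - 5/4 * r) ^ Suc i) \<le> E k0 + 101 * L / (1 - g)"
proof -
  define q where "q = 1 - 5/4 * r"
  have r0: "0 < r" "r < 1" by (fact r_bounds)+
  have q: "0 < q" "q < 1" using r0 small by (auto simp: q_def)
  have rq: "(1 - r) / q * g \<le> 1"
  proof -
    have "1 - r \<le> (1 + r) * q"
      using small r0 mult_left_mono[of r "1/1000" r] by (simp add: q_def algebra_simps)
    then have "(1 - r) / q \<le> 1 + r" using q by (simp add: divide_le_eq)
    also have "\<dots> \<le> sqrt (1 + \<gamma>)" by (fact small)
    finally have "(1 - r) / q * g \<le> sqrt (1 + \<gamma>) * g" using g_bounds by (intro mult_right_mono) auto
    then show ?thesis using gam by (simp add: g_def)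
  qed
  have d: "\<delta> (Suc (k0 + i)) / q ^ Suc i \<le> g ^ i" for i
  proof -
    have "\<delta> (Suc (k0 + i)) / q ^ Suc i = ((1 - r) * g\<^sup>2) ^ k0 * (((1 - r) / q * g) ^ Suc i * g ^ Suc i)"
      unfolding delta_eq power_mult_distrib[symmetric] add_Suc_right[symmetric] power_add
      by (simp add: power_mult_distrib power_divide power2_eq_square)
    also have "\<dots> \<le> 1 * (1 * g ^ i)"
    proof (intro mult_mono)
      show "((1 - r) * g\<^sup>2) ^ k0 \<le> 1"
        using r0 g_bounds by (intro power_le_one mult_le_one) (auto simp: power_le_one)
      show "((1 - r) / q * g) ^ Suc i \<le> 1"
        using r0 g_bounds q rq by (intro power_le_one) auto
      show "g ^ Suc i \<le> g ^ i" using g_bounds by (intro power_decreasing) auto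
    qed (use r0 g_bounds q in auto)
    finally show ?thesis by simp
  qed
  have "E (k0 + k) / q ^ k + (\<Sum>i<k. residual (k0 + i) / q ^ Suc i) \<le> E k0 + 101 * L * (\<Sum>i<k. g ^ i)"
  proof (induction k)
    case (Suc k)
    have "r * real k0 \<le> r * real (k0 + k)" using r0 by (intro mult_left_mono) auto
    then have "11 \<le> r * real (k0 + k)" using k0 by linarith
    from E_step[OF small(1) tau_near_1[OF this]]
    have "E (Suc (k0 + k)) \<le> q * E (k0 + k) - residual (k0 + k) + 101 * L * \<delta> (Suc (k0 + k))"
      by (simp add: q_def residual_def)
    then have "E (Suc (k0 + k)) / q ^ Suc k \<le> (q * E (k0 + k) - residual (k0 + k) + 101 * L * \<delta> (Suc (k0 + k))) / q ^ Suc k"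
      using q by (intro divide_right_mono) auto
    also have "\<dots> = E (k0 + k) / q ^ k - residual (k0 + k) / q ^ Suc k + 101 * L * (\<delta> (Suc (k0 + k)) / q ^ Suc k)"
      using q by (simp add: add_divide_distrib diff_divide_distrib)
    also have "\<dots> \<le> E (k0 + k) / q ^ k - residual (k0 + k) / q ^ Suc k + 101 * L * g ^ k"
      using d[of k] L by (intro add_left_mono mult_left_mono) auto
    finally show ?case using Suc by (simp add: distrib_left)
  qed simp
  also have "\<dots> \<le> E k0 + 101 * L * (1 / (1 - g))"
    using L g_bounds by (intro add_left_mono mult_left_mono geometric_partial_sum_le) auto
  moreover have "0 \<le> E (k0 + k) / q ^ k" using E_nonneg q by simp
  ultimately show ?thesis by (simp add: q_def)
qed

lemma window_residual:
  assumes small: "r \<le> 1 / 1000" "1 + r \<le> sqrt (1 + \<gamma>)" and M: "14 \<le> r * real M"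
    and B: "\<And>n. \<nu> * (Z + (\<Sum>k<n. (real k + 1)\<^sup>2 * (1 / (1 + \<gamma>)) ^ k)) \<le> B"
  shows "\<exists>n. n < M \<and> r * (real M - real n) \<le> 2 \<and>
    (\<Sum>j<N. (norm (W (Suc n) j))\<^sup>2) \<le> 4 * exp 17 / L\<^sup>2 * (60 * B + 101 * L / (1 - g)) / r * exp (- 5/4 * r * real M)"
proof -
  define q where "q = 1 - 5/4 * r"
  define C where "C = 60 * B + 101 * L / (1 - g)"
  have r0: "0 < r" "r < 1" by (fact r_bounds)+
  have q: "0 < q" "q < 1" using r0 small by (auto simp: q_def)
  define k0 m where "k0 = nat \<lceil>11 / r\<rceil>" and "m = nat \<lceil>1 / r\<rceil>"
  have "11 / r \<le> real k0" "real k0 \<le> 11 / r + 1" "1 / r \<le> real m" "real m \<le> 1 / r + 1"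
    using r0 by (auto simp: k0_def m_def)
  then have k0: "11 \<le> r * real k0" "r * real k0 \<le> 11 + r" and m: "1 \<le> r * real m" "r * real m \<le> 1 + r"
    using r0 by (auto simp: field_simps)
  have m0: "0 < m" using m by (cases m) auto
  have "r * real (k0 + m + 1) \<le> r * real M"
    using k0 m M small by (simp add: distrib_left)
  then have kM: "k0 + m + 1 \<le> M" using r0 by simp
  \<comment> \<open>\<open>residual n\<close> concerns \<open>W (Suc (Suc n))\<close> while the
    claim is about \<open>W (Suc n)\<close>; with this \<open>k\<close>, every \<open>i < k\<close>
    gives an admissible index \<open>Suc (k0 + i) < M\<close>.\<close>
  define k where "k = M - k0 - 1"
  have k: "m \<le> k" "M = k0 + k + 1" using kM by (auto simp: k_def)
  have E0: "E k0 \<le> 60 * B" by (rule E_init[OF small(1) tau_near_1[OF k0(1)] B])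
  have C: "(\<Sum>i<k. residual (k0 + i) / q ^ Suc i) \<le> C"
    using weighted_residual_sum[OF small k0(1), of k] E0 by (simp add: C_def q_def)
  have a0: "0 \<le> residual n" for n unfolding residual_def by (intro mult_nonneg_nonneg sum_nonneg) auto
  have C0: "0 \<le> C"
    using E_nonneg[of k0] E0 g_bounds L by (simp add: C_def)
  have "\<exists>i. k - m \<le> i \<and> i < k \<and> residual (k0 + i) \<le> C / real m * q ^ (k - m)"
  proof (rule ccontr)
    assume "\<not> ?thesis"
    then have neg: "C / real m * q ^ (k - m) < residual (k0 + i)" if "i \<in> {k - m..<k}" for i
      using that by force
    have "(\<Sum>i\<in>{k - m..<k}. C / real m) < (\<Sum>i\<in>{k - m..<k}. residual (k0 + i) / q ^ Suc i)"
    proof (intro sum_strict_mono)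
      fix i assume i: "i \<in> {k - m..<k}"
      have "q ^ Suc i \<le> q ^ (k - m)" using i q by (intro power_decreasing) auto
      then have "C / real m * q ^ Suc i \<le> C / real m * q ^ (k - m)"
        using C0 by (intro mult_left_mono) auto
      then have "C / real m * q ^ Suc i < residual (k0 + i)" using neg[OF i] by simp
      then show "C / real m < residual (k0 + i) / q ^ Suc i"
        using q by (simp add: pos_less_divide_eq del: power_Suc)
    qed (use m0 k in auto)
    also have "\<dots> \<le> (\<Sum>i<k. residual (k0 + i) / q ^ Suc i)"
      using a0 q by (intro sum_mono2) auto
    finally show False using C m0 k by simp
  qed
  then obtain i where i: "k - m \<le> i" "i < k" "residual (k0 + i) \<le> C / real m * q ^ (k - m)" by blast
  have "1 / real m \<le> r" using m m0 by (simp add: field_simps)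
  \<comment> \<open>Compared with \<open>M\<close>, the exponent misses \<open>k0\<close>,
    \<open>m\<close> and 1. Multiplied by r these are at most \<open>12 + 3 * r \<le> 13\<close>,
    and \<open>5/4 * 13 < 17\<close>.\<close>
  moreover have "q ^ (k - m) \<le> exp 17 * exp (- 5/4 * r * real M)"
  proof -
    have "q ^ (k - m) \<le> exp (- (5/4 * r) * real (k - m))"
      unfolding q_def using small by (intro one_minus_power_le_exp) auto
    also have "\<dots> \<le> exp (17 + - 5/4 * r * real M)"
    proof -
      have "real (k - m) = real M - real k0 - 1 - real m" using k by simp
      then have "r * real (k - m) = r * real M - r * real k0 - r - r * real m"
        by (simp only: right_diff_distrib mult_1_right)
      then have "r * real M - 13 \<le> r * real (k - m)" using k0 m small by linarith
      then show ?thesis by simp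
    qed
    finally show ?thesis by (simp only: exp_add)
  qed
  ultimately have "C * (1 / real m) * q ^ (k - m) \<le> C * r * (exp 17 * exp (- 5/4 * r * real M))"
    using C0 q r0 by (intro mult_mono) auto
  then have ai: "residual (k0 + i) \<le> C * r * (exp 17 * exp (- 5/4 * r * real M))" using i by simp
  define w where "w = (\<Sum>j<N. (norm (W (Suc (Suc (k0 + i))) j))\<^sup>2)"
  have w0: "0 \<le> w" unfolding w_def by (intro sum_nonneg) auto
  \<comment> \<open>The weight \<open>\<nu> / r\<close> in \<open>residual\<close> is at least
    \<open>L * r\<close>. Dividing by its square costs \<open>1 / r^2\<close>, which the factor r
    gained in the window reduces to \<open>1 / r\<close>.\<close>
  have "\<nu> * (1 - r\<^sup>2) \<le> \<nu> * 1" using nu by (intro mult_left_mono) auto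
  then have "L * r\<^sup>2 \<le> \<nu>" using nu_L by simp
  then have "L * r \<le> \<nu> / r" using r0 by (simp add: field_simps power2_eq_square)
  then have "(L * r)\<^sup>2 \<le> (\<nu> / r)\<^sup>2" using L r0 by (intro power_mono) auto
  then have "1/4 * (L * r)\<^sup>2 * w \<le> 1/4 * (\<nu> / r)\<^sup>2 * w" using w0 by (intro mult_right_mono) auto
  also have "\<dots> = residual (k0 + i)" by (simp add: residual_def w_def)
  finally have "1/4 * (L * r)\<^sup>2 * w \<le> C * r * (exp 17 * exp (- 5/4 * r * real M))" using ai by simp
  then have "w \<le> 4 * exp 17 / L\<^sup>2 * C / r * exp (- 5/4 * r * real M)"
  proof -
    have "w = 4 / (L * r)\<^sup>2 * (1/4 * (L * r)\<^sup>2 * w)" using L r0 by simp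
    also have "\<dots> \<le> 4 / (L * r)\<^sup>2 * (C * r * (exp 17 * exp (- 5/4 * r * real M)))"
      by (rule mult_left_mono) (fact, simp)
    also have "\<dots> = 4 * exp 17 / L\<^sup>2 * C / r * exp (- 5/4 * r * real M)"
      using L r0 by (simp add: power_mult_distrib power2_eq_square mult_ac)
    finally show ?thesis .
  qed
  moreover have "Suc (k0 + i) < M" using i k by simp
  moreover have "r * (real M - real (Suc (k0 + i))) \<le> 2"
  proof -
    have "real M - real (Suc (k0 + i)) \<le> real m" using i k by linarith
    then have "r * (real M - real (Suc (k0 + i))) \<le> r * real m" using r0 by (intro mult_left_mono) auto
    then show ?thesis using m r0 by linarith
  qed
  ultimately show ?thesis unfolding w_def C_def by blast
qed

end

text \<open>Since \<open>\<nu> * Z\<close> is half the squared initial distance plus \<nu>, the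
  bound \<open>B\<close> is uniform down to \<nu> = 0. The threshold \<open>r1\<close> collects the
  two smallness conditions on r.\<close>

lemma window_residual_uniform:
  fixes L \<gamma> \<nu>2 A :: real
  assumes "0 < L" "0 < \<gamma>"
  obtains r1 C where "0 < r1" and "0 < C" and
    "\<And>N \<nu> D (X :: nat \<Rightarrow> nat \<Rightarrow> 'a::real_inner) W e M.
      inexact_accel_prox N L \<nu> \<gamma> D X W e \<Longrightarrow> sqrt (\<nu> / (L + \<nu>)) \<le> r1 \<Longrightarrow> \<nu> \<le> \<nu>2 \<Longrightarrow>
      (\<Sum>j<N. (norm (X 0 j))\<^sup>2) \<le> A \<Longrightarrow> 14 \<le> sqrt (\<nu> / (L + \<nu>)) * real M \<Longrightarrow>
      \<exists>n<M. sqrt (\<nu> / (L + \<nu>)) * (real M - real n) \<le> 2 \<and>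
        (\<Sum>j<N. (norm (W (Suc n) j))\<^sup>2)
          \<le> C / sqrt (\<nu> / (L + \<nu>)) * exp (- 5/4 * sqrt (\<nu> / (L + \<nu>)) * real M)"
proof -
  obtain G where G: "0 \<le> G" "\<And>n. (\<Sum>k<n. (real k + 1)\<^sup>2 * (1 / (1 + \<gamma>)) ^ k) \<le> G"
    using square_times_geometric_bounded[of "1 / (1 + \<gamma>)"] assms by auto
  define g where "g = 1 / sqrt (1 + \<gamma>)"
  have g: "g < 1" using assms by (simp add: g_def)
  define B where "B = \<bar>A\<bar> / 2 + \<bar>\<nu>2\<bar> * (1 + G)"
  define C where "C = 4 * exp 17 / L\<^sup>2 * (60 * B + 101 * L / (1 - g))"
  have B0: "0 \<le> B" using G by (simp add: B_def)
  have C0: "0 < C" unfolding C_def using assms B0 g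
    by (intro mult_pos_pos divide_pos_pos add_nonneg_pos) auto
  show ?thesis
  proof (rule that[of "min (1/1000) (sqrt (1 + \<gamma>) - 1)", OF _ C0])
    fix N \<nu> D e M and X W :: "nat \<Rightarrow> nat \<Rightarrow> 'a"
    define r where "r = sqrt (\<nu> / (L + \<nu>))"
    assume "inexact_accel_prox N L \<nu> \<gamma> D X W e" and nu: "\<nu> \<le> \<nu>2"
      and small: "sqrt (\<nu> / (L + \<nu>)) \<le> min (1/1000) (sqrt (1 + \<gamma>) - 1)"
      and A: "(\<Sum>j<N. (norm (X 0 j))\<^sup>2) \<le> A" and M: "14 \<le> sqrt (\<nu> / (L + \<nu>)) * real M"
    then interpret run: inexact_accel_prox N L \<nu> \<gamma> D X W e r
       "\<lambda>n. ((1 - r) / (1 + \<gamma>)) ^ n" "dfl_t (\<nu> / (L + \<nu>))"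
      by (simp_all add: r_def)
    have "\<nu> * (run.Z + (\<Sum>k<n. (real k + 1)\<^sup>2 * (1 / (1 + \<gamma>)) ^ k)) \<le> B" for n
    proof -
      have "\<nu> * (run.Z + (\<Sum>k<n. (real k + 1)\<^sup>2 * (1 / (1 + \<gamma>)) ^ k)) \<le> \<nu> * (run.Z + G)"
        using G run.nu by (intro mult_left_mono) auto
      also have "\<dots> = (\<Sum>j<N. (norm (X 0 j))\<^sup>2) / 2 + \<nu> * (1 + G)"
        using run.nu by (simp add: run.Z_def field_simps)
      also have "\<dots> \<le> B" unfolding B_def
        using A nu run.nu G by (intro add_mono mult_right_mono) auto
      finally show ?thesis .
    qed
    from run.window_residual[OF _ _ _ this, of M] small M
    show "\<exists>n<M. sqrt (\<nu> / (L + \<nu>)) * (real M - real n) \<le> 2 \<and>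
        (\<Sum>j<N. (norm (W (Suc n) j))\<^sup>2)
          \<le> C / sqrt (\<nu> / (L + \<nu>)) * exp (- 5/4 * sqrt (\<nu> / (L + \<nu>)) * real M)"
      unfolding r_def[symmetric] C_def g_def run.g_def by auto
  qed (use assms in auto)
qed

section \<open>Smooth convex functions and their conjugates\<close>

lemma GDERIV_unique:
  assumes "GDERIV f x :> a" "GDERIV f x :> b"
  shows "a = b"
proof -
  have "(\<lambda>h. h \<bullet> a) = (\<lambda>h. h \<bullet> b)"
    using assms unfolding gderiv_def by (rule has_derivative_unique)
  then have "(a - b) \<bullet> a = (a - b) \<bullet> b" by metis
  then have "(a - b) \<bullet> (a - b) = 0" by (simp add: inner_diff_right)
  then show ?thesis by simp
qed

lemma grad_eq: "GDERIV f x :> a \<Longrightarrow> grad f x = a"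
  unfolding grad_def by (blast intro: the_equality GDERIV_unique)

lemma GDERIV_along_line:
  assumes "GDERIV f (x + t *\<^sub>R d) :> a"
  shows "((\<lambda>t. f (x + t *\<^sub>R d)) has_real_derivative (d \<bullet> a)) (at t)"
proof -
  have "((\<lambda>t. x + t *\<^sub>R d) has_derivative (\<lambda>s. s *\<^sub>R d)) (at t)"
    by (auto intro!: derivative_eq_intros)
  from has_derivative_compose[OF this assms[unfolded gderiv_def]]
  show ?thesis by (simp add: has_field_derivative_def mult_commute_abs)
qed

lemma lipschitz_gradient_upper:
  fixes f :: "'a::real_inner \<Rightarrow> real"
  assumes g: "\<And>x. GDERIV f x :> g x" and lip: "\<And>x y. norm (g x - g y) \<le> L * norm (x - y)"
  shows "f y \<le> f x + g x \<bullet> (y - x) + L / 2 * (norm (y - x))\<^sup>2"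
proof -
  define d where "d = y - x"
  define \<psi> where "\<psi> t = f (x + t *\<^sub>R d) - t * (d \<bullet> g x) - L / 2 * t\<^sup>2 * (norm d)\<^sup>2" for t
  have "\<psi> 1 \<le> \<psi> 0"
  proof (rule DERIV_nonpos_imp_nonincreasing[of 0 1 \<psi>])
    fix t :: real assume t: "0 \<le> t" "t \<le> 1"
    have "(\<psi> has_real_derivative (d \<bullet> g (x + t *\<^sub>R d) - d \<bullet> g x - L * t * (norm d)\<^sup>2)) (at t)"
      unfolding \<psi>_def by (auto intro!: derivative_eq_intros GDERIV_along_line g)
    moreover have "d \<bullet> g (x + t *\<^sub>R d) - d \<bullet> g x \<le> L * t * (norm d)\<^sup>2"
    proof -
      have "d \<bullet> (g (x + t *\<^sub>R d) - g x) \<le> norm d * norm (g (x + t *\<^sub>R d) - g x)"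
        by (rule norm_cauchy_schwarz)
      also have "\<dots> \<le> norm d * (L * norm (x + t *\<^sub>R d - x))"
        by (intro mult_left_mono lip) auto
      also have "\<dots> = L * t * (norm d)\<^sup>2" using t by (simp add: power2_eq_square)
      finally show ?thesis by (simp add: inner_diff_right)
    qed
    ultimately show "\<exists>D. (\<psi> has_real_derivative D) (at t) \<and> D \<le> 0" by (smt (verit))
  qed simp
  then show ?thesis by (simp add: \<psi>_def d_def inner_commute)
qed

lemma convex_gradient_lower:
  fixes f :: "'a::real_inner \<Rightarrow> real"
  assumes cvx: "convex_on UNIV f" and g: "GDERIV f x :> a"
  shows "f x + a \<bullet> (y - x) \<le> f y"
proof -
  define d where "d = y - x"
  have "convex_on UNIV (\<lambda>t::real. f (x + t *\<^sub>R d))"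
  proof (intro convex_onI)
    fix t u v :: real assume t: "0 < t" "t < 1"
    have "x + ((1 - t) *\<^sub>R u + t *\<^sub>R v) *\<^sub>R d = (1 - t) *\<^sub>R (x + u *\<^sub>R d) + t *\<^sub>R (x + v *\<^sub>R d)"
      by (simp add: algebra_simps)
    then show "f (x + ((1 - t) *\<^sub>R u + t *\<^sub>R v) *\<^sub>R d) \<le> (1 - t) * f (x + u *\<^sub>R d) + t * f (x + v *\<^sub>R d)"
      using convex_onD[OF cvx, of t "x + u *\<^sub>R d" "x + v *\<^sub>R d"] t by simp
  qed auto
  moreover have "((\<lambda>t. f (x + t *\<^sub>R d)) has_real_derivative (d \<bullet> a)) (at 0 within UNIV)"
    using GDERIV_along_line[of f x 0 d a] g by simp
  ultimately have "f (x + 1 *\<^sub>R d) - f (x + 0 *\<^sub>R d) \<ge> (d \<bullet> a) * (1 - 0)"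
    by (intro convex_on_imp_above_tangent[where A = UNIV]) auto
  then show ?thesis by (simp add: d_def inner_commute)
qed

text \<open>With \<open>\<nu> = \<alpha>\<close> the regularisation cancels inside the conjugate.
  The number \<phi> is the conjugate value at \<xi>, finite because the gap is bounded by a real;
  recording it by two inequalities keeps the rest of the argument in the reals.\<close>

lemma dfl_gap_witness:
  fixes f :: "'a::real_inner \<Rightarrow> real"
  assumes \<alpha>: "0 < \<alpha>"
    and gap: "dfl_gap (\<lambda>x. f x + \<alpha> / 2 * (norm x)\<^sup>2) \<alpha> \<zeta> \<theta> \<le> ereal d"
  defines "\<xi> \<equiv> \<alpha> *\<^sub>R (\<zeta> - \<theta>)"
  obtains \<phi> where "\<And>y. \<xi> \<bullet> y - f y \<le> \<phi>" "\<phi> \<le> \<xi> \<bullet> \<theta> - f \<theta> + d"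
proof -
  define c where "c = conj f \<xi>"
  have lower: "ereal (\<xi> \<bullet> y - f y) \<le> c" for y
    unfolding c_def conj_def by (rule SUP_upper) simp
  have "norm (\<alpha> *\<^sub>R (\<zeta> - \<theta>) - \<alpha> *\<^sub>R \<zeta>) = \<alpha> * norm \<theta>"
    using \<alpha> by (simp add: scaleR_diff_right)
  then have g: "ereal (f \<theta> + \<alpha> / 2 * (norm \<theta>)\<^sup>2 - \<alpha> * (\<zeta> \<bullet> \<theta>))
      + (c + ereal (\<alpha> / 2 * (norm \<theta>)\<^sup>2)) \<le> ereal d"
    using gap \<alpha> unfolding dfl_gap_def c_def \<xi>_def
    by (simp add: power_mult_distrib power2_eq_square mult_ac)
  have "c \<noteq> \<infinity>" "c \<noteq> - \<infinity>" using g lower[of 0] by auto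
  then obtain \<phi> where c: "c = ereal \<phi>" by (cases c) auto
  show ?thesis
  proof
    show "\<xi> \<bullet> y - f y \<le> \<phi>" for y using lower[of y] by (simp add: c)
    show "\<phi> \<le> \<xi> \<bullet> \<theta> - f \<theta> + d"
      using g by (simp add: c \<xi>_def inner_diff_left power2_norm_eq_inner algebra_simps)
  qed
qed

text \<open>Smoothness of f becomes strong convexity of its conjugate, with \<theta> as a
  d-subgradient at \<xi>. The quadratic is centred at the gradient p rather than at \<xi>; the two
  differ when the local problem is solved inexactly.\<close>

lemma conjugate_strong_convexity:
  fixes f :: "'a::real_inner \<Rightarrow> real"
  assumes L: "0 < L"
    and up: "\<And>y. f y \<le> f \<theta> + p \<bullet> (y - \<theta>) + L / 2 * (norm (y - \<theta>))\<^sup>2"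
    and z: "\<And>y. z \<bullet> y - f y \<le> \<phi>z" and x: "\<phi> \<le> \<xi> \<bullet> \<theta> - f \<theta> + d"
  shows "\<phi> + \<theta> \<bullet> (z - \<xi>) - d + 1 / (2 * L) * (norm (z - p))\<^sup>2 \<le> \<phi>z"
proof -
  \<comment> \<open>The maximiser of \<open>z \<bullet> y\<close> minus the quadratic upper bound of
    f.\<close>
  define y where "y = \<theta> + (1 / L) *\<^sub>R (z - p)"
  have "f y \<le> f \<theta> + (1 / L) * (p \<bullet> (z - p)) + 1 / (2 * L) * (norm (z - p))\<^sup>2"
    using up[of y] L by (simp add: y_def power_divide power2_eq_square)
  moreover have "z \<bullet> y = z \<bullet> \<theta> + 1 / L * (z \<bullet> (z - p))" by (simp add: y_def inner_simps)
  moreover have "1 / L * (z \<bullet> (z - p)) - (1 / L) * (p \<bullet> (z - p)) = 1 / L * (norm (z - p))\<^sup>2"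
    by (simp add: power2_norm_eq_inner inner_simps diff_divide_distrib)
  moreover have "1 / L * (norm (z - p))\<^sup>2 = 2 * (1 / (2 * L) * (norm (z - p))\<^sup>2)" by simp
  ultimately have "z \<bullet> \<theta> - f \<theta> + 1 / (2 * L) * (norm (z - p))\<^sup>2 \<le> z \<bullet> y - f y" by linarith
  also have "\<dots> \<le> \<phi>z" by (rule z)
  finally show ?thesis using x by (simp add: inner_simps inner_commute)
qed

section \<open>Projection orthogonal to the constant tuples, and the dual objective\<close>

definition center :: "nat \<Rightarrow> (nat \<Rightarrow> 'a::real_vector) \<Rightarrow> nat \<Rightarrow> 'a" where
  "center N a j = a j - avg N a"

lemma avg_diff: "avg N (\<lambda>j. a j - b j) = avg N a - avg N b"
  by (simp add: avg_def sum_subtractf scaleR_diff_right)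

lemma center_diff: "center N (\<lambda>j. a j - b j) j = center N a j - center N b j"
  by (simp add: center_def avg_diff)

lemma sum_eq_avg: "0 < N \<Longrightarrow> (\<Sum>j<N. a j) = real N *\<^sub>R avg N a"
  by (simp add: avg_def)

lemma sum_center: "0 < N \<Longrightarrow> (\<Sum>j<N. center N a j) = 0"
  by (simp add: center_def sum_subtractf sum_eq_avg sum_constant_scaleR)

lemma sum_norm_center_le:
  fixes a :: "nat \<Rightarrow> 'a::real_inner"
  assumes "0 < N"
  shows "(\<Sum>j<N. (norm (center N a j))\<^sup>2) \<le> (\<Sum>j<N. (norm (a j))\<^sup>2)"
proof -
  have "(\<Sum>j<N. (norm (a j))\<^sup>2) = (\<Sum>j<N. (norm (center N a j))\<^sup>2 + 2 * (center N a j \<bullet> avg N a) + (norm (avg N a))\<^sup>2)"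
    by (intro sum.cong refl)
      (simp add: center_def power2_norm_eq_inner inner_simps inner_commute)
  also have "\<dots> = (\<Sum>j<N. (norm (center N a j))\<^sup>2) + 2 * ((\<Sum>j<N. center N a j) \<bullet> avg N a) + real N * (norm (avg N a))\<^sup>2"
    by (simp add: sum.distrib inner_sum_left sum_distrib_left)
  finally show ?thesis by (simp add: sum_center[OF assms])
qed

lemma sum_inner_center:
  fixes w a :: "nat \<Rightarrow> 'a::real_inner"
  assumes "(\<Sum>j<N. w j) = 0"
  shows "(\<Sum>j<N. w j \<bullet> a j) = (\<Sum>j<N. w j \<bullet> center N a j)"
proof -
  have "(\<Sum>j<N. w j \<bullet> a j) = (\<Sum>j<N. w j \<bullet> center N a j) + (\<Sum>j<N. w j) \<bullet> avg N a"
    by (simp add: center_def inner_diff_right sum_subtractf inner_sum_left)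
  then show ?thesis using assms by simp
qed

text \<open>For conjugate values \<phi>, this is the Fenchel dual objective of minimising the sum of
  the \<open>f j\<close> plus \<open>N * \<alpha> / 2\<close> times the squared norm; the second
  term is the conjugate of that quadratic at minus the sum of the \<xi>.\<close>

definition dual_energy :: "nat \<Rightarrow> real \<Rightarrow> (nat \<Rightarrow> real) \<Rightarrow> (nat \<Rightarrow> 'a::real_inner) \<Rightarrow> real" where
  "dual_energy N \<alpha> \<phi> \<xi> = (\<Sum>j<N. \<phi> j) + real N / (2 * \<alpha>) * (norm (avg N \<xi>))\<^sup>2"

text \<open>By \<open>bal\<close>, the mean of \<theta> is opposite to the gradient of the quadratic
  term along the constant tuples. The mean parts of the linear term therefore cancel, and the
  centred tuple acts as an approximate subgradient.\<close>

lemma dual_energy_lower: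
  fixes \<xi> z p \<theta> :: "nat \<Rightarrow> 'a::real_inner"
  assumes N: "0 < N" and \<alpha>: "0 < \<alpha>" and L: "0 < L"
    and breg: "\<And>j. j < N \<Longrightarrow>
      \<phi> j + \<theta> j \<bullet> (z j - \<xi> j) - d j + 1 / (2 * L) * (norm (z j - p j))\<^sup>2 \<le> \<phi>z j"
    and bal: "\<alpha> *\<^sub>R avg N \<theta> = - avg N \<xi>"
  shows "dual_energy N \<alpha> \<phi> \<xi> + (\<Sum>j<N. center N \<theta> j \<bullet> (center N z j - center N \<xi> j)) - (\<Sum>j<N. d j)
     + 1 / (2 * L) * (\<Sum>j<N. (norm (center N z j - center N p j))\<^sup>2) \<le> dual_energy N \<alpha> \<phi>z z"
proof -
  define m where "m = avg N \<theta>"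
  define n where "n = real N"
  have av: "avg N \<xi> = - (\<alpha> *\<^sub>R m)" using bal by (simp add: m_def)
  have "(\<Sum>j<N. \<phi> j + \<theta> j \<bullet> (z j - \<xi> j) - d j + 1 / (2 * L) * (norm (z j - p j))\<^sup>2) \<le> (\<Sum>j<N. \<phi>z j)"
    by (intro sum_mono breg) simp
  then have 1: "(\<Sum>j<N. \<phi> j) + (\<Sum>j<N. \<theta> j \<bullet> (z j - \<xi> j)) - (\<Sum>j<N. d j)
     + 1 / (2 * L) * (\<Sum>j<N. (norm (z j - p j))\<^sup>2) \<le> (\<Sum>j<N. \<phi>z j)"
    by (simp only: sum.distrib sum_subtractf sum_distrib_left)
  have 2: "(\<Sum>j<N. \<theta> j \<bullet> (z j - \<xi> j))
      = (\<Sum>j<N. center N \<theta> j \<bullet> (center N z j - center N \<xi> j)) + n * (m \<bullet> (avg N z - avg N \<xi>))"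
  proof -
    have "(\<Sum>j<N. \<theta> j \<bullet> (z j - \<xi> j)) = (\<Sum>j<N. center N \<theta> j \<bullet> (z j - \<xi> j)) + m \<bullet> (\<Sum>j<N. z j - \<xi> j)"
      by (simp add: center_def m_def inner_diff_left inner_diff_right sum_subtractf inner_sum_right)
    also have "(\<Sum>j<N. center N \<theta> j \<bullet> (z j - \<xi> j)) = (\<Sum>j<N. center N \<theta> j \<bullet> (center N z j - center N \<xi> j))"
      using sum_inner_center[OF sum_center[OF N], of \<theta> "\<lambda>j. z j - \<xi> j"] by (simp add: center_diff)
    also have "(\<Sum>j<N. z j - \<xi> j) = n *\<^sub>R (avg N z - avg N \<xi>)"
      using sum_eq_avg[OF N, of "\<lambda>j. z j - \<xi> j"] by (simp add: avg_diff n_def)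
    finally show ?thesis by simp
  qed
  have 3: "1 / (2 * L) * (\<Sum>j<N. (norm (center N z j - center N p j))\<^sup>2)
     \<le> 1 / (2 * L) * (\<Sum>j<N. (norm (z j - p j))\<^sup>2)"
    using sum_norm_center_le[OF N, of "\<lambda>j. z j - p j"] L
    by (intro mult_left_mono) (auto simp: center_diff)
  have 4: "n / (2 * \<alpha>) * (norm (avg N \<xi>))\<^sup>2 \<le> n * (m \<bullet> (avg N z - avg N \<xi>)) + n / (2 * \<alpha>) * (norm (avg N z))\<^sup>2"
  proof -
    have "0 \<le> n / (2 * \<alpha>) * (norm (avg N z - avg N \<xi>))\<^sup>2" using \<alpha> by (simp add: n_def)
    also have "\<dots> = n * (m \<bullet> (avg N z - avg N \<xi>)) + n / (2 * \<alpha>) * (norm (avg N z))\<^sup>2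
        - n / (2 * \<alpha>) * (norm (avg N \<xi>))\<^sup>2"
      unfolding av power2_norm_eq_inner using \<alpha>
      by (simp add: inner_simps inner_commute field_simps)
    finally show ?thesis by simp
  qed
  show ?thesis
    using 1 2 3 4 unfolding dual_energy_def n_def[symmetric] by linarith
qed

section \<open>DualFL as an accelerated proximal point iteration\<close>

locale smooth_convex_sum =
  fixes N :: nat and f :: "nat \<Rightarrow> 'a::euclidean_space \<Rightarrow> real" and G :: "nat \<Rightarrow> 'a \<Rightarrow> 'a"
    and L :: real
  assumes N: "0 < N" and L: "0 < L"
    and cvx: "\<And>j. j < N \<Longrightarrow> convex_on UNIV (f j)"
    and grad: "\<And>j x. j < N \<Longrightarrow> GDERIV (f j) x :> G j x"
    and lip: "\<And>j x y. j < N \<Longrightarrow> norm (G j x - G j y) \<le> L * norm (x - y)"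
    and coercive: "filterlim (\<lambda>x. 1 / real N * (\<Sum>j<N. f j x)) at_top at_infinity"
begin

lemma grad_mono: "j < N \<Longrightarrow> 0 \<le> (G j x - G j y) \<bullet> (x - y)"
  using convex_gradient_lower[OF cvx grad, of j x y] convex_gradient_lower[OF cvx grad, of j y x]
  by (simp add: inner_simps)

lemma GDERIV_avg: "GDERIV (\<lambda>x. 1 / real N * (\<Sum>j<N. f j x)) x :> avg N (\<lambda>j. G j x)"
proof -
  have "((\<lambda>x. 1 / real N * (\<Sum>j<N. f j x)) has_derivative (\<lambda>h. 1 / real N * (\<Sum>j<N. h \<bullet> G j x))) (at x)"
    using grad by (intro has_derivative_mult_right has_derivative_sum) (auto simp: gderiv_def)
  then show ?thesis by (simp add: gderiv_def avg_def inner_sum_right)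
qed

lemma reg_avg_eq:
  "1 / real N * (\<Sum>j<N. f j x + \<alpha> / 2 * (norm x)\<^sup>2) = 1 / real N * (\<Sum>j<N. f j x) + \<alpha> / 2 * (norm x)\<^sup>2"
proof -
  have "(\<Sum>j<N. f j x + \<alpha> / 2 * (norm x)\<^sup>2) = (\<Sum>j<N. f j x) + real N * (\<alpha> / 2 * (norm x)\<^sup>2)"
    by (simp only: sum.distrib sum_constant card_lessThan)
  then show ?thesis using N by (simp only: distrib_left) simp
qed

lemma GDERIV_reg_avg:
  "GDERIV (\<lambda>x. 1 / real N * (\<Sum>j<N. f j x + \<alpha> / 2 * (norm x)\<^sup>2)) x :> avg N (\<lambda>j. G j x) + \<alpha> *\<^sub>R x"
  unfolding reg_avg_eq
proof (rule GDERIV_add[OF GDERIV_avg])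
  have "((\<lambda>x. \<alpha> / 2 * (x \<bullet> x)) has_derivative (\<lambda>h. \<alpha> / 2 * (x \<bullet> h + h \<bullet> x))) (at x)"
    by (auto intro!: derivative_eq_intros)
  then show "GDERIV (\<lambda>x. \<alpha> / 2 * (norm x)\<^sup>2) x :> \<alpha> *\<^sub>R x"
    by (simp add: gderiv_def power2_norm_eq_inner inner_commute)
qed

lemma reg_strong_mono:
  assumes "0 < \<alpha>"
  defines "H \<equiv> \<lambda>x. avg N (\<lambda>j. G j x) + \<alpha> *\<^sub>R x"
  shows "\<alpha> * norm (x - y) \<le> norm (H x - H y)"
proof -
  have "0 \<le> (\<Sum>j<N. (G j x - G j y) \<bullet> (x - y)) / real N"
    by (intro divide_nonneg_nonneg sum_nonneg grad_mono) auto
  then have "\<alpha> * (norm (x - y))\<^sup>2 \<le> (H x - H y) \<bullet> (x - y)"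
    by (simp add: H_def avg_def inner_simps sum_subtractf inner_sum_left power2_norm_eq_inner
        diff_divide_distrib add_divide_distrib sum.distrib algebra_simps)
  also have "\<dots> \<le> norm (H x - H y) * norm (x - y)" by (rule norm_cauchy_schwarz)
  finally have "(\<alpha> * norm (x - y)) * norm (x - y) \<le> norm (H x - H y) * norm (x - y)"
    by (simp add: power2_eq_square)
  then show ?thesis by (cases "x = y") auto
qed

text \<open>\<open>minimizer\<close> is a definite description, so existence (coercivity) and
  uniqueness (strong monotonicity) have to precede stationarity.\<close>

lemma minimizer_stationary:
  assumes \<alpha>: "0 < \<alpha>"
  defines "\<theta> \<equiv> minimizer (\<lambda>x. 1 / real N * (\<Sum>j<N. f j x + \<alpha> / 2 * (norm x)\<^sup>2))"
  shows "avg N (\<lambda>j. G j \<theta>) = - (\<alpha> *\<^sub>R \<theta>)"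
proof -
  define F where "F = (\<lambda>x. 1 / real N * (\<Sum>j<N. f j x + \<alpha> / 2 * (norm x)\<^sup>2))"
  have stat: "avg N (\<lambda>j. G j x) + \<alpha> *\<^sub>R x = 0" if "\<forall>y. F x \<le> F y" for x
  proof -
    have "(\<lambda>h. h \<bullet> (avg N (\<lambda>j. G j x) + \<alpha> *\<^sub>R x)) = (\<lambda>h. 0)"
      using GDERIV_reg_avg[of \<alpha> x] that unfolding gderiv_def F_def
      by (intro has_derivative_local_min) auto
    then have "(avg N (\<lambda>j. G j x) + \<alpha> *\<^sub>R x) \<bullet> (avg N (\<lambda>j. G j x) + \<alpha> *\<^sub>R x) = 0" by metis
    then show ?thesis by (simp only: inner_eq_zero_iff)
  qed
  have "eventually (\<lambda>x. F 0 \<le> 1 / real N * (\<Sum>j<N. f j x)) at_infinity"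
    using coercive by (simp add: filterlim_at_top)
  then obtain b where b: "\<And>x. b \<le> norm x \<Longrightarrow> F 0 \<le> 1 / real N * (\<Sum>j<N. f j x)"
    unfolding eventually_at_infinity by auto
  have cont: "continuous_on UNIV F"
    using GDERIV_reg_avg[of \<alpha>] unfolding gderiv_def F_def
    by (intro continuous_at_imp_continuous_on ballI has_derivative_continuous)
  then have "continuous_on (cball 0 \<bar>b\<bar>) F" by (rule continuous_on_subset) simp
  then obtain x0 where x0: "x0 \<in> cball 0 \<bar>b\<bar>" "\<forall>y\<in>cball 0 \<bar>b\<bar>. F x0 \<le> F y"
    using continuous_attains_inf[of "cball 0 \<bar>b\<bar>" F] by auto
  have min: "\<forall>y. F x0 \<le> F y"
  proof
    fix y
    show "F x0 \<le> F y"
    proof (cases "y \<in> cball 0 \<bar>b\<bar>")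
      case False
      then have "F 0 \<le> 1 / real N * (\<Sum>j<N. f j y)" by (intro b) auto
      also have "\<dots> \<le> F y" using \<alpha> unfolding F_def reg_avg_eq by simp
      finally have "F 0 \<le> F y" .
      moreover have "F x0 \<le> F 0" using x0(2) by simp
      ultimately show ?thesis by linarith
    qed (use x0 in auto)
  qed
  have uniq: "y = x0" if "\<forall>z. F y \<le> F z" for y
    using reg_strong_mono[OF \<alpha>, of y x0] stat[OF that] stat[OF min] \<alpha>
    by (simp add: mult_le_0_iff)
  have "minimizer F = x0" unfolding minimizer_def by (rule the_equality) (fact min, erule uniq)
  then have "\<theta> = x0" unfolding F_def \<theta>_def .
  moreover have "avg N (\<lambda>j. G j x0) = - (\<alpha> *\<^sub>R x0)"
    using stat[OF min] by (rule iffD2[OF eq_neg_iff_add_eq_0])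
  ultimately show ?thesis by (rule ssubst)
qed

end

section \<open>The iterates of DualFL in dual form\<close>

locale dualfl = smooth_convex_sum N f G L
  for N :: nat and f :: "nat \<Rightarrow> 'a::euclidean_space \<Rightarrow> real" and G L +
  fixes \<alpha> \<gamma> :: real and th :: "nat \<Rightarrow> nat \<Rightarrow> 'a"
  assumes alpha: "0 < \<alpha>" and gam: "0 < \<gamma>"
    and run: "dfl_run N (\<lambda>j x. f j x + \<alpha> / 2 * (norm x)\<^sup>2) (\<alpha> / (L + \<alpha>)) \<alpha> \<gamma> th"
begin

abbreviation \<rho> where "\<rho> \<equiv> \<alpha> / (L + \<alpha>)"
abbreviation \<delta> where "\<delta> n \<equiv> ((1 - sqrt \<rho>) / (1 + \<gamma>)) ^ n"
abbreviation \<zeta> where "\<zeta> \<equiv> dfl_zeta N \<rho> th"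
abbreviation \<theta> where "\<theta> \<equiv> dfl_theta N th"

definition opt where "opt = minimizer (\<lambda>x. 1 / real N * (\<Sum>j<N. f j x + \<alpha> / 2 * (norm x)\<^sup>2))"
definition xi where "xi n j = \<alpha> *\<^sub>R (\<zeta> n j - th (Suc n) j)"
definition xs where "xs j = G j opt"
definition W where "W n = center N (th n)"
text \<open>The 0 in the first case is the dual starting point; \<open>xi m\<close> is the dual
  iterate produced by round \<open>Suc m\<close>, hence the index shift.\<close>

definition X where
  "X n j = (case n of 0 \<Rightarrow> 0 | Suc m \<Rightarrow> center N (xi m) j) - center N xs j"

lemma th_0: "j < N \<Longrightarrow> th 0 j = 0" using run by (simp add: dfl_run_def)

lemma theta_0: "\<theta> 0 = 0" by (simp add: dfl_theta_def avg_def th_0)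

text \<open>Every server update adds \<theta> and subtracts the local iterates, whose mean is
  \<theta>. The induction carries two consecutive indices because the recursion is of second
  order.\<close>

lemma avg_zeta: "avg N (\<zeta> n) = 0"
proof -
  have lin: "avg N (\<lambda>j. a *\<^sub>R (u j + c - v j) - b *\<^sub>R (u' j + c' - v' j))
      = a *\<^sub>R (avg N u + c - avg N v) - b *\<^sub>R (avg N u' + c' - avg N v')"
    for a b :: real and u v u' v' :: "nat \<Rightarrow> 'a" and c c'
    using N by (simp add: avg_def sum_subtractf sum.distrib scaleR_sum_right[symmetric]
        sum_constant_scaleR scaleR_diff_right scaleR_add_right scaleR_left_commute)
  have z: "avg N (\<lambda>j. 0 :: 'a) = 0" by (simp add: avg_def)
  have "avg N (\<zeta> n) = 0 \<and> avg N (\<zeta> (Suc n)) = 0"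
  proof (induction n)
    case 0
    have "\<zeta> 0 = (\<lambda>_. 0)" by (rule ext) simp
    moreover have "\<zeta> (Suc 0) = (\<lambda>j. (1 + dfl_beta \<rho> 0) *\<^sub>R (0 + \<theta> 1 - th 1 j) - dfl_beta \<rho> 0 *\<^sub>R (0 + \<theta> 0 - th 0 j))"
      by (rule ext) (simp only: dfl_zeta.simps)
    ultimately show ?case
      by (simp only: lin z) (simp add: dfl_theta_def)
  next
    case (Suc n)
    have "\<zeta> (Suc (Suc n)) = (\<lambda>j.
       (1 + dfl_beta \<rho> (Suc n)) *\<^sub>R (\<zeta> (Suc n) j + \<theta> (Suc (Suc n)) - th (Suc (Suc n)) j)
       - dfl_beta \<rho> (Suc n) *\<^sub>R (\<zeta> n j + \<theta> (Suc n) - th (Suc n) j))"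
      by (rule ext) (simp only: dfl_zeta.simps)
    then show ?case using Suc by (simp only: lin) (simp add: dfl_theta_def)
  qed
  then show ?thesis by simp
qed

lemma avg_xi: "avg N (xi n) = - (\<alpha> *\<^sub>R \<theta> (Suc n))"
proof -
  have "avg N (xi n) = \<alpha> *\<^sub>R (avg N (\<zeta> n) - avg N (th (Suc n)))"
    by (simp add: xi_def avg_def sum_subtractf scaleR_diff_right scaleR_sum_right[symmetric]
        scaleR_left_commute)
  then show ?thesis by (simp add: avg_zeta dfl_theta_def)
qed

lemma center_xi: "center N (xi n) j = \<alpha> *\<^sub>R (\<zeta> n j + \<theta> (Suc n) - th (Suc n) j)"
  by (simp add: center_def avg_xi xi_def algebra_simps)

lemma W_eq: "W n j = th n j - \<theta> n"
  by (simp add: W_def center_def dfl_theta_def)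

lemma avg_xs: "avg N xs = - (\<alpha> *\<^sub>R opt)"
  unfolding xs_def opt_def by (rule minimizer_stationary[OF alpha])

text \<open>Identifies \<open>\<alpha> \<zeta>\<close> as the extrapolated point of the accelerated
  scheme. At \<open>n = 0\<close> the previous point is 0 because all iterates start at 0.\<close>

lemma zeta_Suc:
  assumes "j < N"
  shows "\<alpha> *\<^sub>R \<zeta> (Suc n) j = center N (xi n) j
     + dfl_beta \<rho> n *\<^sub>R (center N (xi n) j - (case n of 0 \<Rightarrow> 0 | Suc m \<Rightarrow> center N (xi m) j))"
proof -
  define q where "q m = (case m of 0 \<Rightarrow> 0 | Suc k \<Rightarrow> center N (xi k) j)" for m
  have q_Suc: "\<zeta> m j + \<theta> (Suc m) - th (Suc m) j = (1 / \<alpha>) *\<^sub>R q (Suc m)" for m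
    using alpha by (simp add: q_def center_xi)
  have "\<zeta> (Suc n) j = (1 + dfl_beta \<rho> n) *\<^sub>R ((1 / \<alpha>) *\<^sub>R q (Suc n)) - dfl_beta \<rho> n *\<^sub>R ((1 / \<alpha>) *\<^sub>R q n)"
  proof (cases n)
    case 0
    then show ?thesis using q_Suc[of 0] theta_0 th_0[OF assms] by (simp add: q_def)
  next
    case (Suc m)
    then show ?thesis using q_Suc[of n] q_Suc[of m] by simp
  qed
  then have "\<alpha> *\<^sub>R \<zeta> (Suc n) j = (1 + dfl_beta \<rho> n) *\<^sub>R q (Suc n) - dfl_beta \<rho> n *\<^sub>R q n"
    using alpha by (simp add: scaleR_diff_right)
  also have "\<dots> = q (Suc n) + dfl_beta \<rho> n *\<^sub>R (q (Suc n) - q n)"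
    by (simp add: scaleR_add_left scaleR_diff_right)
  finally show ?thesis by (simp add: q_def)
qed

lemma X_0: "X 0 j = - center N xs j" by (simp add: X_def)

lemma X_Suc: "X (Suc n) j = center N (xi n) j - center N xs j" by (simp add: X_def)

text \<open>A real number standing in for the conjugate of \<open>f j\<close> at
  \<open>xi n j\<close>.\<close>

definition \<phi> where "\<phi> n j = (SOME v. (\<forall>y. xi n j \<bullet> y - f j y \<le> v) \<and>
     v \<le> xi n j \<bullet> th (Suc n) j - f j (th (Suc n) j) + 1 / real N * \<delta> n)"

lemma phi:
  assumes "j < N"
  shows "xi n j \<bullet> y - f j y \<le> \<phi> n j"
    and "\<phi> n j \<le> xi n j \<bullet> th (Suc n) j - f j (th (Suc n) j) + 1 / real N * \<delta> n"
proof -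
  have "dfl_gap (\<lambda>x. f j x + \<alpha> / 2 * (norm x)\<^sup>2) \<alpha> (\<zeta> n j) (th (Suc n) j) \<le> ereal (1 / real N * \<delta> n)"
    using run assms by (simp add: dfl_run_def)
  from dfl_gap_witness[OF alpha this]
  have "\<exists>v. (\<forall>y. xi n j \<bullet> y - f j y \<le> v) \<and>
     v \<le> xi n j \<bullet> th (Suc n) j - f j (th (Suc n) j) + 1 / real N * \<delta> n"
    unfolding xi_def by metis
  from someI_ex[OF this]
  show "xi n j \<bullet> y - f j y \<le> \<phi> n j"
    and "\<phi> n j \<le> xi n j \<bullet> th (Suc n) j - f j (th (Suc n) j) + 1 / real N * \<delta> n"
    unfolding \<phi>_def[symmetric] by simp_all
qed

definition \<phi>s where "\<phi>s j = xs j \<bullet> opt - f j opt"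

lemma phis: "j < N \<Longrightarrow> xs j \<bullet> y - f j y \<le> \<phi>s j"
  using convex_gradient_lower[OF cvx grad, of j opt y] by (simp add: \<phi>s_def xs_def inner_diff_right)

definition p where "p n j = G j (th (Suc n) j)"
text \<open>Centred distance between the gradient at the inexact local solution and the dual
  iterate.\<close>

definition e where "e n j = (case n of 0 \<Rightarrow> 0 | Suc m \<Rightarrow> center N (\<lambda>j. p m j - xi m j) j)"
definition D where "D n = (case n of 0 \<Rightarrow> 0 | Suc m \<Rightarrow> dual_energy N \<alpha> (\<phi> m) (xi m) - dual_energy N \<alpha> \<phi>s xs)"

lemma upper: "j < N \<Longrightarrow> f j y \<le> f j x + G j x \<bullet> (y - x) + L / 2 * (norm (y - x))\<^sup>2"
  by (rule lipschitz_gradient_upper[OF grad lip])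

text \<open>The common source of \<open>opt\<close> and \<open>descent\<close>: z is taken to be the
  dual solution \<open>xs\<close> or the previous dual iterate.\<close>

lemma iterate_lower:
  assumes "\<And>j y. j < N \<Longrightarrow> z j \<bullet> y - f j y \<le> \<phi>z j"
  shows "dual_energy N \<alpha> (\<phi> n) (xi n) + (\<Sum>j<N. W (Suc n) j \<bullet> (center N z j - center N (xi n) j)) - \<delta> n
     + 1 / (2 * L) * (\<Sum>j<N. (norm (center N z j - center N (xi n) j - e (Suc n) j))\<^sup>2)
     \<le> dual_energy N \<alpha> \<phi>z z"
proof -
  have "\<phi> n j + th (Suc n) j \<bullet> (z j - xi n j) - 1 / real N * \<delta> n
      + 1 / (2 * L) * (norm (z j - p n j))\<^sup>2 \<le> \<phi>z j" if "j < N" for j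
    unfolding p_def by (rule conjugate_strong_convexity[OF L upper[OF that] assms[OF that] phi(2)[OF that]])
  from dual_energy_lower[OF N alpha L this]
  have "dual_energy N \<alpha> (\<phi> n) (xi n) + (\<Sum>j<N. center N (th (Suc n)) j \<bullet> (center N z j - center N (xi n) j))
     - (\<Sum>j<N. 1 / real N * \<delta> n)
     + 1 / (2 * L) * (\<Sum>j<N. (norm (center N z j - center N (p n) j))\<^sup>2)
     \<le> dual_energy N \<alpha> \<phi>z z"
    by (simp add: avg_xi dfl_theta_def)
  moreover have "(\<Sum>j<N. 1 / real N * \<delta> n) = \<delta> n" using N by simp
  ultimately show ?thesis by (simp add: W_def e_def center_diff)
qed

text \<open>Strong convexity tested at \<xi> itself: everything but the error and the quadratic
  cancels.\<close>

lemma p_xi_le: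
  assumes "j < N"
  shows "1 / (2 * L) * (norm (xi n j - p n j))\<^sup>2 \<le> 1 / real N * \<delta> n"
proof -
  have "\<phi> n j + th (Suc n) j \<bullet> (xi n j - xi n j) - 1 / real N * \<delta> n
      + 1 / (2 * L) * (norm (xi n j - p n j))\<^sup>2 \<le> \<phi> n j"
    unfolding p_def
    by (rule conjugate_strong_convexity[OF L upper[OF assms] phi(1)[OF assms] phi(2)[OF assms]])
  then show ?thesis by simp
qed

lemma accel_prox: "inexact_accel_prox N L \<alpha> \<gamma> D X W e"
proof
  show "0 < L" "0 < \<alpha>" "0 < \<gamma>" by (fact L alpha gam)+
  show "X 1 j = X 0 j - \<alpha> *\<^sub>R W 1 j" if "j < N" for j
    by (simp add: X_0 X_Suc center_xi W_eq algebra_simps)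
  show "X (Suc (Suc n)) j = X (Suc n) j + dfl_beta \<rho> n *\<^sub>R (X (Suc n) j - X n j) - \<alpha> *\<^sub>R W (Suc (Suc n)) j"
    if "j < N" for n j
  proof -
    have "center N (xi (Suc n)) j = \<alpha> *\<^sub>R \<zeta> (Suc n) j - \<alpha> *\<^sub>R W (Suc (Suc n)) j"
      by (simp add: center_xi W_eq algebra_simps)
    then show ?thesis unfolding zeta_Suc[OF that] X_def by (simp add: algebra_simps)
  qed
  show "D (Suc n) \<le> (\<Sum>j<N. W (Suc n) j \<bullet> X (Suc n) j)
     - 1 / (2 * L) * (\<Sum>j<N. (norm (X (Suc n) j + e (Suc n) j))\<^sup>2) + \<delta> n" for n
  proof -
    have "(norm (center N xs j - center N (xi n) j - e (Suc n) j))\<^sup>2 = (norm (X (Suc n) j + e (Suc n) j))\<^sup>2" for j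
      unfolding X_Suc by (subst norm_minus_cancel[symmetric]) (simp add: algebra_simps)
    moreover have "W (Suc n) j \<bullet> (center N xs j - center N (xi n) j) = - (W (Suc n) j \<bullet> X (Suc n) j)" for j
      unfolding X_Suc by (simp add: inner_diff_right)
    ultimately show ?thesis
      using iterate_lower[OF phis, of n] by (simp add: D_def sum_negf)
  qed
  show "D (Suc (Suc n)) \<le> D (Suc n) - (\<Sum>j<N. W (Suc (Suc n)) j \<bullet> (X (Suc n) j - X (Suc (Suc n)) j))
     - 1 / (2 * L) * (\<Sum>j<N. (norm (X (Suc n) j - X (Suc (Suc n)) j - e (Suc (Suc n)) j))\<^sup>2)
     + \<delta> (Suc n)" for n
    using iterate_lower[of "xi n" "\<phi> n" "Suc n", OF phi(1)] by (simp add: D_def X_Suc)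
  show "1 / (2 * L) * (\<Sum>j<N. (norm (e (Suc n) j))\<^sup>2) \<le> \<delta> n" for n
  proof -
    have "1 / (2 * L) * (\<Sum>j<N. (norm (e (Suc n) j))\<^sup>2) \<le> 1 / (2 * L) * (\<Sum>j<N. (norm (p n j - xi n j))\<^sup>2)"
      using sum_norm_center_le[OF N, of "\<lambda>j. p n j - xi n j"] L by (intro mult_left_mono) (auto simp: e_def)
    also have "\<dots> = (\<Sum>j<N. 1 / (2 * L) * (norm (xi n j - p n j))\<^sup>2)"
      by (simp add: sum_distrib_left norm_minus_commute)
    also have "\<dots> \<le> (\<Sum>j<N. 1 / real N * \<delta> n)" by (intro sum_mono p_xi_le) auto
    also have "\<dots> = \<delta> n" using N by simp
    finally show ?thesis .
  qed
  show "1 / (2 * L) * (\<Sum>j<N. (norm (X (Suc n) j))\<^sup>2) \<le> D (Suc n)" for n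
  proof -
    \<comment> \<open>At the solution Fenchel-Young holds with equality, so the error is 0; as
      \<open>opt\<close> is the same point for every client, its centred part and with it the linear
      term vanish.\<close>
    have "\<phi>s j + opt \<bullet> (xi n j - xs j) - 0 + 1 / (2 * L) * (norm (xi n j - xs j))\<^sup>2 \<le> \<phi> n j" if "j < N" for j
      unfolding xs_def
      by (rule conjugate_strong_convexity[OF L upper[OF that] phi(1)[OF that]]) (simp add: \<phi>s_def xs_def)
    note breg = this
    have const: "avg N (\<lambda>_. opt) = opt" using N by (simp add: avg_def sum_constant_scaleR)
    have "dual_energy N \<alpha> \<phi>s xs + (\<Sum>j<N. center N (\<lambda>_. opt) j \<bullet> (center N (xi n) j - center N xs j)) - (\<Sum>j<N. 0)
     + 1 / (2 * L) * (\<Sum>j<N. (norm (center N (xi n) j - center N xs j))\<^sup>2) \<le> dual_energy N \<alpha> (\<phi> n) (xi n)"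
      by (rule dual_energy_lower[OF N alpha L breg]) (simp_all add: const avg_xs)
    moreover have "center N (\<lambda>_. opt) j = 0" for j by (simp add: center_def const)
    ultimately show ?thesis by (simp add: D_def X_Suc)
  qed
qed

text \<open>Let \<open>H\<close> be the gradient of the regularised average. The wanted gradient is
  \<open>H - \<alpha> \<theta>\<close>, and strong monotonicity bounds
  \<open>\<alpha> * |\<theta> - opt|\<close> by |H| once more, whence the factor 2.\<close>

lemma grad_avg_le:
  "norm (avg N (\<lambda>j. G j (\<theta> (Suc n))))
     \<le> 2 * (L * sqrt (\<Sum>j<N. (norm (W (Suc n) j))\<^sup>2) + sqrt (2 * L * \<delta> n)) + \<alpha> * norm opt"
proof -
  define H where "H x = avg N (\<lambda>j. G j x) + \<alpha> *\<^sub>R x" for x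
  define B where "B = L * sqrt (\<Sum>j<N. (norm (W (Suc n) j))\<^sup>2) + sqrt (2 * L * \<delta> n)"
  have d0: "0 \<le> \<delta> n" using alpha L gam by (intro zero_le_power divide_nonneg_pos) auto
  have "norm (G j (\<theta> (Suc n)) - xi n j) \<le> B" if j: "j < N" for j
  proof -
    have "norm (G j (\<theta> (Suc n)) - G j (th (Suc n) j)) \<le> L * norm (W (Suc n) j)"
      using lip[OF j, of "\<theta> (Suc n)" "th (Suc n) j"] by (simp add: W_eq norm_minus_commute)
    also have "\<dots> \<le> L * sqrt (\<Sum>j<N. (norm (W (Suc n) j))\<^sup>2)"
    proof (intro mult_left_mono real_le_rsqrt)
      show "(norm (W (Suc n) j))\<^sup>2 \<le> (\<Sum>j<N. (norm (W (Suc n) j))\<^sup>2)"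
        using j by (intro member_le_sum) auto
    qed (use L in auto)
    finally have 1: "norm (G j (\<theta> (Suc n)) - G j (th (Suc n) j)) \<le> L * sqrt (\<Sum>j<N. (norm (W (Suc n) j))\<^sup>2)" .
    have "1 / (2 * L) * (norm (xi n j - p n j))\<^sup>2 \<le> 1 * \<delta> n"
      using p_xi_le[OF j, of n] N d0
      by (elim order_trans, intro mult_right_mono) auto
    then have "(norm (xi n j - p n j))\<^sup>2 \<le> 2 * L * \<delta> n" using L by (simp add: field_simps)
    then have "norm (p n j - xi n j) \<le> sqrt (2 * L * \<delta> n)"
      by (intro real_le_rsqrt) (simp add: norm_minus_commute)
    with 1 show ?thesis
      using norm_triangle_ineq[of "G j (\<theta> (Suc n)) - G j (th (Suc n) j)" "p n j - xi n j"]
      by (simp add: B_def p_def)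
  qed
  then have "norm (\<Sum>j<N. G j (\<theta> (Suc n)) - xi n j) \<le> real N * B"
    using sum_bounded_above[of "{..<N}" "\<lambda>j. norm (G j (\<theta> (Suc n)) - xi n j)" B]
    by (intro order_trans[OF norm_sum]) auto
  then have "norm (avg N (\<lambda>j. G j (\<theta> (Suc n)) - xi n j)) \<le> B"
    using N by (simp add: avg_def field_simps)
  then have HB: "norm (H (\<theta> (Suc n))) \<le> B" by (simp add: H_def avg_diff avg_xi)
  have H0: "H opt = 0" using avg_xs by (simp add: H_def xs_def[abs_def])
  have "\<alpha> * norm (\<theta> (Suc n) - opt) \<le> norm (H (\<theta> (Suc n)))"
    using reg_strong_mono[OF alpha, of "\<theta> (Suc n)" opt] H0 by (simp add: H_def)
  moreover have "norm (avg N (\<lambda>j. G j (\<theta> (Suc n)))) \<le> norm (H (\<theta> (Suc n))) + \<alpha> * norm (\<theta> (Suc n))"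
    using norm_triangle_ineq4[of "H (\<theta> (Suc n))" "\<alpha> *\<^sub>R \<theta> (Suc n)"] alpha by (simp add: H_def)
  moreover have "\<alpha> * norm (\<theta> (Suc n)) \<le> \<alpha> * (norm (\<theta> (Suc n) - opt) + norm opt)"
    using norm_triangle_ineq[of "\<theta> (Suc n) - opt" opt] alpha by (intro mult_left_mono) auto
  ultimately show ?thesis using HB unfolding B_def[symmetric] by (simp add: distrib_left)
qed

text \<open>The bound depends on \<alpha> only through R, so one \<open>A\<close> serves all
  regularisation parameters.\<close>

lemma X_0_le:
  assumes "norm opt \<le> R"
  shows "(\<Sum>j<N. (norm (X 0 j))\<^sup>2) \<le> (\<Sum>j<N. (norm (G j 0) + L * R)\<^sup>2)"
proof -
  have "(\<Sum>j<N. (norm (X 0 j))\<^sup>2) \<le> (\<Sum>j<N. (norm (xs j))\<^sup>2)"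
    using sum_norm_center_le[OF N, of xs] by (simp add: X_0)
  also have "\<dots> \<le> (\<Sum>j<N. (norm (G j 0) + L * R)\<^sup>2)"
  proof (intro sum_mono power_mono)
    fix j assume "j \<in> {..<N}"
    then have "norm (xs j - G j 0) \<le> L * norm opt" using lip[of j opt 0] by (simp add: xs_def)
    also have "\<dots> \<le> L * R" using assms L by (intro mult_left_mono) auto
    finally show "norm (xs j) \<le> norm (G j 0) + L * R"
      using norm_triangle_sub[of "xs j" "G j 0"] by simp
  qed auto
  finally show ?thesis .
qed

end

section \<open>Rates\<close>

context dualfl
begin

lemma grad_bound:
  assumes w: "(\<Sum>j<N. (norm (W (Suc n) j))\<^sup>2) \<le> B * y\<^sup>2" and d: "\<delta> n \<le> B' * y\<^sup>2"
    and "0 \<le> y" "0 \<le> B" "0 \<le> B'"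
  shows "norm (grad (\<lambda>x. 1 / real N * (\<Sum>j<N. f j x)) (\<theta> (Suc n)))
     \<le> 2 * (L * sqrt B + sqrt (2 * L * B')) * y + \<alpha> * norm opt"
proof -
  have "sqrt (\<Sum>j<N. (norm (W (Suc n) j))\<^sup>2) \<le> sqrt (B * y\<^sup>2)" using w by simp
  also have "\<dots> = sqrt B * y" using assms by (simp add: real_sqrt_mult)
  finally have 1: "L * sqrt (\<Sum>j<N. (norm (W (Suc n) j))\<^sup>2) \<le> L * (sqrt B * y)"
    using L by (intro mult_left_mono) auto
  have "2 * L * \<delta> n \<le> 2 * L * (B' * y\<^sup>2)" using d L by (intro mult_left_mono) auto
  then have "sqrt (2 * L * \<delta> n) \<le> sqrt (2 * L * B' * y\<^sup>2)"
    by (intro real_sqrt_le_mono) (simp only: mult.assoc)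
  also have "\<dots> = sqrt (2 * L * B') * y" using assms by (simp add: real_sqrt_mult)
  finally show ?thesis
    using grad_avg_le[of n] 1 unfolding grad_eq[OF GDERIV_avg] by (simp add: algebra_simps)
qed

lemma rate: "0 < sqrt \<rho>" "sqrt \<rho> < 1" "0 \<le> \<delta> n" "\<delta> n \<le> (1 - sqrt \<rho>) ^ n"
proof -
  show r: "0 < sqrt \<rho>" "sqrt \<rho> < 1" using alpha L by auto
  then show "0 \<le> \<delta> n" using gam by (intro zero_le_power divide_nonneg_pos) auto
  have "(1 - sqrt \<rho>) / (1 + \<gamma>) \<le> (1 - sqrt \<rho>) / 1"
    using r gam by (intro divide_left_mono) auto
  then show "\<delta> n \<le> (1 - sqrt \<rho>) ^ n" using r gam by (intro power_mono) auto
qed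

lemma linear_rate:
  "\<exists>C>0. \<forall>n. norm (grad (\<lambda>x. 1 / real N * (\<Sum>j<N. f j x)) (\<theta> n))
     \<le> C * ((1 - sqrt \<rho>) powr (real n / 2) + \<alpha> * norm opt)"
proof -
  define s where "s = 1 - sqrt \<rho>"
  have s: "0 < s" "s < 1" using rate(1,2) by (auto simp: s_def)
  \<comment> \<open>The interval degenerates to the single value \<alpha>, since here the constant
    may depend on \<alpha>.\<close>
  obtain C where "0 < C" and unif: "\<And>N' \<nu> D (X' :: nat \<Rightarrow> nat \<Rightarrow> 'a) W e n.
      inexact_accel_prox N' L \<nu> \<gamma> D X' W e \<Longrightarrow> \<alpha> \<le> \<nu> \<Longrightarrow> \<nu> \<le> \<alpha> \<Longrightarrow>
      (\<Sum>j<N'. (norm (X' 0 j))\<^sup>2) \<le> (\<Sum>j<N. (norm (X 0 j))\<^sup>2) \<Longrightarrow>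
      (\<Sum>j<N'. (norm (W (Suc n) j))\<^sup>2) \<le> C * (1 - sqrt (\<nu> / (L + \<nu>))) ^ n"
    by (rule residual_le_uniform[OF L gam alpha, where ?\<nu>2.0 = \<alpha> and A = "\<Sum>j<N. (norm (X 0 j))\<^sup>2" and 'a = 'a])
      (rule that)
  then have C: "0 < C" "\<And>n. (\<Sum>j<N. (norm (W (Suc n) j))\<^sup>2) \<le> C * s ^ n"
    using unif[OF accel_prox order_refl order_refl order_refl] by (auto simp: s_def)
  define K where "K = 2 * (L * sqrt C + sqrt (2 * L * 1)) / s powr (1/2)"
  \<comment> \<open>The residual bounds start at \<open>\<theta> 1\<close>, so the gradient at the
    initial point goes into the constant separately.\<close>
  define g0 where "g0 = norm (grad (\<lambda>x. 1 / real N * (\<Sum>j<N. f j x)) (\<theta> 0))"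
  have K: "0 \<le> K" using L C s by (simp add: K_def)
  show ?thesis
  proof (intro exI[of _ "K + g0 + 1"] conjI allI)
    show "0 < K + g0 + 1" using K by (simp add: g0_def add_nonneg_pos)
    have a0: "0 \<le> \<alpha> * norm opt" using alpha by simp
    fix n
    have g0: "0 \<le> g0" by (simp add: g0_def)
    show "norm (grad (\<lambda>x. 1 / real N * (\<Sum>j<N. f j x)) (\<theta> n))
       \<le> (K + g0 + 1) * ((1 - sqrt \<rho>) powr (real n / 2) + \<alpha> * norm opt)"
    proof (cases n)
      case 0
      have "g0 * 1 \<le> (K + g0 + 1) * (1 + \<alpha> * norm opt)"
        using K a0 g0 by (intro mult_mono) auto
      then show ?thesis using 0 s by (simp add: g0_def s_def[symmetric])
    next
      case (Suc m)
      define y where "y = s powr (real m / 2)"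
      have y: "y\<^sup>2 = s ^ m" "0 \<le> y"
        using s by (auto simp: y_def powr_power powr_realpow)
      have sn: "y = s powr (real n / 2) / s powr (1/2)"
        using s by (simp add: y_def Suc powr_diff[symmetric] diff_divide_distrib[symmetric])
      have "norm (grad (\<lambda>x. 1 / real N * (\<Sum>j<N. f j x)) (\<theta> n))
        \<le> 2 * (L * sqrt C + sqrt (2 * L * 1)) * y + \<alpha> * norm opt"
        unfolding Suc using C rate(4)[of m] y by (intro grad_bound) (auto simp: s_def[symmetric])
      also have "\<dots> = K * s powr (real n / 2) + 1 * (\<alpha> * norm opt)" by (simp add: K_def sn)
      also have "\<dots> \<le> (K + g0 + 1) * s powr (real n / 2) + (K + g0 + 1) * (\<alpha> * norm opt)"
        using K g0 a0 by (intro add_mono mult_right_mono) auto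
      finally show ?thesis by (simp add: s_def distrib_left)
    qed
  qed
qed

end

section \<open>Communication complexity, uniformly in the accuracy\<close>

context smooth_convex_sum
begin

text \<open>The budget is \<open>2 * s / r\<close> rounds, rounded up, and \<open>7 \<le> s\<close>
  yields the 14 required by the window estimate. Small r uses the window; for larger r the parameter
  stays above \<open>\<nu>1\<close> and the last index of the budget will do.\<close>

lemma uniform_window:
  assumes gam: "0 < \<gamma>" and \<alpha>0: "0 < \<alpha>0" and R0: "0 < R0"
  obtains B where "0 < B" and
    "\<And>\<epsilon> th s. 0 < \<epsilon> \<Longrightarrow> \<epsilon> \<le> 2 * R0 * \<alpha>0 \<Longrightarrow> dualfl N f G L (\<epsilon> / (2 * R0)) \<gamma> th \<Longrightarrow>
       norm (dualfl.opt N f (\<epsilon> / (2 * R0))) \<le> R0 \<Longrightarrow> 7 \<le> s \<Longrightarrow> ln (1 / \<epsilon>) \<le> s \<Longrightarrow>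
       \<exists>n. real (Suc n) \<le> 1 + 2 * sqrt (1 + 2 * L * R0 / \<epsilon>) * s \<and>
         (\<Sum>j<N. (norm (dualfl.W N th (Suc n) j))\<^sup>2) \<le> B * (exp (- s))\<^sup>2 \<and>
         (1 - sqrt (\<epsilon> / (2 * R0) / (L + \<epsilon> / (2 * R0)))) ^ n \<le> exp 2 * (exp (- s))\<^sup>2"
proof -
  define A where "A = (\<Sum>j<N. (norm (G j 0) + L * R0)\<^sup>2)"
  obtain r1 C2 where r1: "0 < r1" and C2: "0 < C2" and
    small: "\<And>N \<nu> D (X :: nat \<Rightarrow> nat \<Rightarrow> 'a) W e M.
      inexact_accel_prox N L \<nu> \<gamma> D X W e \<Longrightarrow> sqrt (\<nu> / (L + \<nu>)) \<le> r1 \<Longrightarrow> \<nu> \<le> \<alpha>0 \<Longrightarrow>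
      (\<Sum>j<N. (norm (X 0 j))\<^sup>2) \<le> A \<Longrightarrow> 14 \<le> sqrt (\<nu> / (L + \<nu>)) * real M \<Longrightarrow>
      \<exists>n<M. sqrt (\<nu> / (L + \<nu>)) * (real M - real n) \<le> 2 \<and>
        (\<Sum>j<N. (norm (W (Suc n) j))\<^sup>2)
          \<le> C2 / sqrt (\<nu> / (L + \<nu>)) * exp (- 5/4 * sqrt (\<nu> / (L + \<nu>)) * real M)"
    by (rule window_residual_uniform[OF L gam, where ?\<nu>2.0 = \<alpha>0 and A = A and 'a = 'a]) (rule that)
  define \<nu>1 where "\<nu>1 = L * r1\<^sup>2"
  have \<nu>1: "0 < \<nu>1" using L r1 by (simp add: \<nu>1_def)
  obtain C1 where C1: "0 < C1" and
    large: "\<And>N \<nu> D (X :: nat \<Rightarrow> nat \<Rightarrow> 'a) W e n.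
      inexact_accel_prox N L \<nu> \<gamma> D X W e \<Longrightarrow> \<nu>1 \<le> \<nu> \<Longrightarrow> \<nu> \<le> \<alpha>0 \<Longrightarrow>
      (\<Sum>j<N. (norm (X 0 j))\<^sup>2) \<le> A \<Longrightarrow>
      (\<Sum>j<N. (norm (W (Suc n) j))\<^sup>2) \<le> C1 * (1 - sqrt (\<nu> / (L + \<nu>))) ^ n"
    by (rule residual_le_uniform[OF L gam \<nu>1, where ?\<nu>2.0 = \<alpha>0 and A = A and 'a = 'a]) (rule that)
  define Q where "Q = sqrt (2 * R0 * (L + \<alpha>0))"
  have Q: "0 < Q" using L \<alpha>0 R0 by (simp add: Q_def)
  define B where "B = C2 * Q + C1 * exp 2"
  show ?thesis
  proof (rule that[of B])
    show "0 < B" using C1 C2 Q by (simp add: B_def add_pos_pos)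
    fix \<epsilon> s :: real and th
    define \<nu> where "\<nu> = \<epsilon> / (2 * R0)"
    assume \<epsilon>: "0 < \<epsilon>" "\<epsilon> \<le> 2 * R0 * \<alpha>0" and "dualfl N f G L (\<epsilon> / (2 * R0)) \<gamma> th"
      and opt: "norm (dualfl.opt N f (\<epsilon> / (2 * R0))) \<le> R0" and s: "7 \<le> s" "ln (1 / \<epsilon>) \<le> s"
    then interpret dualfl N f G L \<nu> \<gamma> th by (simp add: \<nu>_def)
    define r where "r = sqrt (\<nu> / (L + \<nu>))"
    have r: "0 < r" "r < 1" using rate(1,2) by (auto simp: r_def)
    have \<nu>: "0 < \<nu>" "\<nu> \<le> \<alpha>0" using \<epsilon> R0 by (auto simp: \<nu>_def field_simps)
    have X0: "(\<Sum>j<N. (norm (X 0 j))\<^sup>2) \<le> A"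
      unfolding A_def using opt by (intro X_0_le) (simp add: \<nu>_def)
    have inv_r: "sqrt (1 + 2 * L * R0 / \<epsilon>) = 1 / r"
    proof -
      have "1 + 2 * L * R0 / \<epsilon> = (L + \<nu>) / \<nu>" using \<epsilon> R0 by (simp add: \<nu>_def field_simps)
      then show ?thesis by (simp add: r_def real_sqrt_divide)
    qed
    define M where "M = nat \<lceil>2 / r * s\<rceil>"
    have "0 \<le> 2 / r * s" using r s by simp
    then have "real M = of_int \<lceil>2 / r * s\<rceil>" by (simp add: M_def)
    then have "2 / r * s \<le> real M" and M2: "real M \<le> 1 + 2 / r * s"
      using le_of_int_ceiling[of "2 / r * s"] of_int_ceiling_le_add_one[of "2 / r * s"] by linarith+
    then have M: "2 * s \<le> r * real M" using r by (simp add: field_simps)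
    have es: "exp (- (2 * s)) = (exp (- s))\<^sup>2" using exp_double[of "- s"] by simp
    \<comment> \<open>The index found lies within \<open>2 / r\<close> of the end of the budget, so
      the inexactness at that same index is still of order \<open>exp (- 2 * s)\<close>.\<close>
    have decay: "(1 - r) ^ n \<le> exp 2 * (exp (- s))\<^sup>2" if "r * (real M - real n) \<le> 2" for n
    proof -
      have "(1 - r) ^ n \<le> exp (- r * real n)" using r by (intro one_minus_power_le_exp) auto
      also have "\<dots> \<le> exp (2 + - (2 * s))" using that M by (simp add: algebra_simps)
      finally show ?thesis by (simp only: exp_add es)
    qed
    have "\<exists>n<M. r * (real M - real n) \<le> 2 \<and> (\<Sum>j<N. (norm (W (Suc n) j))\<^sup>2) \<le> B * (exp (- s))\<^sup>2"
    proof (cases "r \<le> r1")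
      case True
      obtain n where n: "n < M" "r * (real M - real n) \<le> 2"
        "(\<Sum>j<N. (norm (W (Suc n) j))\<^sup>2) \<le> C2 / r * exp (- 5/4 * r * real M)"
        using small[OF accel_prox _ \<nu>(2) X0, of M] True M s unfolding r_def[symmetric] by auto
      \<comment> \<open>The loss \<open>1 / r\<close> is of order
        \<open>\<epsilon> powr (- 1/2)\<close>, at most a multiple of \<open>exp (s / 2)\<close>:
        just the surplus of \<open>exp (- 5/2 * s)\<close> over
        \<open>exp (- 2 * s)\<close>.\<close>
      have "1 / r \<le> Q * exp (s / 2)"
      proof -
        have "1 / r = sqrt ((L + \<nu>) / \<nu>)" by (simp add: r_def real_sqrt_divide)
        also have "\<dots> \<le> sqrt (2 * R0 * (L + \<alpha>0) * exp s)"
        proof (rule real_sqrt_le_mono)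
          have "1 / \<epsilon> = exp (ln (1 / \<epsilon>))" using \<epsilon> by simp
          also have "\<dots> \<le> exp s" using s(2) by (simp only: exp_le_cancel_iff)
          finally have e: "1 / \<epsilon> \<le> exp s" .
          have "(L + \<nu>) / \<nu> = 2 * R0 * (L + \<nu>) * (1 / \<epsilon>)" using R0 by (simp add: \<nu>_def)
          also have "\<dots> \<le> 2 * R0 * (L + \<alpha>0) * exp s"
            using e \<epsilon> \<nu> R0 L by (intro mult_mono) auto
          finally show "(L + \<nu>) / \<nu> \<le> 2 * R0 * (L + \<alpha>0) * exp s" .
        qed
        also have "\<dots> = Q * exp (s / 2)"
        proof -
          have "sqrt (exp s) = exp (s / 2)"
            using exp_double[of "s / 2"] by (intro real_sqrt_unique) auto
          then show ?thesis by (simp add: Q_def real_sqrt_mult)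
        qed
        finally show ?thesis .
      qed
      moreover have "exp (- 5/4 * r * real M) \<le> exp (- (5/2 * s))" using M by simp
      ultimately have "C2 * (1 / r) * exp (- 5/4 * r * real M) \<le> C2 * (Q * exp (s / 2)) * exp (- (5/2 * s))"
        using C2 r Q by (intro mult_mono) auto
      also have "\<dots> = C2 * Q * exp (s / 2 + - (5/2 * s))" by (simp only: exp_add mult.assoc)
      also have "s / 2 + - (5/2 * s) = - (2 * s)" by simp
      also have "C2 * Q * exp (- (2 * s)) \<le> B * (exp (- s))\<^sup>2"
        unfolding es B_def using C1 by (intro mult_right_mono) auto
      finally show ?thesis using n by (intro exI[of _ n]) auto
    next
      case False
      have "\<nu>1 \<le> \<nu>"
      proof (rule ccontr)
        assume "\<not> \<nu>1 \<le> \<nu>"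
        moreover have "0 \<le> \<nu> * r1\<^sup>2" using \<nu> by simp
        ultimately have "\<nu> \<le> r1\<^sup>2 * (L + \<nu>)" by (simp add: \<nu>1_def algebra_simps)
        then have "\<nu> / (L + \<nu>) \<le> r1\<^sup>2" using L \<nu> by (simp add: divide_le_eq)
        then have "r \<le> sqrt (r1\<^sup>2)" unfolding r_def by (rule real_sqrt_le_mono)
        then show False using False r1 by simp
      qed
      have "M \<noteq> 0" using M s by (intro notI) simp
      define n where "n = M - 1"
      have n: "n < M" "real M - real n = 1" using \<open>M \<noteq> 0\<close> by (auto simp: n_def)
      have d: "(1 - r) ^ n \<le> exp 2 * (exp (- s))\<^sup>2" using n r by (intro decay) auto
      have "(\<Sum>j<N. (norm (W (Suc n) j))\<^sup>2) \<le> C1 * (1 - r) ^ n"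
        using large[OF accel_prox \<open>\<nu>1 \<le> \<nu>\<close> \<nu>(2) X0] by (simp add: r_def)
      also have "\<dots> \<le> C1 * (exp 2 * (exp (- s))\<^sup>2)" using d C1 by (intro mult_left_mono) auto
      also have "\<dots> \<le> B * (exp (- s))\<^sup>2"
        unfolding B_def mult.assoc[symmetric] using C2 Q by (intro mult_right_mono) auto
      finally show ?thesis using n r by (intro exI[of _ n]) auto
    qed
    then obtain n where n: "n < M" "r * (real M - real n) \<le> 2"
      "(\<Sum>j<N. (norm (W (Suc n) j))\<^sup>2) \<le> B * (exp (- s))\<^sup>2" by blast
    show "\<exists>n. real (Suc n) \<le> 1 + 2 * sqrt (1 + 2 * L * R0 / \<epsilon>) * s \<and>
         (\<Sum>j<N. (norm (W (Suc n) j))\<^sup>2) \<le> B * (exp (- s))\<^sup>2 \<and>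
         (1 - sqrt (\<epsilon> / (2 * R0) / (L + \<epsilon> / (2 * R0)))) ^ n \<le> exp 2 * (exp (- s))\<^sup>2"
    proof (intro exI[of _ n] conjI)
      have "real (Suc n) \<le> real M" using n by simp
      then show "real (Suc n) \<le> 1 + 2 * sqrt (1 + 2 * L * R0 / \<epsilon>) * s" using M2 by (simp add: inv_r)
      show "(1 - sqrt (\<epsilon> / (2 * R0) / (L + \<epsilon> / (2 * R0)))) ^ n \<le> exp 2 * (exp (- s))\<^sup>2"
        using decay[OF n(2)] by (simp only: r_def \<nu>_def)
    qed (fact n)
  qed
qed

lemma communication_complexity:
  assumes gam: "0 < \<gamma>" and \<alpha>0: "0 < \<alpha>0" and R0: "0 < R0"
    and bound: "\<forall>\<alpha>\<in>{0<..\<alpha>0}. norm (minimizer (\<lambda>x. 1 / real N * (\<Sum>j<N. f j x + \<alpha> / 2 * (norm x)\<^sup>2))) \<le> R0"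
  shows "\<exists>K. \<forall>\<epsilon>\<in>{0<..2 * R0 * \<alpha>0}. \<forall>th.
      dfl_run N (\<lambda>j x. f j x + (\<epsilon> / (2 * R0)) / 2 * (norm x)\<^sup>2)
        ((\<epsilon> / (2 * R0)) / (L + \<epsilon> / (2 * R0))) (\<epsilon> / (2 * R0)) \<gamma> th \<longrightarrow>
      (\<exists>n. real n \<le> (1 + 2 * sqrt (1 + 2 * L * R0 / \<epsilon>)) * (ln (1 / \<epsilon>) + K) \<and>
        norm (grad (\<lambda>x. 1 / real N * (\<Sum>j<N. f j x)) (dfl_theta N th n)) \<le> \<epsilon>)"
proof -
  obtain B where B: "0 < B" and win: "\<And>\<epsilon> th s. 0 < \<epsilon> \<Longrightarrow> \<epsilon> \<le> 2 * R0 * \<alpha>0 \<Longrightarrow>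
       dualfl N f G L (\<epsilon> / (2 * R0)) \<gamma> th \<Longrightarrow>
       norm (dualfl.opt N f (\<epsilon> / (2 * R0))) \<le> R0 \<Longrightarrow> 7 \<le> s \<Longrightarrow> ln (1 / \<epsilon>) \<le> s \<Longrightarrow>
       \<exists>n. real (Suc n) \<le> 1 + 2 * sqrt (1 + 2 * L * R0 / \<epsilon>) * s \<and>
         (\<Sum>j<N. (norm (dualfl.W N th (Suc n) j))\<^sup>2) \<le> B * (exp (- s))\<^sup>2 \<and>
         (1 - sqrt (\<epsilon> / (2 * R0) / (L + \<epsilon> / (2 * R0)))) ^ n \<le> exp 2 * (exp (- s))\<^sup>2"
    by (rule uniform_window[OF gam \<alpha>0 R0]) (rule that)
  define c where "c = 2 * (L * sqrt B + sqrt (2 * L * exp 2))"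
  have c: "0 < c" using L B by (simp add: c_def add_pos_pos)
  \<comment> \<open>\<open>ln (2 * c)\<close> makes the iteration error at most \<epsilon> / 2, the
    other half being reserved for the regularisation bias \<open>\<nu> * R0\<close>. The last entry
    guarantees \<open>7 \<le> s\<close> for every admissible \<epsilon>, even when
    \<open>ln (1 / \<epsilon>)\<close> is negative.\<close>
  define K where "K = max (max 0 (ln (2 * c))) (7 + ln (2 * R0 * \<alpha>0))"
  show ?thesis
  proof (intro exI[of _ K] ballI allI impI)
    fix \<epsilon> th assume "\<epsilon> \<in> {0<..2 * R0 * \<alpha>0}"
      and run: "dfl_run N (\<lambda>j x. f j x + (\<epsilon> / (2 * R0)) / 2 * (norm x)\<^sup>2)
        ((\<epsilon> / (2 * R0)) / (L + \<epsilon> / (2 * R0))) (\<epsilon> / (2 * R0)) \<gamma> th"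
    then have \<epsilon>: "0 < \<epsilon>" "\<epsilon> \<le> 2 * R0 * \<alpha>0" by auto
    define \<nu> where "\<nu> = \<epsilon> / (2 * R0)"
    have \<nu>: "0 < \<nu>" "\<nu> \<le> \<alpha>0" using \<epsilon> R0 by (auto simp: \<nu>_def field_simps)
    interpret dualfl N f G L \<nu> \<gamma> th
      by unfold_locales (use \<nu> gam run in \<open>auto simp: \<nu>_def\<close>)
    have opt: "norm opt \<le> R0" unfolding opt_def using bound \<nu> by simp
    define s where "s = ln (1 / \<epsilon>) + K"
    have "ln \<epsilon> \<le> ln (2 * R0 * \<alpha>0)" using \<epsilon> by (subst ln_le_cancel_iff) auto
    moreover have "7 + ln (2 * R0 * \<alpha>0) \<le> K" "0 \<le> K" by (auto simp: K_def)
    moreover have "ln (1 / \<epsilon>) = - ln \<epsilon>" using \<epsilon> by (simp add: ln_div)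
    ultimately have s: "7 \<le> s" "ln (1 / \<epsilon>) \<le> s" unfolding s_def by linarith+
    obtain n where n: "real (Suc n) \<le> 1 + 2 * sqrt (1 + 2 * L * R0 / \<epsilon>) * s"
      "(\<Sum>j<N. (norm (W (Suc n) j))\<^sup>2) \<le> B * (exp (- s))\<^sup>2"
      "(1 - sqrt \<rho>) ^ n \<le> exp 2 * (exp (- s))\<^sup>2"
      using win[OF \<epsilon> _ _ s, folded \<nu>_def, OF dualfl_axioms opt] by blast
    have "norm (grad (\<lambda>x. 1 / real N * (\<Sum>j<N. f j x)) (\<theta> (Suc n))) \<le> c * exp (- s) + \<nu> * norm opt"
      unfolding c_def using n rate(4)[of n] B by (intro grad_bound) auto
    also have "\<nu> * norm opt \<le> \<nu> * R0" using opt \<nu> by (intro mult_left_mono) auto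
    also have "\<nu> * R0 = \<epsilon> / 2" using R0 by (simp add: \<nu>_def)
    also have "c * exp (- s) \<le> \<epsilon> / 2"
    proof -
      have "exp (- s) = \<epsilon> * exp (- K)"
        using \<epsilon> by (simp add: s_def exp_add exp_diff ln_div exp_minus field_simps)
      moreover have "2 * c \<le> exp K"
      proof -
        have "2 * c = exp (ln (2 * c))" using c by simp
        also have "\<dots> \<le> exp K" by (simp only: exp_le_cancel_iff) (simp add: K_def)
        finally show ?thesis .
      qed
      ultimately show ?thesis using \<epsilon> by (simp add: exp_minus field_simps)
    qed
    finally have "norm (grad (\<lambda>x. 1 / real N * (\<Sum>j<N. f j x)) (\<theta> (Suc n))) \<le> \<epsilon>" by simp
    \<comment> \<open>The 1 lost in rounding up the budget is absorbed by the summand 1 of the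
      factor, since \<open>1 \<le> s\<close>.\<close>
    moreover have "real (Suc n) \<le> (1 + 2 * sqrt (1 + 2 * L * R0 / \<epsilon>)) * (ln (1 / \<epsilon>) + K)"
      using n(1) s(1) unfolding s_def[symmetric] distrib_right by linarith
    ultimately show "\<exists>n. real n \<le> (1 + 2 * sqrt (1 + 2 * L * R0 / \<epsilon>)) * (ln (1 / \<epsilon>) + K) \<and>
        norm (grad (\<lambda>x. 1 / real N * (\<Sum>j<N. f j x)) (\<theta> n)) \<le> \<epsilon>" by blast
  qed
qed

end

theorem theorem4p2:
  fixes N :: nat and f :: "nat \<Rightarrow> 'a::euclidean_space \<Rightarrow> real" and L \<gamma> :: real
  assumes N: "N \<ge> 1"
    and L: "L > 0"
    and gam: "\<gamma> > 0"
    and cvx: "\<forall>j<N. convex_on UNIV (f j)"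
    and smooth: "\<forall>j<N. L_smooth (f j) L"
    and coercive: "filterlim (\<lambda>x. (1 / real N) * (\<Sum>j<N. f j x)) at_top at_infinity"
  shows
   "(\<forall>\<alpha>>0. \<forall>th.
       dfl_run N (\<lambda>j x. f j x + \<alpha> / 2 * (norm x)\<^sup>2) (\<alpha> / (L + \<alpha>)) \<alpha> \<gamma> th \<longrightarrow>
       (\<exists>C>0. \<forall>n.
          norm (grad (\<lambda>x. (1 / real N) * (\<Sum>j<N. f j x)) (dfl_theta N th n))
          \<le> C * ((1 - sqrt (\<alpha> / (L + \<alpha>))) powr (real n / 2)
                 + \<alpha> * norm (minimizer (\<lambda>x. (1 / real N) * (\<Sum>j<N. f j x + \<alpha> / 2 * (norm x)\<^sup>2))))))
    \<and>
    (\<forall>\<alpha>0>0. \<forall>R0>0.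
       (\<forall>\<alpha>\<in>{0<..\<alpha>0}.
          norm (minimizer (\<lambda>x. (1 / real N) * (\<Sum>j<N. f j x + \<alpha> / 2 * (norm x)\<^sup>2))) \<le> R0) \<longrightarrow>
       (\<exists>K. \<forall>\<epsilon>\<in>{0<..2 * R0 * \<alpha>0}. \<forall>th.
          dfl_run N (\<lambda>j x. f j x + (\<epsilon> / (2 * R0)) / 2 * (norm x)\<^sup>2)
                  ((\<epsilon> / (2 * R0)) / (L + \<epsilon> / (2 * R0))) (\<epsilon> / (2 * R0)) \<gamma> th \<longrightarrow>
          (\<exists>n. real n \<le> (1 + 2 * sqrt (1 + 2 * L * R0 / \<epsilon>)) * (ln (1 / \<epsilon>) + K) \<and>
               norm (grad (\<lambda>x. (1 / real N) * (\<Sum>j<N. f j x)) (dfl_theta N th n)) \<le> \<epsilon>)))"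
proof -
  have "\<forall>j. \<exists>g. j < N \<longrightarrow> (\<forall>x. GDERIV (f j) x :> g x) \<and> (\<forall>x y. norm (g x - g y) \<le> L * norm (x - y))"
    using smooth unfolding L_smooth_def by blast
  then obtain G where G: "\<And>j. j < N \<Longrightarrow> (\<forall>x. GDERIV (f j) x :> G j x) \<and>
      (\<forall>x y. norm (G j x - G j y) \<le> L * norm (x - y))"
    by metis
  interpret smooth_convex_sum N f G L
    by unfold_locales (use N L cvx G coercive in auto)
  show ?thesis
  proof (intro conjI allI impI)
    fix \<alpha> :: real and th
    assume "0 < \<alpha>" and "dfl_run N (\<lambda>j x. f j x + \<alpha> / 2 * (norm x)\<^sup>2) (\<alpha> / (L + \<alpha>)) \<alpha> \<gamma> th"
    then interpret dualfl N f G L \<alpha> \<gamma> th by unfold_locales (use gam in auto)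
    show "\<exists>C>0. \<forall>n. norm (grad (\<lambda>x. (1 / real N) * (\<Sum>j<N. f j x)) (dfl_theta N th n))
        \<le> C * ((1 - sqrt (\<alpha> / (L + \<alpha>))) powr (real n / 2)
          + \<alpha> * norm (minimizer (\<lambda>x. (1 / real N) * (\<Sum>j<N. f j x + \<alpha> / 2 * (norm x)\<^sup>2))))"
      using linear_rate unfolding opt_def .
  qed (rule communication_complexity[OF gam])
qed

end
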